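(* Let $\Delta_1\subset\mathbb R^{m_1},\dots,\Delta_t\subset\mathbb R^{m_t}$ be full-dimensional simplices and $\mathbf c=(\mathbf c_1,\dots,\mathbf c_t)\in\mathbb R^{m_1+\dots+m_t}$ a generic direction (i.e. each $\mathbf c_s\in\mathbb R^{m_s}$ takes distinct values on the vertices of $\Delta_s$). Then the product slope map $\Theta$ is a piecewise linear isomorphism from the pivot fan $\mathcal F(\Delta_1\times\dots\times\Delta_t,\mathbf c)$ to the $(m_1,\dots,m_t)$-sylvester fan $\mathcal F_{m_1,\dots,m_t}$.
   Context: Let $m=\sum_sm_s$, $P=\Delta_1\times\dots\times\Delta_t\subset\mathbb R^m$. For a polytope $Q$ and direction $\mathbf b$ generic on edges: a vertex $\mathbf v$ is an improving neighbor of $\mathbf u$ if $\mathbf u\mathbf v$ is an edge and $\langle\mathbf b,\mathbf u\rangle<\langle\mathbf b,\mathbf v\rangle$; for distinct vertices and a vector $\boldsymbol\omega$, $\rho^{\boldsymbol\omega}(\mathbf u,\mathbf v)=\frac{\langle\boldsymbol\omega,\mathbf v-\mathbf u\rangle}{\langle\mathbf b,\mathbf v-\mathbf u\rangle}$ and $\tau^{\boldsymbol\omega}(\mathbf u)=\max\{\rho^{\boldsymbol\omega}(\mathbf u,\mathbf v):\mathbf v\text{ improving neighbor of }\mathbf u\}$, with $\tau^{\boldsymbol\omega}=-\infty$ at the $\mathbf b$-maximal vertex $\mathbf v_{\max}$. A direction $\boldsymbol\omega$ linearly independent of $\mathbf b$ is generic if at every non-maximal vertex $\mathbf u$ the maximum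 is attained by a unique improving neighbor $\mathcal A^{\boldsymbol\omega}(\mathbf u)$ (and $\mathcal A^{\boldsymbol\omega}(\mathbf v_{\max})=\mathbf v_{\max}$). The pivot fan $\mathcal F(Q,\mathbf b)$ is the complete polyhedral fan whose maximal cones are the closures of the fibers of $\boldsymbol\omega\mapsto\mathcal A^{\boldsymbol\omega}$ on generic $\boldsymbol\omega$. For each $s$, label the $m_s+1$ vertices of $\Delta_s$ as $\mathbf u^{(s)}_1,\dots,\mathbf u^{(s)}_{m_s+1}$ in increasing order of $\langle\mathbf c_s,\cdot\rangle$ and let $\theta_s(\boldsymbol\omega_s)=(\tau^{\boldsymbol\omega_s}(\mathbf u^{(s)}_i))_{i\in[m_s]}$ (for $(\Delta_s,\mathbf c_s)$). The product slope map is $\Theta(\boldsymbol\omega_1,\dots,\boldsymbol\omega_t)=(\theta_1(\boldsymbol\omega_1),\dots,\theta_t(\boldsymbol\omega_t))\in\mathbb R^m$ (concatenation), for $\boldsymbol\omega_s\in\mathbb R^{m_s}$. Let $M_s=\sum_{r\le s}m_r$ ($M_0=0$). For a permutation $\pi$ of $[m]$, $C(\pi)=\{\mathbf x\in\mathbb R^m:x_{\pi_1}<\dots<x_{\pi_m}\}$. The $(m_1,\dots,m_t)$-sylvester congruence is the equivalence relation on permutations of $[m]$ generated by $UjVikW\equiv UjVkiW$ for words $U,V,W$ and letters with $M_{s-1}<i<j<k\le M_s$ for some $s$. The $(m_1,\dots,m_t)$-sylvester fan $\mathcal F_{m_1,\dots,m_t}$ is the fan in $\mathbb R^m$ whose maximal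 cones are the closures of the unions of the regions $C(\pi)$ over the permutations $\pi$ in one congruence class (it is the normal fan of the shuffle of associahedra). A piecewise linear isomorphism from a fan $\mathcal F$ to a fan $\mathcal G$ is a continuous bijection that is linear on each cone of $\mathcal F$ and maps the cones of $\mathcal F$ bijectively onto the cones of $\mathcal G$. *)

theory Defs
  imports "HOL-Analysis.Analysis"
begin

section \<open>Fans and piecewise linear isomorphisms\<close>

definition complete_fan :: "'a::euclidean_space set set \<Rightarrow> bool" where
  "complete_fan F \<longleftrightarrow>
     finite F \<and>
     (\<forall>C\<in>F. C \<noteq> {} \<and> polyhedron C \<and> cone C) \<and>
     (\<forall>C\<in>F. \<forall>D. D face_of C \<and> D \<noteq> {} \<longrightarrow> D \<in> F) \<and>
     (\<forall>C\<in>F. \<forall>D\<in>F. (C \<inter> D) face_of C \<and> (C \<inter> D) face_of D) \<and>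
     \<Union>F = UNIV"

text \<open>The empty set is a face in the sense of \<^const>\<open>face_of\<close>, but it is not a cone of a fan.\<close>

definition fan_of_max_cones :: "'a::euclidean_space set set \<Rightarrow> 'a set set" where
  "fan_of_max_cones K = {D. D \<noteq> {} \<and> (\<exists>C\<in>K. D face_of C)}"

definition pl_isomorphism ::
  "('a::euclidean_space \<Rightarrow> 'b::euclidean_space) \<Rightarrow> 'a set set \<Rightarrow> 'b set set \<Rightarrow> bool" where
  "pl_isomorphism f F G \<longleftrightarrow>
     complete_fan F \<and> complete_fan G \<and>
     continuous_on UNIV f \<and> bij f \<and>
     (\<forall>C\<in>F. \<exists>L. linear L \<and> (\<forall>x\<in>C. f x = L x)) \<and>
     bij_betw (\<lambda>C. f ` C) F G"

section \<open>The pivot fan of a polytope\<close>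

definition vertices :: "'a::euclidean_space set \<Rightarrow> 'a set" where
  "vertices Q = {v. v extreme_point_of Q}"

definition improving_neighbors :: "'a::euclidean_space set \<Rightarrow> 'a \<Rightarrow> 'a \<Rightarrow> 'a set" where
  "improving_neighbors Q b u =
     {v \<in> vertices Q. closed_segment u v edge_of Q \<and> b \<bullet> u < b \<bullet> v}"

definition slope :: "'a::euclidean_space \<Rightarrow> 'a \<Rightarrow> 'a \<Rightarrow> 'a \<Rightarrow> real" where
  "slope b w u v = (w \<bullet> (v - u)) / (b \<bullet> (v - u))"

definition is_max_vertex :: "'a::euclidean_space set \<Rightarrow> 'a \<Rightarrow> 'a \<Rightarrow> bool" where
  "is_max_vertex Q b u \<longleftrightarrow> u \<in> vertices Q \<and> (\<forall>v\<in>vertices Q. b \<bullet> v \<le> b \<bullet> u)"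

definition max_slope :: "'a::euclidean_space set \<Rightarrow> 'a \<Rightarrow> 'a \<Rightarrow> 'a \<Rightarrow> ereal" where
  "max_slope Q b w u =
     (if is_max_vertex Q b u then - \<infinity>
      else ereal (Max (slope b w u ` improving_neighbors Q b u)))"

text \<open>
  On a line no direction is linearly independent of \<open>b\<close>; there the independence requirement is
  void, as otherwise no direction would be generic and the pivot fan would not be complete.
\<close>

definition generic_direction :: "'a::euclidean_space set \<Rightarrow> 'a \<Rightarrow> 'a \<Rightarrow> bool" where
  "generic_direction Q b w \<longleftrightarrow>
     (DIM('a) \<ge> 2 \<longrightarrow> w \<noteq> b \<and> independent {w, b}) \<and>
     (\<forall>u\<in>vertices Q. \<not> is_max_vertex Q b u \<longrightarrow>
        (\<exists>!v. v \<in> improving_neighbors Q b u \<and> ereal (slope b w u v) = max_slope Q b w u))"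

definition arborescence :: "'a::euclidean_space set \<Rightarrow> 'a \<Rightarrow> 'a \<Rightarrow> 'a \<Rightarrow> 'a" where
  "arborescence Q b w =
     (\<lambda>u\<in>vertices Q. if is_max_vertex Q b u then u
        else (THE v. v \<in> improving_neighbors Q b u \<and> ereal (slope b w u v) = max_slope Q b w u))"

definition pivot_fan :: "'a::euclidean_space set \<Rightarrow> 'a \<Rightarrow> 'a set set" where
  "pivot_fan Q b = fan_of_max_cones
     {closure {w. generic_direction Q b w \<and> arborescence Q b w = arborescence Q b w0} | w0.
        generic_direction Q b w0}"

section \<open>Products\<close>

text \<open>
  The index set \<open>[m]\<close> is a finite linearly ordered type \<open>'n\<close> with \<open>m\<close> elements, and
  \<open>\<real>\<^sup>m\<close> is \<^typ>\<open>real ^ 'n\<close>. The number \<open>pos i\<close> is the element of \<open>{1..m}\<close> corresponding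
  to \<open>i\<close>. The factor \<open>\<real>\<^bsup>m s\<^esup>\<close> is identified with the subspace of \<^typ>\<open>real ^ 'n\<close> of vectors supported on the coordinates in \<open>block m s\<close>.
\<close>

definition partial_sum :: "(nat \<Rightarrow> nat) \<Rightarrow> nat \<Rightarrow> nat" where
  "partial_sum m s = (\<Sum>r=1..s. m r)"

definition pos :: "'n::{finite,linorder} \<Rightarrow> nat" where
  "pos i = card {..i}"

definition block :: "(nat \<Rightarrow> nat) \<Rightarrow> nat \<Rightarrow> 'n::{finite,linorder} set" where
  "block m s = {i. partial_sum m (s - 1) < pos i \<and> pos i \<le> partial_sum m s}"

definition block_space :: "(nat \<Rightarrow> nat) \<Rightarrow> nat \<Rightarrow> (real ^ 'n::{finite,linorder}) set" where
  "block_space m s = {x. \<forall>i. i \<notin> block m s \<longrightarrow> x $ i = 0}"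

definition component :: "(nat \<Rightarrow> nat) \<Rightarrow> nat \<Rightarrow> (real ^ 'n::{finite,linorder}) \<Rightarrow> (real ^ 'n::{finite,linorder})" where
  "component m s x = (\<chi> i. if i \<in> block m s then x $ i else 0)"

definition product_polytope ::
  "nat \<Rightarrow> (nat \<Rightarrow> nat) \<Rightarrow> (nat \<Rightarrow> (real ^ 'n::{finite,linorder}) set) \<Rightarrow> (real ^ 'n::{finite,linorder}) set" where
  "product_polytope t m \<Delta> = {x. \<forall>s\<in>{1..t}. component m s x \<in> \<Delta> s}"

definition increasing_labelling ::
  "'a::euclidean_space set \<Rightarrow> 'a \<Rightarrow> nat \<Rightarrow> (nat \<Rightarrow> 'a) \<Rightarrow> bool" where
  "increasing_labelling Q b n u \<longleftrightarrow>
     bij_betw u {1..n} (vertices Q) \<and> strict_mono_on {1..n} (\<lambda>i. b \<bullet> u i)"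

text \<open>
  The \<open>i\<close>-th coordinate of \<open>\<theta>\<close>; for \<open>i\<close> other than the last label \<^const>\<open>max_slope\<close> is finite.
\<close>

definition slope_map ::
  "'a::euclidean_space set \<Rightarrow> 'a \<Rightarrow> (nat \<Rightarrow> 'a) \<Rightarrow> 'a \<Rightarrow> nat \<Rightarrow> real" where
  "slope_map Q b u w i = real_of_ereal (max_slope Q b w (u i))"

definition product_slope_map ::
  "(nat \<Rightarrow> nat) \<Rightarrow> (nat \<Rightarrow> (real ^ 'n::{finite,linorder}) set) \<Rightarrow> (real ^ 'n::{finite,linorder}) \<Rightarrow>
     (nat \<Rightarrow> nat \<Rightarrow> real ^ 'n::{finite,linorder}) \<Rightarrow> (real ^ 'n::{finite,linorder}) \<Rightarrow> (real ^ 'n::{finite,linorder})" where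
  "product_slope_map m \<Delta> c u w =
     (\<chi> i. let s = (THE s. i \<in> block m s) in
        slope_map (\<Delta> s) (component m s c) (u s) (component m s w)
          (pos i - partial_sum m (s - 1)))"

section \<open>The sylvester fan\<close>

text \<open>Permutations of \<open>[m]\<close> in one-line notation.\<close>

definition permutation_words :: "'n::finite list set" where
  "permutation_words = {\<pi>. distinct \<pi> \<and> set \<pi> = UNIV}"

definition permutation_region :: "'n::finite list \<Rightarrow> (real ^ 'n) set" where
  "permutation_region \<pi> = {x. sorted_wrt (\<lambda>i j. x $ i < x $ j) \<pi>}"

definition sylvester_step ::
  "nat \<Rightarrow> (nat \<Rightarrow> nat) \<Rightarrow> 'n::{finite,linorder} list \<Rightarrow> 'n list \<Rightarrow> bool" where
  "sylvester_step t m \<pi> \<sigma> \<longleftrightarrow>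
     \<pi> \<in> permutation_words \<and> \<sigma> \<in> permutation_words \<and>
     (\<exists>U V W i j k. \<exists>s\<in>{1..t}. {i, j, k} \<subseteq> block m s \<and> i < j \<and> j < k \<and>
        \<pi> = U @ [j] @ V @ [i, k] @ W \<and> \<sigma> = U @ [j] @ V @ [k, i] @ W)"

definition sylvester_congruence ::
  "nat \<Rightarrow> (nat \<Rightarrow> nat) \<Rightarrow> 'n::{finite,linorder} list \<Rightarrow> 'n list \<Rightarrow> bool" where
  "sylvester_congruence t m = equivclp (sylvester_step t m)"

definition sylvester_fan ::
  "nat \<Rightarrow> (nat \<Rightarrow> nat) \<Rightarrow> (real ^ 'n::{finite,linorder}) set set" where
  "sylvester_fan t m = fan_of_max_cones
     {closure (\<Union>\<sigma>\<in>{\<sigma>\<in>permutation_words. sylvester_congruence t m \<pi> \<sigma>}. permutation_region \<sigma>) | \<pi>.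
        \<pi> \<in> permutation_words}"

end

theory Submission
  imports Defs
begin

text \<open>
  Call \<open>\<I>\<close> the family of all intervals contained in one block and of all pairs of indices from two
  different blocks, and attach to \<open>x \<in> \<real>\<^sup>m\<close> the sets of minimizers of \<open>x\<close> on the members of \<open>\<I>\<close>.
  The closures of the cells where these sets are constant are the normal cones of a Minkowski sum of
  simplices.
  Two permutations are congruent iff they have the same minimizers: a sylvester move never changes
  them, and if two words with equal minimizers differ, then some adjacent pair of letters of the first
  is inverted in the second; the minimizer of the interval spanned by that pair precedes both letters,
  so exchanging them is a sylvester move. On the other side, the steepest chord from the \<open>i\<close>-th vertex
  of a simplex leads to the first \<open>j > i\<close> whose own maximal slope is smaller, and at a vertex of the
  product the block with the largest maximal slope wins. Hence the arborescence of \<open>\<omega>\<close> and the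
  minimizers of \<open>\<Theta> \<omega>\<close> on \<open>\<I>\<close> determine each other. For a fixed arborescence \<open>\<Theta>\<close> is linear and
  injective, and \<open>\<Theta>\<close> is inverted by recovering the heights of the vertices from the last one downwards.
\<close>

section \<open>Fans\<close>

text \<open>The fan axioms are verified only once, on the side of minimizer cells, where a cone is
  given by comparisons of two coordinates. The pivot fan inherits them through
  \<open>\<Theta>\<close>, which is bijective and agrees with an injective linear map on every
  maximal cone. A direct check that closures of fibers meet in faces would be awkward, since a fiber
  is defined by a choice at each vertex of the product. Two notions of general position have to be
  matched: permutations see only vectors with distinct coordinates, while generic directions
  tolerate ties inside a block as long as every member of the family has one minimizer. Density of
  the vectors with distinct coordinates shows that both give the same closed cells. The arborescence
  is probed at few vertices: with all factors but one at the top it shows the targets in that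
  factor, with all but two it shows which factor has the larger slope. Linear dependence of the
  direction on \<open>c\<close> is excluded by these data once the dimension is at least 2.\<close>

lemma face_of_cone_imp_cone:
  fixes C :: "'a::euclidean_space set"
  assumes "cone C" "D face_of C"
  shows "cone D"
  unfolding cone_def
proof (intro ballI allI impI)
  fix x and r :: real
  assume x: "x \<in> D" and r: "r \<ge> 0"
  have DC: "D \<subseteq> C" and conv: "convex D"
    using assms(2) face_of_imp_subset face_of_imp_convex by auto
  have inC: "s *\<^sub>R x \<in> C" if "s \<ge> 0" for s
    using assms(1) x DC that unfolding cone_def by auto
  \<comment> \<open>For nonzero \<open>x\<close> and \<open>s > 1\<close>, \<open>x\<close> lies
    strictly between \<open>0\<close> and \<open>s *\<^sub>R x\<close>, both in \<open>C\<close>, so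
    the face contains both ends. Convexity then supplies the factors up to 1.\<close>
  have ends: "0 \<in> D \<and> s *\<^sub>R x \<in> D" if "s > 1" for s
  proof (cases "x = 0")
    case False
    have "x = (1 - 1 / s) *\<^sub>R 0 + (1 / s) *\<^sub>R (s *\<^sub>R x)"
      using that by simp
    moreover have "0 < 1 / s" "1 / s < 1"
      using that by auto
    ultimately have "x \<in> open_segment 0 (s *\<^sub>R x)"
      using False that unfolding in_segment by (intro conjI exI[of _ "1 / s"]) auto
    then show ?thesis
      using face_ofD[OF assms(2)] x inC[of 0] inC[of s] that by auto
  qed (use x in auto)
  show "r *\<^sub>R x \<in> D"
  proof (cases "r > 1")
    case False
    have "0 \<in> D"
      using ends[of 2] by simp
    then have "(1 - r) *\<^sub>R 0 + r *\<^sub>R x \<in> D"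
      using False r x conv by (intro convexD) auto
    then show ?thesis by simp
  qed (use ends in auto)
qed

text \<open>For faces \<open>D1\<close> of \<open>C1\<close> and \<open>D2\<close> of
  \<open>C2\<close>, cutting each with \<open>C1 \<inter> C2\<close> gives faces of this common
  face, and so does their intersection \<open>D1 \<inter> D2\<close>. Checking intersections of
  maximal cones therefore suffices.\<close>

lemma complete_fan_of_max_cones:
  fixes K :: "'a::euclidean_space set set"
  assumes fin: "finite K"
    and cone: "\<And>C. C \<in> K \<Longrightarrow> polyhedron C \<and> cone C"
    and face: "\<And>C D. C \<in> K \<Longrightarrow> D \<in> K \<Longrightarrow> (C \<inter> D) face_of C"
    and cover: "\<Union>K = UNIV"
  shows "complete_fan (fan_of_max_cones K)"
  unfolding complete_fan_def
proof (intro conjI ballI allI impI)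
  have "fan_of_max_cones K \<subseteq> (\<Union>C\<in>K. {D. D face_of C})"
    by (auto simp: fan_of_max_cones_def)
  then show "finite (fan_of_max_cones K)"
    by (rule finite_subset) (use fin cone finite_polyhedron_faces in auto)
next
  fix C assume "C \<in> fan_of_max_cones K"
  then obtain C' where C': "C' \<in> K" "C face_of C'" "C \<noteq> {}"
    by (auto simp: fan_of_max_cones_def)
  show "C \<noteq> {}" by fact
  show "polyhedron C" using C' cone face_of_polyhedron_polyhedron by blast
  show "cone C" using C' cone face_of_cone_imp_cone by blast
  fix D assume "D face_of C \<and> D \<noteq> {}"
  then show "D \<in> fan_of_max_cones K"
    using C' face_of_trans by (auto simp: fan_of_max_cones_def)
next
  have *: "(D1 \<inter> D2) face_of D1"
    if "C1 \<in> K" "C2 \<in> K" "D1 face_of C1" "D2 face_of C2" for C1 C2 D1 D2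
  proof -
    have 1: "(C1 \<inter> C2) face_of C1" "(C1 \<inter> C2) face_of C2"
      using face[OF that(1,2)] face[OF that(2,1)] by (simp_all add: Int_commute)
    have sub: "D1 \<subseteq> C1" "D2 \<subseteq> C2"
      using that face_of_imp_subset by auto
    have "(D1 \<inter> (C1 \<inter> C2)) face_of C1" "(D2 \<inter> (C1 \<inter> C2)) face_of C2"
      using 1 that by (auto intro: face_of_Int)
    then have "(D1 \<inter> (C1 \<inter> C2)) face_of (C1 \<inter> C2)" "(D2 \<inter> (C1 \<inter> C2)) face_of (C1 \<inter> C2)"
      by (auto intro: face_of_subset)
    then have "((D1 \<inter> (C1 \<inter> C2)) \<inter> (D2 \<inter> (C1 \<inter> C2))) face_of (C1 \<inter> C2)"
      by (rule face_of_Int)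
    moreover have "(D1 \<inter> (C1 \<inter> C2)) \<inter> (D2 \<inter> (C1 \<inter> C2)) = D1 \<inter> D2"
      using sub by auto
    ultimately have "(D1 \<inter> D2) face_of C1"
      using 1(1) face_of_trans by metis
    then show ?thesis
      using sub by (auto intro: face_of_subset)
  qed
  have **: "(C \<inter> D) face_of C" if "C \<in> fan_of_max_cones K" "D \<in> fan_of_max_cones K" for C D
    using that * unfolding fan_of_max_cones_def by blast
  fix C D assume "C \<in> fan_of_max_cones K" "D \<in> fan_of_max_cones K"
  then show "(C \<inter> D) face_of C" "(C \<inter> D) face_of D"
    using **[of C D] **[of D C] by (simp_all add: Int_commute)
next
  have "C \<in> fan_of_max_cones K" if "C \<in> K" "C \<noteq> {}" for C
    using that cone polyhedron_imp_convex face_of_refl by (auto simp: fan_of_max_cones_def)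
  then have "\<Union>K \<subseteq> \<Union>(fan_of_max_cones K)"
    by blast
  then show "\<Union>(fan_of_max_cones K) = UNIV"
    using cover by (simp add: top.extremum_unique)
qed

lemma complete_fanD:
  assumes "complete_fan F"
  shows "finite F" "\<And>C. C \<in> F \<Longrightarrow> C \<noteq> {}" "\<And>C. C \<in> F \<Longrightarrow> polyhedron C"
    "\<And>C. C \<in> F \<Longrightarrow> cone C"
    "\<And>C D. C \<in> F \<Longrightarrow> D \<in> F \<Longrightarrow> (C \<inter> D) face_of C"
    "\<And>C D. C \<in> F \<Longrightarrow> D \<in> F \<Longrightarrow> (C \<inter> D) face_of D"
    "\<Union>F = UNIV"
  using assms unfolding complete_fan_def by blast+

text \<open>Only the target has to be known to be a fan. On each cone \<open>f\<close> is the
  restriction of a linear bijection, which relates faces and polyhedra in both directions, so every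
  axiom pulls back.\<close>

lemma pl_isomorphism_of_max_cones:
  fixes f :: "'a::euclidean_space \<Rightarrow> 'a"
  assumes G: "complete_fan (fan_of_max_cones ((`) f ` K))"
    and f: "continuous_on UNIV f" "bij f"
    and lin: "\<And>C. C \<in> K \<Longrightarrow> \<exists>L. linear L \<and> inj L \<and> (\<forall>x\<in>C. f x = L x)"
  shows "pl_isomorphism f (fan_of_max_cones K) (fan_of_max_cones ((`) f ` K))"
proof -
  let ?F = "fan_of_max_cones K" and ?G = "fan_of_max_cones ((`) f ` K)"
  have injf: "inj f" using f(2) bij_is_inj by blast
  have linF: "\<exists>L. linear L \<and> inj L \<and> (\<forall>x\<in>D. f x = L x)" if D: "D \<in> ?F" for D
  proof -
    obtain C where C: "C \<in> K" "D \<subseteq> C"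
      using D by (auto simp: fan_of_max_cones_def dest: face_of_imp_subset)
    show ?thesis using lin[OF C(1)] C(2) by blast
  qed
  have face_iff: "f ` E face_of f ` D \<longleftrightarrow> E face_of D"
    if D: "D \<in> K \<union> ?F" "E \<subseteq> D" for D E
  proof -
    obtain L where L: "linear L" "inj L" "\<forall>x\<in>D. f x = L x"
      using D lin linF by blast
    then have "f ` D = L ` D" "f ` E = L ` E" using D(2) by (auto intro!: image_cong)
    then show ?thesis using face_of_linear_image[OF L(1,2)] by simp
  qed
  have img: "(`) f ` ?F = ?G"
  proof (intro equalityI subsetI)
    fix E assume "E \<in> (`) f ` ?F"
    then obtain D C where DC: "E = f ` D" "D \<noteq> {}" "C \<in> K" "D face_of C"
      by (auto simp: fan_of_max_cones_def)
    then have "f ` D face_of f ` C"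
      using face_iff[of C D] face_of_imp_subset[of D C] by simp
    then show "E \<in> ?G"
      using DC by (auto simp: fan_of_max_cones_def)
  next
    fix E assume "E \<in> ?G"
    then obtain C where C: "C \<in> K" "E face_of f ` C" "E \<noteq> {}"
      by (auto simp: fan_of_max_cones_def)
    define D where "D = f -` E"
    have "E \<subseteq> f ` C" using C face_of_imp_subset by auto
    then have E: "E = f ` D" unfolding D_def by blast
    have "D \<subseteq> C" unfolding D_def using \<open>E \<subseteq> f ` C\<close> injf by (auto dest: injD)
    then have "D face_of C" using face_iff[of C D] C E by simp
    then have "D \<in> ?F" using C E by (auto simp: fan_of_max_cones_def)
    then show "E \<in> (`) f ` ?F" using E by auto
  qed
  have bb: "bij_betw ((`) f) ?F ?G"
    unfolding bij_betw_def using img injf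
    by (auto intro!: inj_onI simp: inj_image_eq_iff)
  have memG: "f ` C \<in> ?G" if "C \<in> ?F" for C
    using img that by auto
  have "complete_fan ?F"
    unfolding complete_fan_def
  proof (intro conjI ballI allI impI)
    show "finite ?F"
      using bij_betw_finite[OF bb] complete_fanD(1)[OF G] by simp
  next
    fix C assume C: "C \<in> ?F"
    obtain L where L: "linear L" "inj L" "\<forall>x\<in>C. f x = L x"
      using linF[OF C] by blast
    then have fC: "f ` C = L ` C" by (auto intro!: image_cong)
    have GC: "f ` C \<noteq> {}" "polyhedron (f ` C)" "cone (f ` C)"
      using complete_fanD(2-4)[OF G memG[OF C]] by simp_all
    then show "C \<noteq> {}" by auto
    \<comment> \<open>An injective linear endomorphism is onto in finite dimension, so polyhedrality
      passes from the image back to \<open>C\<close>.\<close>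
    have "bij L" using L linear_injective_imp_surjective[OF L(1,2)] by (simp add: bij_def)
    then show "polyhedron C" using GC fC polyhedron_linear_image_eq[OF L(1)] by simp
    show "cone C"
      unfolding cone_def
    proof (intro ballI allI impI)
      fix x and r :: real assume "x \<in> C" "r \<ge> 0"
      then have "r *\<^sub>R L x \<in> L ` C" using GC(3) fC by (simp add: cone_def)
      then have "L (r *\<^sub>R x) \<in> L ` C" using L(1) by (simp add: linear_scale)
      then show "r *\<^sub>R x \<in> C" using inj_image_mem_iff[OF L(2)] by simp
    qed
    fix D assume "D face_of C \<and> D \<noteq> {}"
    then show "D \<in> ?F"
      using C face_of_trans by (auto simp: fan_of_max_cones_def)
  next
    fix C D assume CD: "C \<in> ?F" "D \<in> ?F"
    have "(f ` C \<inter> f ` D) face_of f ` C" "(f ` C \<inter> f ` D) face_of f ` D"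
      using complete_fanD(5,6)[OF G] CD memG by simp_all
    then have "f ` (C \<inter> D) face_of f ` C" "f ` (C \<inter> D) face_of f ` D"
      using injf by (simp_all add: image_Int)
    then show "(C \<inter> D) face_of C" "(C \<inter> D) face_of D"
      using face_iff[of C "C \<inter> D"] face_iff[of D "C \<inter> D"] CD by simp_all
  next
    have "f ` \<Union>?F = \<Union>?G" unfolding img[symmetric] by blast
    also have "\<dots> = UNIV" using complete_fanD(7)[OF G] by simp
    finally show "\<Union>?F = UNIV"
      using inj_image_eq_iff[OF injf, of _ UNIV] bij_is_surj[OF f(2)] by simp
  qed
  then show ?thesis
    unfolding pl_isomorphism_def using G f bb by (auto dest: linF)
qed

section \<open>Cells of argmin patterns\<close>

definition argmins :: "'i set \<Rightarrow> ('i \<Rightarrow> real) \<Rightarrow> 'i set" where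
  "argmins I x = {l \<in> I. \<forall>k\<in>I. x l \<le> x k}"

definition strict_on :: "'i set set \<Rightarrow> ('i \<Rightarrow> real) \<Rightarrow> bool" where
  "strict_on \<I> x \<longleftrightarrow> (\<forall>I\<in>\<I>. is_singleton (argmins I x))"

definition open_cell :: "'i set set \<Rightarrow> (real ^ 'i::finite) \<Rightarrow> (real ^ 'i) set" where
  "open_cell \<I> x = {y. \<forall>I\<in>\<I>. argmins I (($) y) = argmins I (($) x)}"

text \<open>Inclusion instead of equality: new ties are allowed, but no old minimizer may be lost.
  For a vector with unique minimizers this is the closure of \<open>open_cell\<close>.\<close>

definition closed_cell :: "'i set set \<Rightarrow> (real ^ 'i::finite) \<Rightarrow> (real ^ 'i) set" where
  "closed_cell \<I> x = {y. \<forall>I\<in>\<I>. argmins I (($) x) \<subseteq> argmins I (($) y)}"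

lemma argmins_singletonD:
  assumes "argmins I x = {l}"
  shows "l \<in> I" "\<And>k. k \<in> I \<Longrightarrow> k \<noteq> l \<Longrightarrow> x l < x k"
proof -
  show l: "l \<in> I" using assms by (auto simp: argmins_def)
  fix k assume k: "k \<in> I" "k \<noteq> l"
  have le: "\<forall>j\<in>I. x l \<le> x j" using assms by (auto simp: argmins_def)
  have "k \<notin> argmins I x" using assms k by auto
  then obtain j where "j \<in> I" "x j < x k" using k by (auto simp: argmins_def not_le)
  then show "x l < x k" using le by force
qed

lemma argmins_eq_singletonI:
  assumes "l \<in> I" "\<And>k. k \<in> I \<Longrightarrow> k \<noteq> l \<Longrightarrow> x l < x k"
  shows "argmins I x = {l}"
proof -
  have "x l \<le> x k" if "k \<in> I" for k using assms(2)[OF that] by (cases "k = l") auto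
  then have "l \<in> argmins I x" using assms(1) by (auto simp: argmins_def)
  moreover have "k = l" if "k \<in> argmins I x" for k
    using assms that by (force simp: argmins_def)
  ultimately show ?thesis by blast
qed

lemma argmins_nonempty:
  assumes "finite I" "I \<noteq> {}"
  shows "argmins I x \<noteq> {}"
proof -
  have "Min (x ` I) \<in> x ` I" using assms by (intro Min_in) auto
  then obtain l where "l \<in> I" "Min (x ` I) = x l" by auto
  then have "l \<in> argmins I x" using assms by (auto simp: argmins_def simp flip: \<open>Min (x ` I) = x l\<close>)
  then show ?thesis by blast
qed

lemma inj_imp_strict_on:
  assumes "inj x" "\<And>I. I \<in> \<I> \<Longrightarrow> finite I \<and> I \<noteq> {}"
  shows "strict_on \<I> x"
  unfolding strict_on_def
proof
  fix I assume "I \<in> \<I>"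
  then obtain l where l: "l \<in> argmins I x"
    using argmins_nonempty[of I x] assms(2)[of I] by auto
  moreover have "k = l" if "k \<in> argmins I x" for k
  proof -
    have "x k = x l" using l that by (auto simp: argmins_def intro: antisym)
    then show ?thesis using assms(1) by (rule injD[rotated])
  qed
  ultimately have "argmins I x = {l}" by blast
  then show "is_singleton (argmins I x)" by (simp add: is_singleton_def)
qed

lemma closed_cell_halfspaces:
  "closed_cell \<I> x =
     (\<Inter>I\<in>\<I>. \<Inter>l\<in>argmins I (($) x). \<Inter>k\<in>I. {y. (axis l 1 - axis k 1) \<bullet> y \<le> 0})"
  by (auto simp: closed_cell_def argmins_def inner_diff_left inner_axis')

lemma polyhedron_INT:
  fixes A :: "'c::finite set"
  assumes "\<And>k. k \<in> A \<Longrightarrow> polyhedron (S k)"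
  shows "polyhedron (\<Inter>k\<in>A. S k)"
  using assms by (intro polyhedron_Inter) auto

lemma polyhedron_closed_cell: "polyhedron (closed_cell \<I> x)"
  unfolding closed_cell_halfspaces by (intro polyhedron_INT polyhedron_halfspace_le)

lemma cone_closed_cell: "cone (closed_cell \<I> x)"
  by (auto simp: cone_def closed_cell_def argmins_def subset_iff mult_left_mono)

text \<open>In the cell of \<open>x\<close>, a minimizer \<open>l0\<close> of \<open>x\<close> is
  minimal at \<open>a\<close> and at \<open>b\<close>. At a point \<open>p\<close> between them that
  also lies in the cell of \<open>z\<close>, a minimizer \<open>l1\<close> of \<open>z\<close> ties
  with \<open>l0\<close>. Two nonnegative differences then average to zero, so \<open>l1\<close> is
  minimal at \<open>a\<close> and \<open>b\<close> too.\<close>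

lemma closed_cell_Int_face_of:
  assumes "\<And>I. I \<in> \<I> \<Longrightarrow> I \<noteq> {}"
  shows "(closed_cell \<I> x \<inter> closed_cell \<I> z) face_of closed_cell \<I> x"
  unfolding face_of_def
proof (intro conjI ballI impI)
  show "closed_cell \<I> x \<inter> closed_cell \<I> z \<subseteq> closed_cell \<I> x" by simp
  show "convex (closed_cell \<I> x \<inter> closed_cell \<I> z)"
    by (intro convex_Int polyhedron_imp_convex polyhedron_closed_cell)
  fix a b p
  assume a: "a \<in> closed_cell \<I> x" and b: "b \<in> closed_cell \<I> x"
    and p: "p \<in> closed_cell \<I> x \<inter> closed_cell \<I> z" and seg: "p \<in> open_segment a b"
  obtain r where r: "0 < r" "r < 1" "p = (1 - r) *\<^sub>R a + r *\<^sub>R b"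
    using seg by (auto simp: in_segment)
  have key: "a $ l1 = a $ l0 \<and> b $ l1 = b $ l0"
    if I: "I \<in> \<I>" and l: "l0 \<in> argmins I (($) x)" "l1 \<in> argmins I (($) z)" for I l0 l1
  proof -
    have 1: "l0 \<in> I" "l1 \<in> I" using l by (auto simp: argmins_def)
    have "a $ l0 \<le> a $ l1" "b $ l0 \<le> b $ l1"
      using a b I l 1 by (auto simp: closed_cell_def argmins_def subset_iff)
    moreover have "p $ l1 \<le> p $ l0"
      using p I l 1 by (auto simp: closed_cell_def argmins_def subset_iff)
    then have "(1 - r) * (a $ l1 - a $ l0) + r * (b $ l1 - b $ l0) \<le> 0"
      unfolding r(3) by (simp add: algebra_simps)
    moreover have "0 \<le> (1 - r) * (a $ l1 - a $ l0)" "0 \<le> r * (b $ l1 - b $ l0)"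
      using calculation r by auto
    ultimately have "(1 - r) * (a $ l1 - a $ l0) = 0" "r * (b $ l1 - b $ l0) = 0" by linarith+
    then show ?thesis using r by auto
  qed
  have mem: "l1 \<in> argmins I (($) a) \<and> l1 \<in> argmins I (($) b)"
    if I: "I \<in> \<I>" and l1: "l1 \<in> argmins I (($) z)" for I l1
  proof -
    obtain l0 where l0: "l0 \<in> argmins I (($) x)"
      using argmins_nonempty[of I] assms[OF I] by fastforce
    have "l0 \<in> argmins I (($) a)" "l0 \<in> argmins I (($) b)"
      using a b I l0 by (auto simp: closed_cell_def)
    then show ?thesis
      using key[OF I l0 l1] l1 by (auto simp: argmins_def)
  qed
  then show "a \<in> closed_cell \<I> x \<inter> closed_cell \<I> z" "b \<in> closed_cell \<I> x \<inter> closed_cell \<I> z"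
    using a b by (auto simp: closed_cell_def)
qed

text \<open>A cell depends only on the map sending each set to its minimizers, and there are
  finitely many such maps.\<close>

lemma finite_range_closed_cell: "finite (range (closed_cell \<I> :: real ^ 'i::finite \<Rightarrow> _))"
proof (rule finite_subset)
  let ?c = "\<lambda>a :: 'i set \<Rightarrow> 'i set. {y :: real ^ 'i. \<forall>I\<in>\<I>. a I \<subseteq> argmins I (($) y)}"
  show "range (closed_cell \<I>) \<subseteq> range ?c"
    by (rule image_subsetI, rule image_eqI[of _ _ "\<lambda>I. argmins I (($) _)"])
      (simp_all only: closed_cell_def UNIV_I)
qed simp

text \<open>Unique minimizers turn membership into finitely many strict inequalities; a tie would
  impose an equation.\<close>

lemma open_open_cell:
  fixes x :: "real ^ 'i::finite"
  assumes "strict_on \<I> (($) x)"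
  shows "open (open_cell \<I> x)"
proof -
  have "finite \<I>" by (rule finite_subset[of _ UNIV]) auto
  have "open_cell \<I> x =
    (\<Inter>I\<in>\<I>. \<Inter>l\<in>argmins I (($) x). \<Inter>k\<in>I - {l}. {y. y $ l < y $ k})" (is "_ = ?R")
  proof (intro equalityI subsetI)
    fix y assume y: "y \<in> open_cell \<I> x"
    show "y \<in> ?R"
    proof (intro INT_I CollectI)
      fix I l k assume I: "I \<in> \<I>" "l \<in> argmins I (($) x)" "k \<in> I - {l}"
      then have "argmins I (($) y) = {l}"
        using y assms by (auto simp: open_cell_def strict_on_def is_singleton_def)
      then show "y $ l < y $ k" using argmins_singletonD(2)[of I "($) y"] I by auto
    qed
  next
    fix y assume y: "y \<in> ?R"
    show "y \<in> open_cell \<I> x"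
      unfolding open_cell_def
    proof (intro CollectI ballI)
      fix I assume I: "I \<in> \<I>"
      then obtain l where l: "argmins I (($) x) = {l}"
        using assms by (auto simp: strict_on_def is_singleton_def)
      then have "argmins I (($) y) = {l}"
        using y I argmins_singletonD(1)[OF l] by (intro argmins_eq_singletonI) auto
      then show "argmins I (($) y) = argmins I (($) x)" using l by simp
    qed
  qed
  also have "open \<dots>"
    using \<open>finite \<I>\<close> by (intro open_INT ballI open_Collect_less continuous_intros) auto
  finally show ?thesis .
qed

text \<open>Along a direction \<open>y\<close> with distinct coordinates, two given coordinates of
  \<open>x + e *\<^sub>R y\<close> coincide for at most one \<open>e\<close>, so all small positive
  \<open>e\<close> avoid coincidences.\<close>

lemma closure_range_inj: "closure {x :: real ^ 'i::finite. inj (($) x)} = UNIV"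
proof -
  obtain f :: "'i \<Rightarrow> nat" where f: "inj f" using finite_imp_inj_to_nat_seg[of "UNIV :: 'i set"] by auto
  define y :: "real ^ 'i" where "y = (\<chi> i. real (f i))"
  have "x \<in> closure {x :: real ^ 'i. inj (($) x)}" for x
  proof (rule Lim_in_closed_set)
    show "closed (closure {x :: real ^ 'i. inj (($) x)})" by simp
    have "\<forall>\<^sub>F e in at_right (0::real). \<forall>i. \<forall>j. i \<noteq> j \<longrightarrow> x $ i + e * y $ i \<noteq> x $ j + e * y $ j"
    proof (intro eventually_all_finite)
      fix i j :: 'i
      show "\<forall>\<^sub>F e in at_right (0::real). i \<noteq> j \<longrightarrow> x $ i + e * y $ i \<noteq> x $ j + e * y $ j"
      proof (cases "i = j")
        case False
        then have ne: "y $ i \<noteq> y $ j" using f by (auto simp: y_def dest: injD)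
        \<comment> \<open>This quotient is the one value of \<open>e\<close> at which coordinates
          \<open>i\<close> and \<open>j\<close> meet. Only a positive value can obstruct, and
          smaller \<open>e\<close> stay below it.\<close>
        have "\<forall>\<^sub>F e in at_right (0::real). e \<noteq> (x $ j - x $ i) / (y $ i - y $ j)"
        proof (cases "(x $ j - x $ i) / (y $ i - y $ j) > 0")
          case True
          then show ?thesis
            by (auto simp: eventually_at_right_field intro!: exI[of _ "(x $ j - x $ i) / (y $ i - y $ j)"])
        next
          case False
          then show ?thesis
            by (auto simp: eventually_at_right_field intro!: exI[of _ 1])
        qed
        then show ?thesis
          by (rule eventually_mono) (use ne in \<open>auto simp: field_simps\<close>)
      qed simp
    qed
    then show "\<forall>\<^sub>F e in at_right (0::real). x + e *\<^sub>R y \<in> closure {x :: real ^ 'i. inj (($) x)}"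
    proof (rule eventually_mono)
      fix e assume "\<forall>i. \<forall>j. i \<noteq> j \<longrightarrow> x $ i + e * y $ i \<noteq> x $ j + e * y $ j"
      then have "inj (($) (x + e *\<^sub>R y))" by (auto simp: inj_def)
      then show "x + e *\<^sub>R y \<in> closure {x :: real ^ 'i. inj (($) x)}"
        by (intro subsetD[OF closure_subset]) simp
    qed
    show "((\<lambda>e. x + e *\<^sub>R y) \<longlongrightarrow> x) (at_right 0)"
      by (auto intro!: tendsto_eq_intros)
    show "at_right (0::real) \<noteq> bot" by simp
  qed
  then show ?thesis by auto
qed

text \<open>A weak minimizer of \<open>z\<close> becomes the only one after adding any positive
  multiple of \<open>x\<close>, and \<open>z + e *\<^sub>R x\<close> tends to
  \<open>z\<close>.\<close>

lemma closed_cell_subset_closure: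
  fixes x :: "real ^ 'i::finite"
  assumes "strict_on \<I> (($) x)"
  shows "closed_cell \<I> x \<subseteq> closure (open_cell \<I> x)"
proof
  fix z assume z: "z \<in> closed_cell \<I> x"
  show "z \<in> closure (open_cell \<I> x)"
  proof (rule Lim_in_closed_set)
    show "closed (closure (open_cell \<I> x))" by simp
    show "\<forall>\<^sub>F e in at_right (0::real). z + e *\<^sub>R x \<in> closure (open_cell \<I> x)"
      unfolding eventually_at_right_field
    proof (intro exI[of _ 1] conjI allI impI)
      fix e :: real assume e: "0 < e" "e < 1"
      have "z + e *\<^sub>R x \<in> open_cell \<I> x"
        unfolding open_cell_def
      proof (intro CollectI ballI)
        fix I assume I: "I \<in> \<I>"
        then obtain l where l: "argmins I (($) x) = {l}"
          using assms by (auto simp: strict_on_def is_singleton_def)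
        have "z $ l \<le> z $ k" if "k \<in> I" for k
          using z I l that by (auto simp: closed_cell_def argmins_def)
        then have "argmins I (($) (z + e *\<^sub>R x)) = {l}"
          using argmins_singletonD[OF l] e by (intro argmins_eq_singletonI) (auto intro!: add_le_less_mono)
        then show "argmins I (($) (z + e *\<^sub>R x)) = argmins I (($) x)" using l by simp
      qed
      then show "z + e *\<^sub>R x \<in> closure (open_cell \<I> x)" by (rule subsetD[OF closure_subset])
    qed simp
    show "((\<lambda>e. z + e *\<^sub>R x) \<longlongrightarrow> z) (at_right 0)"
      by (auto intro!: tendsto_eq_intros)
    show "at_right (0::real) \<noteq> bot" by simp
  qed
qed

text \<open>The first form serves the fibers of the pivot fan, the second the sylvester classes,
  whose regions contain only vectors with distinct coordinates. Such vectors are dense, so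
  restricting an open set to them keeps its closure.\<close>

lemma closure_open_cell:
  fixes x :: "real ^ 'i::finite"
  assumes "strict_on \<I> (($) x)"
  shows "closure (open_cell \<I> x) = closed_cell \<I> x"
    and "closure (open_cell \<I> x \<inter> {y. inj (($) y)}) = closed_cell \<I> x"
proof -
  have sub: "open_cell \<I> x \<subseteq> closed_cell \<I> x"
    by (auto simp: open_cell_def closed_cell_def)
  have cl: "closed (closed_cell \<I> x)"
    using polyhedron_closed_cell polyhedron_imp_closed by blast
  show 1: "closure (open_cell \<I> x) = closed_cell \<I> x"
    using sub cl closed_cell_subset_closure[OF assms] by (simp add: closure_minimal subset_antisym)
  have "open_cell \<I> x \<subseteq> closure (open_cell \<I> x \<inter> {y. inj (($) y)})"
    using open_Int_closure_subset[OF open_open_cell[OF assms], of "{y. inj (($) y)}"] closure_range_inj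
    by auto
  then have "closure (open_cell \<I> x) \<subseteq> closure (open_cell \<I> x \<inter> {y. inj (($) y)})"
    by (simp add: closure_minimal)
  moreover have "closure (open_cell \<I> x \<inter> {y. inj (($) y)}) \<subseteq> closure (open_cell \<I> x)"
    by (intro closure_mono) auto
  ultimately show "closure (open_cell \<I> x \<inter> {y. inj (($) y)}) = closed_cell \<I> x"
    using 1 by simp
qed

lemma complete_fan_closed_cells:
  fixes \<I> :: "'i::finite set set"
  assumes "\<And>I. I \<in> \<I> \<Longrightarrow> I \<noteq> {}"
  shows "complete_fan (fan_of_max_cones {closed_cell \<I> x | x. inj (($) x)})"
proof (rule complete_fan_of_max_cones)
  let ?K = "{closed_cell \<I> x | x. inj (($) x)}"
  show finK: "finite ?K"
    by (rule finite_subset[OF _ finite_range_closed_cell]) auto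
  show "polyhedron C \<and> cone C" if "C \<in> ?K" for C
    using that polyhedron_closed_cell cone_closed_cell by auto
  show "(C \<inter> D) face_of C" if "C \<in> ?K" "D \<in> ?K" for C D
    using that closed_cell_Int_face_of[OF assms] by auto
  \<comment> \<open>The cells cover a dense set, and a finite union of closed cells is
    closed.\<close>
  have "closed (\<Union>?K)"
    using finK polyhedron_closed_cell polyhedron_imp_closed by (intro closed_Union) auto
  moreover have "{x. inj (($) x)} \<subseteq> \<Union>?K"
  proof
    fix x :: "real ^ 'i" assume "x \<in> {x. inj (($) x)}"
    moreover have "x \<in> closed_cell \<I> x" by (simp add: closed_cell_def)
    ultimately show "x \<in> \<Union>?K" by blast
  qed
  ultimately show "\<Union>?K = UNIV"
    using closure_minimal[of "{x. inj (($) x)}" "\<Union>?K"] closure_range_inj[where 'i = 'i] by auto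
qed

text \<open>The left side is indexed as generic directions are, the right side as permutations are.
  The open cell around a vector with unique minimizers contains a vector with distinct coordinates,
  and that vector has the same closed cell.\<close>

lemma closed_cells_strict_eq_inj:
  fixes \<I> :: "'i::finite set set"
  assumes "\<And>I. I \<in> \<I> \<Longrightarrow> I \<noteq> {}"
  shows "{closed_cell \<I> x | x. strict_on \<I> (($) x)} = {closed_cell \<I> x | x. inj (($) x)}"
proof -
  have "\<exists>y. inj (($) y) \<and> closed_cell \<I> x = closed_cell \<I> y" if x: "strict_on \<I> (($) x)" for x
  proof -
    have "x \<in> closure (open_cell \<I> x \<inter> {y. inj (($) y)})"
      unfolding closure_open_cell(2)[OF x] by (simp add: closed_cell_def)
    then have "open_cell \<I> x \<inter> {y. inj (($) y)} \<noteq> {}" by auto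
    then obtain y where "y \<in> open_cell \<I> x" "inj (($) y)" by auto
    then show ?thesis by (intro exI[of _ y]) (simp add: open_cell_def closed_cell_def)
  qed
  moreover have "strict_on \<I> (($) x)" if "inj (($) x)" for x
    using inj_imp_strict_on[OF that] assms by simp
  ultimately show ?thesis by blast
qed

section \<open>Sylvester classes as argmin patterns\<close>

text \<open>Intervals in a block are the simplices whose Minkowski sum is Loday's associahedron;
  cross-block pairs are the segments that compare blocks. Only the endpoints of an interval are
  tested: for a monotone \<open>b\<close> the whole interval then lies in one block.\<close>

definition block_family :: "('n::{finite,linorder} \<Rightarrow> nat) \<Rightarrow> 'n set set" where
  "block_family b = {{i..k} | i k. i \<le> k \<and> b i = b k} \<union> {{i, k} | i k. b i \<noteq> b k}"

text \<open>Exchanging two neighbouring letters of a word, read on points: it carries the region of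
  one word into the region of the other.\<close>

definition swap_coords :: "'n \<Rightarrow> 'n \<Rightarrow> real ^ 'n::finite \<Rightarrow> real ^ 'n" where
  "swap_coords a b x = (\<chi> l. x $ (if l = a then b else if l = b then a else l))"

lemma block_family_nonempty: "I \<in> block_family b \<Longrightarrow> I \<noteq> {}"
  by (auto simp: block_family_def)

lemma argmins_cong_order:
  assumes "\<And>a b. a \<in> I \<Longrightarrow> b \<in> I \<Longrightarrow> x a < x b \<longleftrightarrow> y a < y b"
  shows "argmins I x = argmins I y"
  using assms by (auto simp: argmins_def not_less[symmetric])

section \<open>Permutation regions and the exchange of adjacent letters\<close>

lemma region_order:
  fixes x y :: "real ^ 'n::finite"
  assumes "\<pi> \<in> permutation_words" "x \<in> permutation_region \<pi>" "y \<in> permutation_region \<pi>"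
  shows "x $ a < x $ b \<longleftrightarrow> y $ a < y $ b"
proof -
  obtain p q where pq: "p < length \<pi>" "q < length \<pi>" "a = \<pi> ! p" "b = \<pi> ! q"
    using assms(1) unfolding permutation_words_def by (metis (mono_tags) UNIV_I in_set_conv_nth mem_Collect_eq)
  have "z $ a < z $ b \<longleftrightarrow> p < q" if "z \<in> permutation_region \<pi>" for z :: "real ^ 'n"
  proof -
    have s: "z $ (\<pi> ! i) < z $ (\<pi> ! j)" if "i < j" "j < length \<pi>" for i j
      using \<open>z \<in> permutation_region \<pi>\<close> that by (simp add: permutation_region_def sorted_wrt_iff_nth_less)
    show ?thesis
      using s[of p q] s[of q p] pq by (cases p q rule: linorder_cases) auto
  qed
  then show ?thesis using assms by simp
qed

lemma region_imp_inj:
  assumes "\<pi> \<in> permutation_words" "x \<in> permutation_region \<pi>"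
  shows "inj (($) x)"
proof (rule injI, rule ccontr)
  fix a b assume eq: "x $ a = x $ b" and ne: "a \<noteq> b"
  obtain p q where pq: "p < length \<pi>" "q < length \<pi>" "a = \<pi> ! p" "b = \<pi> ! q"
    using assms(1) unfolding permutation_words_def by (metis (mono_tags) UNIV_I in_set_conv_nth mem_Collect_eq)
  have s: "x $ (\<pi> ! i) < x $ (\<pi> ! j)" if "i < j" "j < length \<pi>" for i j
    using assms(2) that by (simp add: permutation_region_def sorted_wrt_iff_nth_less)
  show False
    using s[of p q] s[of q p] pq eq ne by (cases p q rule: linorder_cases) auto
qed

lemma region_unique:
  assumes "\<pi> \<in> permutation_words" "\<sigma> \<in> permutation_words"
    "x \<in> permutation_region \<pi>" "x \<in> permutation_region \<sigma>"
  shows "\<pi> = \<sigma>"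
proof -
  have "sorted (map (($) x) \<pi>)" "sorted (map (($) x) \<sigma>)"
    using assms(3,4) by (auto simp: permutation_region_def sorted_map elim: sorted_wrt_mono_rel[rotated])
  then show ?thesis
    using map_sorted_distinct_set_unique[of "($) x" \<pi> \<sigma>] region_imp_inj[OF assms(1,3)] assms(1,2)
    by (auto simp: permutation_words_def distinct_map inj_on_subset)
qed

lemma ex_region:
  fixes x :: "real ^ 'n::{finite,linorder}"
  assumes "inj (($) x)"
  shows "\<exists>\<sigma>\<in>permutation_words. x \<in> permutation_region \<sigma>"
proof
  let ?\<sigma> = "sort_key (($) x) (sorted_list_of_set (UNIV :: 'n set))"
  show "?\<sigma> \<in> permutation_words" by (simp add: permutation_words_def)
  have "sorted (map (($) x) ?\<sigma>)" "distinct (map (($) x) ?\<sigma>)"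
    using assms by (auto simp: distinct_map inj_on_subset)
  then have "sorted_wrt (<) (map (($) x) ?\<sigma>)" by (simp add: strict_sorted_iff)
  then show "x \<in> permutation_region ?\<sigma>"
    by (simp add: permutation_region_def sorted_wrt_map)
qed

lemma region_nonempty:
  fixes \<pi> :: "'n::finite list"
  assumes "\<pi> \<in> permutation_words"
  shows "permutation_region \<pi> \<noteq> {}"
proof -
  define x :: "real ^ 'n" where "x = (\<chi> i. real (the_inv_into {..<length \<pi>} ((!) \<pi>) i))"
  have "inj_on ((!) \<pi>) {..<length \<pi>}"
    using assms by (auto simp: permutation_words_def inj_on_nth)
  then have "x $ (\<pi> ! p) = real p" if "p < length \<pi>" for p
    using that by (simp add: x_def the_inv_into_f_f)
  then have "x \<in> permutation_region \<pi>"
    by (simp add: permutation_region_def sorted_wrt_iff_nth_less)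
  then show ?thesis by blast
qed

lemma region_adjacent_cases:
  assumes "U @ [a, b] @ W \<in> permutation_words" "x \<in> permutation_region (U @ [a, b] @ W)"
  shows "l \<in> set U \<and> x $ l < x $ a \<and> x $ l < x $ b \<or> l \<in> set W \<and> x $ a < x $ l \<and> x $ b < x $ l
    \<or> l = a \<or> l = b"
  using assms by (auto simp: permutation_words_def permutation_region_def sorted_wrt_append)

lemma swap_coords_region:
  assumes "U @ [a, b] @ W \<in> permutation_words" "x \<in> permutation_region (U @ [a, b] @ W)"
  shows "swap_coords a b x \<in> permutation_region (U @ [b, a] @ W)"
proof -
  have d: "a \<noteq> b" "a \<notin> set U" "b \<notin> set U" "a \<notin> set W" "b \<notin> set W"
    using assms(1) by (auto simp: permutation_words_def)
  have s: "swap_coords a b x $ l = x $ l" if "l \<in> set U \<union> set W" for l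
    using d that by (auto simp: swap_coords_def)
  have "sorted_wrt (\<lambda>i j. swap_coords a b x $ i < swap_coords a b x $ j) V"
    if "sorted_wrt (\<lambda>i j. x $ i < x $ j) V" "set V \<subseteq> set U \<union> set W" for V
  proof -
    have "swap_coords a b x $ l = x $ l" if "l \<in> set V" for l
      using s \<open>set V \<subseteq> set U \<union> set W\<close> that by blast
    then show ?thesis using sorted_wrt_mono_rel[OF _ that(1)] by simp
  qed
  moreover have "swap_coords a b x $ a = x $ b" "swap_coords a b x $ b = x $ a"
    using d by (auto simp: swap_coords_def)
  ultimately show ?thesis
    using assms(2) s by (auto simp: permutation_region_def sorted_wrt_append)
qed

text \<open>No letter stands between \<open>a\<close> and \<open>b\<close>, so every other
  coordinate is on the same side of both; only their mutual comparison is reversed.\<close>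

lemma swap_coords_less_iff:
  assumes "U @ [a, b] @ W \<in> permutation_words" "x \<in> permutation_region (U @ [a, b] @ W)"
    and "\<not> (p = a \<and> q = b)" "\<not> (p = b \<and> q = a)"
  shows "swap_coords a b x $ p < swap_coords a b x $ q \<longleftrightarrow> x $ p < x $ q"
proof -
  have y: "swap_coords a b x $ a = x $ b" "swap_coords a b x $ b = x $ a"
    "\<And>l. l \<noteq> a \<Longrightarrow> l \<noteq> b \<Longrightarrow> swap_coords a b x $ l = x $ l"
    by (auto simp: swap_coords_def)
  show ?thesis
    using region_adjacent_cases[OF assms(1,2), of p] region_adjacent_cases[OF assms(1,2), of q]
      y(1,2) y(3)[of p] y(3)[of q] assms(3,4)
    by (cases "p = a"; cases "p = b"; cases "q = a"; cases "q = b") auto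
qed

text \<open>If \<open>I\<close> misses \<open>a\<close> or \<open>b\<close>, the exchange does not
  change the order on \<open>I\<close>. Otherwise a letter \<open>j\<close> of \<open>I\<close>
  standing before both has a smaller coordinate than either, so neither is a minimizer before or
  after.\<close>

lemma argmins_swap_coords:
  assumes perm: "U @ [a, b] @ W \<in> permutation_words"
    and x: "x \<in> permutation_region (U @ [a, b] @ W)"
    and j: "a \<in> I \<Longrightarrow> b \<in> I \<Longrightarrow> \<exists>j\<in>I. j \<in> set U"
  shows "argmins I (($) (swap_coords a b x)) = argmins I (($) x)"
proof -
  let ?y = "swap_coords a b x"
  have cases: "l \<in> set U \<and> x $ l < x $ a \<and> x $ l < x $ b
      \<or> l \<in> set W \<and> x $ a < x $ l \<and> x $ b < x $ l \<or> l = a \<or> l = b" for l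
    using region_adjacent_cases[OF perm x] .
  have y: "?y $ a = x $ b" "?y $ b = x $ a" "\<And>l. l \<noteq> a \<Longrightarrow> l \<noteq> b \<Longrightarrow> ?y $ l = x $ l"
    by (auto simp: swap_coords_def)
  show ?thesis
  proof (cases "a \<in> I \<and> b \<in> I")
    case True
    then obtain j where j: "j \<in> I" "j \<in> set U" using j by blast
    then have j2: "j \<noteq> a" "j \<noteq> b" "x $ j < x $ a" "x $ j < x $ b"
      using perm cases[of j] by (auto simp: permutation_words_def)
    \<comment> \<open>Once \<open>z j\<close> is below \<open>z a\<close> and \<open>z b\<close>,
      minimizing over \<open>I\<close> amounts to minimizing over \<open>I - {a, b}\<close>, where
      \<open>x\<close> and \<open>?y\<close> agree.\<close>
    have mem: "l \<in> argmins I z \<longleftrightarrow> l \<in> I - {a, b} \<and> (\<forall>k\<in>I-{a,b}. z l \<le> z k)"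
      if z: "z j < z a" "z j < z b" for l and z :: "'a \<Rightarrow> real"
    proof
      assume "l \<in> argmins I z"
      then show "l \<in> I - {a, b} \<and> (\<forall>k\<in>I-{a,b}. z l \<le> z k)"
        using z j by (force simp: argmins_def)
    next
      assume l: "l \<in> I - {a, b} \<and> (\<forall>k\<in>I-{a,b}. z l \<le> z k)"
      then have "z l \<le> z j" using j j2 by auto
      then show "l \<in> argmins I z"
        using l z True by (force simp: argmins_def)
    qed
    show ?thesis
    proof (rule set_eqI)
      fix l
      have "(\<forall>k\<in>I-{a,b}. ?y $ l \<le> ?y $ k) \<longleftrightarrow> (\<forall>k\<in>I-{a,b}. x $ l \<le> x $ k)" if "l \<in> I - {a, b}"
        using y(3) that by (intro ball_cong) simp_all
      moreover have "?y $ j < ?y $ a" "?y $ j < ?y $ b" using j2 y by simp_all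
      ultimately show "l \<in> argmins I (($) ?y) \<longleftrightarrow> l \<in> argmins I (($) x)"
        using mem[of "($) x" l] mem[of "($) ?y" l] j2(3,4) by blast
    qed
  next
    case False
    show ?thesis
    proof (rule argmins_cong_order)
      fix p q assume "p \<in> I" "q \<in> I"
      then show "?y $ p < ?y $ q \<longleftrightarrow> x $ p < x $ q"
        using False by (intro swap_coords_less_iff[OF perm x]) auto
    qed
  qed
qed

text \<open>A sylvester move read in either direction, so \<open>a\<close> and \<open>b\<close> may
  come in either order. The witness \<open>j\<close> stands earlier in the word and lies between
  them in value.\<close>

definition adjacent_move :: "('n::{finite,linorder} \<Rightarrow> nat) \<Rightarrow> 'n list \<Rightarrow> 'n list \<Rightarrow> bool" where
  "adjacent_move blk \<pi> \<sigma> \<longleftrightarrow> \<pi> \<in> permutation_words \<and>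
     (\<exists>U a b W j. \<pi> = U @ [a, b] @ W \<and> \<sigma> = U @ [b, a] @ W \<and> j \<in> set U \<and>
        blk a = blk b \<and> min a b < j \<and> j < max a b)"

text \<open>Presenting the blocks as fibers of a monotone map keeps partial sums out of the word
  combinatorics.\<close>

locale sylvester_blocks =
  fixes t :: nat and m :: "nat \<Rightarrow> nat" and blk :: "'n::{finite,linorder} \<Rightarrow> nat"
  assumes mem_block: "i \<in> block m s \<longleftrightarrow> blk i = s"
    and blk_range: "blk i \<in> {1..t}"
    and mono_blk: "mono blk"
begin

lemma blk_between:
  assumes "i \<le> j" "j \<le> k" "blk i = blk k"
  shows "blk j = blk i"
  using monoD[OF mono_blk assms(1)] monoD[OF mono_blk assms(2)] assms(3) by simp

lemma sylvester_stepI: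
  assumes "U @ [j] @ V @ [i, k] @ W \<in> permutation_words"
    "U @ [j] @ V @ [k, i] @ W \<in> permutation_words"
    and blk: "blk i = blk j" "blk j = blk k" and "i < j" "j < k"
  shows "sylvester_step t m (U @ [j] @ V @ [i, k] @ W) (U @ [j] @ V @ [k, i] @ W)"
proof -
  have "{i, j, k} \<subseteq> block m (blk j)" using blk by (auto simp: mem_block)
  then show ?thesis
    unfolding sylvester_step_def using assms blk_range[of j] by blast
qed

text \<open>The block of the witness \<open>j\<close> is not recorded in
  \<open>adjacent_move\<close>; it follows because \<open>blk\<close> is monotone and agrees at the
  two letters around \<open>j\<close>.\<close>

lemma symclp_sylvester_step:
  "sylvester_step t m \<pi> \<sigma> \<or> sylvester_step t m \<sigma> \<pi> \<longleftrightarrow> adjacent_move blk \<pi> \<sigma>" (is "?L \<longleftrightarrow> ?R")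
proof
  assume ?L
  then show ?R
  proof
    assume "sylvester_step t m \<pi> \<sigma>"
    then obtain U V W i j k s where *: "\<pi> \<in> permutation_words" "{i, j, k} \<subseteq> block m s" "i < j" "j < k"
        "\<pi> = U @ [j] @ V @ [i, k] @ W" "\<sigma> = U @ [j] @ V @ [k, i] @ W"
      unfolding sylvester_step_def by blast
    show ?R
      unfolding adjacent_move_def
      by (intro conjI exI[of _ "U @ [j] @ V"] exI[of _ i] exI[of _ k] exI[of _ W] exI[of _ j])
        (use * in \<open>auto simp: mem_block min_def max_def\<close>)
  next
    assume "sylvester_step t m \<sigma> \<pi>"
    then obtain U V W i j k s where *: "\<pi> \<in> permutation_words" "{i, j, k} \<subseteq> block m s" "i < j" "j < k"
        "\<sigma> = U @ [j] @ V @ [i, k] @ W" "\<pi> = U @ [j] @ V @ [k, i] @ W"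
      unfolding sylvester_step_def by blast
    show ?R
      unfolding adjacent_move_def
      by (intro conjI exI[of _ "U @ [j] @ V"] exI[of _ k] exI[of _ i] exI[of _ W] exI[of _ j])
        (use * in \<open>auto simp: mem_block min_def max_def\<close>)
  qed
next
  assume ?R
  then obtain U a b W j where *: "\<pi> \<in> permutation_words" "\<pi> = U @ [a, b] @ W" "\<sigma> = U @ [b, a] @ W"
      "j \<in> set U" "blk a = blk b" "min a b < j" "j < max a b"
    unfolding adjacent_move_def by blast
  have \<sigma>: "\<sigma> \<in> permutation_words" using *(1-3) by (auto simp: permutation_words_def)
  obtain U1 V where U: "U = U1 @ [j] @ V" using split_list[OF *(4)] by auto
  have bj: "blk j = blk a" "blk j = blk b"
    using blk_between[of "min a b" j "max a b"] *(5-7) by (auto simp: min_def max_def split: if_splits)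
  show ?L
  proof (cases "a < b")
    case True
    then have "sylvester_step t m \<pi> \<sigma>"
      using sylvester_stepI[of U1 j V a b W] *(1-3,6,7) \<sigma> bj by (simp add: U min_def max_def split: if_splits)
    then show ?L ..
  next
    case False
    then have "sylvester_step t m \<sigma> \<pi>"
      using sylvester_stepI[of U1 j V b a W] *(1-3,6,7) \<sigma> bj by (simp add: U min_def max_def split: if_splits)
    then show ?L ..
  qed
qed

text \<open>An interval holding \<open>a\<close> and \<open>b\<close> also holds the witness
  \<open>j\<close> between them, and a cross-block pair cannot hold two letters of one
  block.\<close>

lemma move_swap_coords:
  assumes "U @ [a, b] @ W \<in> permutation_words" "x \<in> permutation_region (U @ [a, b] @ W)"
    and j: "j \<in> set U" "blk a = blk b" "min a b < j" "j < max a b"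
    and I: "I \<in> block_family blk"
  shows "argmins I (($) (swap_coords a b x)) = argmins I (($) x)"
proof (rule argmins_swap_coords[OF assms(1,2)])
  assume ab: "a \<in> I" "b \<in> I"
  show "\<exists>j\<in>I. j \<in> set U"
  proof (cases "\<exists>i k. I = {i..k}")
    case True
    then obtain i k where "I = {i..k}" by blast
    then have "j \<in> I" using ab j(3,4) by (auto simp: min_def max_def split: if_splits)
    then show ?thesis using j(1) by blast
  next
    case False
    then obtain i k where "I = {i, k}" "blk i \<noteq> blk k"
      using I unfolding block_family_def by blast
    then have "a = b" using ab j(2) by auto
    then show ?thesis using j by auto
  qed
qed

text \<open>Induction along a chain of moves, carried by points: exchanging two coordinates of a
  point in the new region lands in the old region, where the claim is known.\<close>

lemma congruent_imp_argmins_eq: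
  assumes "sylvester_congruence t m \<pi> \<sigma>" "\<pi> \<in> permutation_words" "x \<in> permutation_region \<pi>"
    "y \<in> permutation_region \<sigma>" "I \<in> block_family blk"
  shows "argmins I (($) y) = argmins I (($) x)"
proof -
  have "\<sigma> \<in> permutation_words \<and> (\<forall>y\<in>permutation_region \<sigma>. argmins I (($) y) = argmins I (($) x))"
    using assms(1) unfolding sylvester_congruence_def
  proof (induction rule: equivclp_induct)
    case base
    show ?case
    proof (intro conjI ballI)
      fix y assume "y \<in> permutation_region \<pi>"
      then show "argmins I (($) y) = argmins I (($) x)"
        by (intro argmins_cong_order region_order[OF assms(2) _ assms(3)])
    qed (rule assms(2))
  next
    case (step \<sigma> \<rho>)
    then have "adjacent_move blk \<rho> \<sigma>" using symclp_sylvester_step by blast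
    then obtain U a b W j where *: "\<rho> \<in> permutation_words" "\<rho> = U @ [a, b] @ W" "\<sigma> = U @ [b, a] @ W"
        "j \<in> set U" "blk a = blk b" "min a b < j" "j < max a b"
      unfolding adjacent_move_def by blast
    have "argmins I (($) y) = argmins I (($) x)" if y: "y \<in> permutation_region \<rho>" for y
    proof -
      have "swap_coords a b y \<in> permutation_region \<sigma>"
        using swap_coords_region[of U a b W y] *(1-3) y by simp
      then have "argmins I (($) (swap_coords a b y)) = argmins I (($) x)" using step by blast
      then show ?thesis using move_swap_coords[of U a b W y j I] * y assms(5) by simp
    qed
    then show ?case using *(1) by blast
  qed
  then show ?thesis using assms(4) by blast
qed

text \<open>Bubble sort of \<open>\<pi>\<close> towards \<open>\<sigma>\<close>, by induction on the
  number of pairs that \<open>x\<close> and \<open>y\<close> order oppositely. Each exchange is a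
  congruence and keeps the minimizers, so the hypothesis survives.\<close>

lemma argmins_eq_imp_congruent:
  assumes "\<pi> \<in> permutation_words" "x \<in> permutation_region \<pi>"
    and \<sigma>: "\<sigma> \<in> permutation_words" "y \<in> permutation_region \<sigma>"
    and "\<And>I. I \<in> block_family blk \<Longrightarrow> argmins I (($) x) = argmins I (($) y)"
  shows "sylvester_congruence t m \<pi> \<sigma>"
  using assms(1,2,5)
proof (induction "card {(p, q). x $ p < x $ q \<and> y $ q < y $ p}" arbitrary: \<pi> x rule: less_induct)
  case less
  show ?case
  proof (cases "successively (\<lambda>i j. y $ i < y $ j) \<pi>")
    case True
    then have "sorted_wrt (\<lambda>i j. y $ i < y $ j) \<pi>"
      by (subst (asm) successively_conv_sorted_wrt) (auto intro: transpI)
    then have "y \<in> permutation_region \<pi>" by (simp add: permutation_region_def)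
    then have "\<pi> = \<sigma>" using region_unique less.prems(1) \<sigma> by blast
    then show ?thesis by (simp add: sylvester_congruence_def)
  next
    case False
    then obtain p where p: "Suc p < length \<pi>" "\<not> y $ (\<pi> ! p) < y $ (\<pi> ! Suc p)"
      unfolding successively_conv_nth by blast
    define a b U W where "a = \<pi> ! p" "b = \<pi> ! Suc p" "U = take p \<pi>" "W = drop (Suc (Suc p)) \<pi>"
    then have \<pi>: "\<pi> = U @ [a, b] @ W"
      using p(1) by (simp add: Cons_nth_drop_Suc)
    then have ne: "a \<noteq> b" using less.prems(1) by (auto simp: permutation_words_def)
    have yba: "y $ b < y $ a"
      using p(2) ne injD[OF region_imp_inj[OF \<sigma>], of a b] a_b_U_W_def by (force simp: not_less)
    have xab: "x $ a < x $ b"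
      using less.prems(2) by (simp add: \<pi> permutation_region_def sorted_wrt_append)
    have eqA: "argmins I (($) x) = argmins I (($) y)" if "I \<in> block_family blk" for I
      using less.prems(3) that .
    have finI: "I \<noteq> {}" "finite I" if "I \<in> block_family blk" for I
      using block_family_nonempty[OF that] by auto
    \<comment> \<open>Cross-block pairs belong to the family, so their order is visible in the
      minimizers and cannot be inverted.\<close>
    have blk: "blk a = blk b"
    proof (rule ccontr)
      assume "blk a \<noteq> blk b"
      then have "{a, b} \<in> block_family blk" by (auto simp: block_family_def)
      from eqA[OF this] show False using xab yba by (auto simp: argmins_def)
    qed
    let ?I = "{min a b..max a b}"
    have I: "?I \<in> block_family blk"
    proof -
      have "min a b \<le> max a b" "blk (min a b) = blk (max a b)"
        using blk by (auto simp: min_def max_def)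
      then show ?thesis unfolding block_family_def by blast
    qed
    have abI: "a \<in> ?I" "b \<in> ?I" by auto
    \<comment> \<open>The common minimizer is neither letter: \<open>j = b\<close> contradicts the
      order at \<open>x\<close>, and \<open>j = a\<close> the order at \<open>y\<close>. Hence it
      lies strictly inside the interval and is the witness for the move.\<close>
    obtain j where j: "j \<in> argmins ?I (($) x)" using argmins_nonempty finI[OF I] by blast
    then have j': "j \<in> argmins ?I (($) y)" using eqA[OF I] by simp
    have le: "x $ j \<le> x $ a" "y $ j \<le> y $ b" "j \<in> ?I"
      using j j' abI unfolding argmins_def by blast+
    then have "j \<noteq> a" "j \<noteq> b" using xab yba by auto
    then have "min a b \<noteq> j" "j \<noteq> max a b" by (auto simp: min_def max_def)
    moreover have "min a b \<le> j" "j \<le> max a b" using le(3) by (simp_all only: atLeastAtMost_iff)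
    ultimately have jj: "min a b < j" "j < max a b" by (simp_all only: less_le) simp_all
    have "j \<in> set U"
      using region_adjacent_cases[of U a b W x j] less.prems(1,2) \<open>j \<noteq> a\<close> \<open>j \<noteq> b\<close> le(1)
      unfolding \<pi> by (auto simp: not_less[symmetric])
    note jj = jj this
    let ?\<rho> = "U @ [b, a] @ W" and ?z = "swap_coords a b x"
    have \<rho>: "?\<rho> \<in> permutation_words" using less.prems(1) \<pi> by (auto simp: permutation_words_def)
    have z: "?z \<in> permutation_region ?\<rho>"
      using swap_coords_region less.prems(1,2) \<pi> by blast
    have zA: "argmins I (($) ?z) = argmins I (($) x)" if "I \<in> block_family blk" for I
      using move_swap_coords[of U a b W x j I] less.prems(1,2) \<pi> jj blk that by simp
    \<comment> \<open>The exchange affects only the comparison of \<open>a\<close> and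
      \<open>b\<close>: it creates no inversion and removes that one.\<close>
    have sub: "{(p, q). ?z $ p < ?z $ q \<and> y $ q < y $ p} \<subseteq> {(p, q). x $ p < x $ q \<and> y $ q < y $ p}"
    proof clarify
      fix p q assume pq: "?z $ p < ?z $ q" "y $ q < y $ p"
      show "x $ p < x $ q"
      proof (cases "p = a \<and> q = b \<or> p = b \<and> q = a")
        case True
        then show ?thesis using pq(2) xab yba by (elim disjE conjE) simp_all
      next
        case False
        then show ?thesis
          using swap_coords_less_iff[of U a b W x p q] less.prems(1,2) pq(1) unfolding \<pi> by blast
      qed
    qed
    have "(a, b) \<in> {(p, q). x $ p < x $ q \<and> y $ q < y $ p}" using xab yba by simp
    moreover have "(a, b) \<notin> {(p, q). ?z $ p < ?z $ q \<and> y $ q < y $ p}"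
      using xab ne by (simp add: swap_coords_def)
    ultimately have "{(p, q). ?z $ p < ?z $ q \<and> y $ q < y $ p} \<subset> {(p, q). x $ p < x $ q \<and> y $ q < y $ p}"
      using sub by blast
    then have "card {(p, q). ?z $ p < ?z $ q \<and> y $ q < y $ p} < card {(p, q). x $ p < x $ q \<and> y $ q < y $ p}"
      by (intro psubset_card_mono finite)
    then have "sylvester_congruence t m ?\<rho> \<sigma>"
      using less.hyps[of ?z ?\<rho>] \<rho> z zA eqA by simp
    moreover have "adjacent_move blk \<pi> ?\<rho>"
      unfolding adjacent_move_def using less.prems(1) \<pi> jj blk by blast
    then have "equivclp (sylvester_step t m) \<pi> ?\<rho>"
      using symclp_sylvester_step by blast
    ultimately show ?thesis
      unfolding sylvester_congruence_def by (rule transpD[OF transp_equivclp, rotated])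
  qed
qed

text \<open>Regions are defined by strict inequalities, so a class captures exactly the tie-free
  part of a cell.\<close>

lemma Union_regions:
  assumes "\<pi> \<in> permutation_words" "x \<in> permutation_region \<pi>"
  shows "(\<Union>\<sigma>\<in>{\<sigma>\<in>permutation_words. sylvester_congruence t m \<pi> \<sigma>}. permutation_region \<sigma>)
    = open_cell (block_family blk) x \<inter> {y. inj (($) y)}" (is "?L = ?R")
proof (intro equalityI subsetI)
  fix y assume "y \<in> ?L"
  then obtain \<sigma> where "\<sigma> \<in> permutation_words" "sylvester_congruence t m \<pi> \<sigma>" "y \<in> permutation_region \<sigma>"
    by blast
  then show "y \<in> ?R"
    using congruent_imp_argmins_eq assms region_imp_inj by (auto simp: open_cell_def)
next
  fix y assume y: "y \<in> ?R"
  then obtain \<sigma> where \<sigma>: "\<sigma> \<in> permutation_words" "y \<in> permutation_region \<sigma>"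
    using ex_region by blast
  have "sylvester_congruence t m \<pi> \<sigma>"
    using argmins_eq_imp_congruent[OF assms \<sigma>] y by (auto simp: open_cell_def)
  then show "y \<in> ?L" using \<sigma> by blast
qed

lemma sylvester_fan_eq_inj:
  "sylvester_fan t m = fan_of_max_cones {closed_cell (block_family blk) x | x. inj (($) x)}"
proof -
  let ?fam = "block_family blk"
  have strict: "strict_on ?fam (($) x)" if "inj (($) x)" for x :: "real ^ 'n::{finite,linorder}"
    using inj_imp_strict_on[OF that] block_family_nonempty by auto
  have cl: "closure (\<Union>\<sigma>\<in>{\<sigma>\<in>permutation_words. sylvester_congruence t m \<pi> \<sigma>}. permutation_region \<sigma>) = closed_cell ?fam x"
    if "\<pi> \<in> permutation_words" "x \<in> permutation_region \<pi>" for \<pi> x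
    using Union_regions[OF that] closure_open_cell(2)[OF strict[OF region_imp_inj[OF that]]] by simp
  have "{closure (\<Union>\<sigma>\<in>{\<sigma>\<in>permutation_words. sylvester_congruence t m \<pi> \<sigma>}. permutation_region \<sigma>) | \<pi>.
        \<pi> \<in> permutation_words} = {closed_cell ?fam x | x. inj (($) x)}" (is "?A = ?B")
  proof (intro equalityI subsetI)
    fix C assume "C \<in> ?A"
    then obtain \<pi> where \<pi>: "\<pi> \<in> permutation_words"
      "C = closure (\<Union>\<sigma>\<in>{\<sigma>\<in>permutation_words. sylvester_congruence t m \<pi> \<sigma>}. permutation_region \<sigma>)"
      by blast
    obtain x where x: "x \<in> permutation_region \<pi>" using region_nonempty[OF \<pi>(1)] by blast
    then show "C \<in> ?B" using \<pi> cl[OF \<pi>(1) x] region_imp_inj[OF \<pi>(1) x] by blast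
  next
    fix C assume "C \<in> ?B"
    then obtain x where x: "inj (($) x)" "C = closed_cell ?fam x" by blast
    obtain \<pi> where \<pi>: "\<pi> \<in> permutation_words" "x \<in> permutation_region \<pi>" using ex_region[OF x(1)] by blast
    then show "C \<in> ?A" using x(2) cl[OF \<pi>] by blast
  qed
  then show ?thesis unfolding sylvester_fan_def by simp
qed

lemma sylvester_fan_eq:
  "sylvester_fan t m = fan_of_max_cones {closed_cell (block_family blk) x | x. strict_on (block_family blk) (($) x)}"
  unfolding sylvester_fan_eq_inj
  by (rule arg_cong[OF closed_cells_strict_eq_inj[OF block_family_nonempty, symmetric]])

lemma complete_fan_sylvester_fan: "complete_fan (sylvester_fan t m :: (real ^ 'n::{finite,linorder}) set set)"
  unfolding sylvester_fan_eq_inj by (rule complete_fan_closed_cells[OF block_family_nonempty])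

end

section \<open>Steepest chords of a point sequence\<close>

definition chord :: "(nat \<Rightarrow> real) \<Rightarrow> (nat \<Rightarrow> real) \<Rightarrow> nat \<Rightarrow> nat \<Rightarrow> real" where
  "chord h y i j = (y j - y i) / (h j - h i)"

definition steepest :: "(nat \<Rightarrow> real) \<Rightarrow> nat \<Rightarrow> (nat \<Rightarrow> real) \<Rightarrow> nat \<Rightarrow> real" where
  "steepest h n y i = Max (chord h y i ` {i<..n+1})"

text \<open>The index \<open>n + 1\<close> is a sentinel, as if its value were minus infinity, like
  the slope at the maximal vertex. If the first later value not above \<open>x i\<close> equals
  \<open>x i\<close>, no \<open>j\<close> qualifies; existence thus excludes ties.\<close>

definition next_smaller :: "nat \<Rightarrow> (nat \<Rightarrow> real) \<Rightarrow> nat \<Rightarrow> nat \<Rightarrow> bool" where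
  "next_smaller n x i j \<longleftrightarrow> j \<in> {i<..n+1} \<and> (\<forall>k\<in>{i<..<j}. x i < x k) \<and> (j \<le> n \<longrightarrow> x j < x i)"

lemma next_smaller_unique:
  assumes "next_smaller n x i j" "next_smaller n x i k"
  shows "j = k"
proof -
  have "\<not> p < q" if "next_smaller n x i p" "next_smaller n x i q" for p q
  proof
    assume "p < q"
    then have "x i < x p" "x p < x i" using that by (auto simp: next_smaller_def)
    then show False by simp
  qed
  then show ?thesis using assms by (meson linorder_neqE_nat)
qed

text \<open>The index \<open>i\<close> wins on intervals up to \<open>j - 1\<close> and then loses
  to \<open>j\<close>. For \<open>j = n + 1\<close> the first interval already reaches the
  end.\<close>

lemma next_smaller_iff_argmins:
  assumes "i < j" "j \<le> n + 1"
  shows "next_smaller n x i j \<longleftrightarrow>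
    argmins {i..j-1} x = {i} \<and> (j \<le> n \<longrightarrow> argmins {i..j} x = {j})" (is "?L \<longleftrightarrow> ?R")
proof
  assume L: ?L
  have "argmins {i..j-1} x = {i}"
  proof (rule argmins_eq_singletonI)
    fix k assume "k \<in> {i..j-1}" "k \<noteq> i"
    then have "k \<in> {i<..<j}" using assms by auto
    then show "x i < x k" using L by (auto simp: next_smaller_def)
  qed (use assms in auto)
  moreover have "argmins {i..j} x = {j}" if "j \<le> n"
  proof (rule argmins_eq_singletonI)
    have ji: "x j < x i" using L that by (auto simp: next_smaller_def)
    fix k assume k: "k \<in> {i..j}" "k \<noteq> j"
    show "x j < x k"
    proof (cases "k = i")
      case False
      then have "k \<in> {i<..<j}" using k by auto
      then have "x i < x k" using L by (auto simp: next_smaller_def)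
      then show ?thesis using ji by simp
    qed (use ji in simp)
  qed (use assms in auto)
  ultimately show ?R by blast
next
  assume R: ?R
  have "x i < x k" if "k \<in> {i<..<j}" for k
    using argmins_singletonD(2)[of "{i..j-1}" x i k] R that by auto
  moreover have "x j < x i" if "j \<le> n"
    using argmins_singletonD(2)[of "{i..j}" x j i] R that assms by auto
  ultimately show ?L using assms by (simp add: next_smaller_def)
qed

text \<open>Following the pointers from \<open>i\<close> while they stay within
  \<open>{i..k}\<close> ends at the minimizer, so vectors with the same pointers share it. Taking
  \<open>y = x\<close> gives uniqueness of minimizers.\<close>

lemma argmins_interval_common:
  assumes "\<And>i. i \<in> {1..n} \<Longrightarrow> \<exists>j. next_smaller n x i j \<and> next_smaller n y i j"
    and "1 \<le> i" "i \<le> k" "k \<le> n"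
  shows "\<exists>l. argmins {i..k} x = {l} \<and> argmins {i..k} y = {l}"
  using assms(2-4)
proof (induction "k - i" arbitrary: i rule: less_induct)
  case less
  obtain j where j: "next_smaller n x i j" "next_smaller n y i j"
    using assms(1)[of i] less.prems by auto
  have ij: "i < j" using j by (auto simp: next_smaller_def)
  show ?case
  proof (cases "k < j")
    case True
    have "argmins {i..k} z = {i}" if "next_smaller n z i j" for z
      using that True less.prems by (intro argmins_eq_singletonI) (auto simp: next_smaller_def)
    then show ?thesis using j by blast
  next
    case False
    then have "k - j < k - i" "1 \<le> j" "j \<le> k" using ij less.prems by auto
    then obtain l where l: "argmins {j..k} x = {l}" "argmins {j..k} y = {l}"
      using less.hyps[of j] less.prems(3) by blast
    have "argmins {i..k} z = {l}" if z: "next_smaller n z i j" "argmins {j..k} z = {l}" for z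
    proof (rule argmins_eq_singletonI)
      show "l \<in> {i..k}" using argmins_singletonD(1)[OF z(2)] ij by auto
      fix a assume a: "a \<in> {i..k}" "a \<noteq> l"
      show "z l < z a"
      proof (cases "j \<le> a")
        case True
        then show ?thesis using argmins_singletonD(2)[OF z(2)] a by auto
      next
        case lt: False
        have "z l \<le> z j" using argmins_singletonD(2)[OF z(2), of j] False by (cases "j = l") auto
        moreover have "z j < z i" using z(1) False less.prems by (auto simp: next_smaller_def)
        moreover have "z i \<le> z a"
        proof (cases "a = i")
          case False
          then have "a \<in> {i<..<j}" using a lt by simp
          then have "z i < z a" using z(1) unfolding next_smaller_def by blast
          then show ?thesis by simp
        qed simp
        ultimately show ?thesis by linarith
      qed
    qed
    then show ?thesis using j l by blast
  qed
qed

text \<open>The first later index with value at most \<open>x i\<close> is the candidate; a tie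
  there would give \<open>{i..j}\<close> two minimizers.\<close>

lemma ex_next_smaller_if_singleton:
  assumes "\<And>k. i \<le> k \<Longrightarrow> k \<le> n \<Longrightarrow> is_singleton (argmins {i..k} x)" "i \<le> n"
  shows "\<exists>j. next_smaller n x i j"
proof (cases "\<exists>j. i < j \<and> j \<le> n \<and> x j \<le> x i")
  case False
  then have "next_smaller n x i (n + 1)"
    using assms(2) by (auto simp: next_smaller_def not_le)
  then show ?thesis ..
next
  case True
  define j where "j = (LEAST j. i < j \<and> j \<le> n \<and> x j \<le> x i)"
  have j: "i < j" "j \<le> n" "x j \<le> x i"
    using LeastI_ex[OF True] by (simp_all add: j_def)
  have least: "x i < x k" if "k \<in> {i<..<j}" for k
    using not_less_Least[of k "\<lambda>j. i < j \<and> j \<le> n \<and> x j \<le> x i"] that j unfolding j_def[symmetric] by auto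
  have "x j \<noteq> x i"
  proof
    assume eq: "x j = x i"
    have "x i \<le> x k" if "k \<in> {i..j}" for k
      using least[of k] eq that by (cases "k = i"; cases "k = j") auto
    then have "i \<in> argmins {i..j} x" "j \<in> argmins {i..j} x"
      using eq j by (auto simp: argmins_def)
    moreover have "is_singleton (argmins {i..j} x)" using assms(1) j by simp
    ultimately show False using j by (auto simp: is_singleton_def)
  qed
  then have "next_smaller n x i j" using j least by (auto simp: next_smaller_def)
  then show ?thesis ..
qed

lemma strict_intervals_iff_next_smaller:
  "(\<forall>i k. 1 \<le> i \<longrightarrow> i \<le> k \<longrightarrow> k \<le> n \<longrightarrow> is_singleton (argmins {i..k} x)) \<longleftrightarrow>
   (\<forall>i\<in>{1..n}. \<exists>j. next_smaller n x i j)"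
  using argmins_interval_common[of n x x] ex_next_smaller_if_singleton[of _ n x]
  by (auto simp: is_singleton_def)

lemma argmins_intervals_eq_iff_next_smaller:
  assumes "\<forall>i\<in>{1..n}. \<exists>j. next_smaller n x i j" "\<forall>i\<in>{1..n}. \<exists>j. next_smaller n y i j"
  shows "(\<forall>i k. 1 \<le> i \<longrightarrow> i \<le> k \<longrightarrow> k \<le> n \<longrightarrow> argmins {i..k} x = argmins {i..k} y) \<longleftrightarrow>
   (\<forall>i\<in>{1..n}. next_smaller n x i = next_smaller n y i)" (is "?L \<longleftrightarrow> ?R")
proof
  assume L: ?L
  show ?R
  proof (intro ballI ext)
    fix i j assume i: "i \<in> {1..n}"
    show "next_smaller n x i j = next_smaller n y i j"
    proof (cases "i < j \<and> j \<le> n + 1")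
      case True
      then have "argmins {i..j-1} x = argmins {i..j-1} y" "j \<le> n \<Longrightarrow> argmins {i..j} x = argmins {i..j} y"
        using L i by auto
      then show ?thesis using next_smaller_iff_argmins True by auto
    qed (auto simp: next_smaller_def)
  qed
next
  assume ?R
  then have "\<exists>j. next_smaller n x i j \<and> next_smaller n y i j" if "i \<in> {1..n}" for i
    using assms(1) that by auto
  from argmins_interval_common[OF this] show ?L by metis
qed

section \<open>Steepest slopes over strictly increasing heights\<close>

locale increasing_heights =
  fixes h :: "nat \<Rightarrow> real" and n :: nat
  assumes mono_h: "strict_mono_on {1..n+1} h"
begin

lemma h_less: "1 \<le> i \<Longrightarrow> i < j \<Longrightarrow> j \<le> n + 1 \<Longrightarrow> h i < h j"
  using mono_h by (auto simp: strict_mono_on_def)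

lemma chord_compare:
  assumes "1 \<le> i" "i < j" "j \<le> n + 1"
  shows "chord h y i j \<le> s \<longleftrightarrow> y j - y i \<le> s * (h j - h i)"
    and "chord h y i j < s \<longleftrightarrow> y j - y i < s * (h j - h i)"
    and "chord h y i j = s \<longleftrightarrow> y j - y i = s * (h j - h i)"
  using h_less[OF assms] unfolding chord_def
  by (simp_all add: pos_divide_le_eq pos_divide_less_eq divide_eq_eq)

lemma steepest_eq_iff:
  assumes "1 \<le> i" "i \<le> n"
  shows "steepest h n y i = s \<longleftrightarrow>
    (\<exists>j\<in>{i<..n+1}. chord h y i j = s) \<and> (\<forall>j\<in>{i<..n+1}. chord h y i j \<le> s)"
proof -
  have "chord h y i ` {i<..n+1} \<noteq> {}" using assms by auto
  then show ?thesis unfolding steepest_def by (subst Max_eq_iff) auto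
qed

lemma chord_le_steepest:
  assumes "1 \<le> i" "i < j" "j \<le> n + 1"
  shows "chord h y i j \<le> steepest h n y i"
  unfolding steepest_def using assms by (intro Max_ge) auto

lemma ex_chord_steepest:
  assumes "1 \<le> i" "i \<le> n"
  shows "\<exists>j\<in>{i<..n+1}. chord h y i j = steepest h n y i"
  using steepest_eq_iff[OF assms] by blast

text \<open>With \<open>j\<close> the first target, points between \<open>i\<close> and
  \<open>j\<close> lie strictly below the chord, so \<open>j\<close> is seen from them at a larger
  slope. Points after \<open>j\<close> lie on or below its line, so no slope from \<open>j\<close>
  is larger.\<close>

lemma least_steepest:
  assumes i: "1 \<le> i" and j: "i < j" "j \<le> n + 1" "chord h y i j = steepest h n y i"
    and least: "\<And>k. k \<in> {i<..<j} \<Longrightarrow> chord h y i k \<noteq> steepest h n y i"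
  shows "\<And>k. k \<in> {i<..<j} \<Longrightarrow> steepest h n y i < steepest h n y k"
    and "j \<le> n \<Longrightarrow> steepest h n y j \<le> steepest h n y i"
proof -
  let ?s = "steepest h n y i"
  have eqj: "y j - y i = ?s * (h j - h i)" using chord_compare(3)[OF i j(1,2)] j(3) by blast
  fix k assume k: "k \<in> {i<..<j}"
  have "chord h y i k < ?s"
    using least[OF k] chord_le_steepest[of i k y] i j k by auto
  then have "y k - y i < ?s * (h k - h i)"
    using chord_compare(2)[of i k y ?s] i j k by auto
  then have "?s * (h j - h k) < y j - y k"
    using eqj by (simp add: algebra_simps)
  then have "?s < chord h y k j"
    using chord_compare(1)[of k j y ?s] i j k by (auto simp: not_le[symmetric])
  also have "\<dots> \<le> steepest h n y k" using chord_le_steepest[of k j] i j k by auto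
  finally show "?s < steepest h n y k" .
next
  let ?s = "steepest h n y i"
  have eqj: "y j - y i = ?s * (h j - h i)" using chord_compare(3)[OF i j(1,2)] j(3) by blast
  assume jn: "j \<le> n"
  then obtain l where l: "l \<in> {j<..n+1}" "chord h y j l = steepest h n y j"
    using ex_chord_steepest[of j y] i j by auto
  have "chord h y i l \<le> ?s" using chord_le_steepest[of i l y] i j l by auto
  then have "y l - y i \<le> ?s * (h l - h i)" using chord_compare(1)[of i l y ?s] i j l by auto
  then have "y l - y j \<le> ?s * (h l - h j)" using eqj by (simp add: algebra_simps)
  then show "steepest h n y j \<le> ?s" using chord_compare(1)[of j l y ?s] i j l by auto
qed

text \<open>
  The slope-maximising chord from \<open>i\<close> leads to the next vertex of the upper hull of the points to the
  right of \<open>i\<close>; along that hull the steepest slopes decrease, and below it they exceed the one at \<open>i\<close>.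
\<close>

lemma unique_steepest_iff_next_smaller:
  assumes i: "1 \<le> i" "i \<le> n"
  shows "{q \<in> {i<..n+1}. chord h y i q = steepest h n y i} = {j} \<longleftrightarrow>
    next_smaller n (steepest h n y) i j" (is "?A = {j} \<longleftrightarrow> ?R j")
proof -
  let ?s = "steepest h n y i"
  have eq: "y q - y i = ?s * (h q - h i)" if "q \<in> ?A" for q
    using chord_compare(3)[of i q y ?s] that i by auto
  \<comment> \<open>The first of the maximising targets; any others lie on the line through
    \<open>i\<close> and \<open>j1\<close>.\<close>
  define j1 where "j1 = Min ?A"
  have "?A \<noteq> {}" using ex_chord_steepest[OF i, of y] by auto
  moreover have fin: "finite ?A" by simp
  ultimately have j1: "j1 \<in> ?A" unfolding j1_def by (rule Min_in[rotated])
  have j1_le: "j1 \<le> q" if "q \<in> ?A" for q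
    unfolding j1_def using fin that by (rule Min_le)
  have not: "chord h y i k \<noteq> ?s" if "k \<in> {i<..<j1}" for k
  proof
    assume "chord h y i k = ?s"
    then have "k \<in> ?A" using that j1 by auto
    then show False using j1_le[of k] that by auto
  qed
  have j1': "i < j1" "j1 \<le> n + 1" "chord h y i j1 = ?s" using j1 by auto
  note least = least_steepest[OF i(1) j1' not]
  \<comment> \<open>Beyond \<open>j1\<close>, slope \<open>?s\<close> from \<open>i\<close> and
    slope \<open>?s\<close> from \<open>j1\<close> both mean lying on that line. So for
    \<open>j1 \<le> n\<close> a second target exists iff the steepest slope at \<open>j1\<close> is
    again \<open>?s\<close>.\<close>
  have tie: "l \<in> ?A \<longleftrightarrow> chord h y j1 l = ?s" if l: "l \<in> {j1<..n+1}" for l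
  proof -
    have "chord h y i l = ?s \<longleftrightarrow> y l - y i = ?s * (h l - h i)"
      using chord_compare(3)[of i l y ?s] i l j1' by auto
    also have "\<dots> \<longleftrightarrow> y l - y j1 = ?s * (h l - h j1)"
      using eq[OF j1] by (simp add: algebra_simps) linarith
    also have "\<dots> \<longleftrightarrow> chord h y j1 l = ?s"
      using chord_compare(3)[of j1 l y ?s] i l j1' by auto
    finally show ?thesis using l j1' by auto
  qed
  show ?thesis
  proof
    assume A: "?A = {j}"
    from j1 have j: "j = j1" unfolding A by simp
    have "steepest h n y j1 \<noteq> ?s" if n: "j1 \<le> n"
    proof
      assume e: "steepest h n y j1 = ?s"
      obtain l where l: "l \<in> {j1<..n+1}" "chord h y j1 l = steepest h n y j1"
        using ex_chord_steepest[of j1 y] i j1' n by auto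
      then have "l \<in> ?A" using tie e by simp
      then have "l = j" unfolding A by simp
      then show False using j l by simp
    qed
    then show "?R j" using least j1' j by (force simp: next_smaller_def)
  next
    assume R: "?R j"
    \<comment> \<open>Before \<open>j1\<close> all steepest slopes exceed \<open>?s\<close>, so
      \<open>j\<close> cannot be earlier; the one at \<open>j1\<close> does not, so
      \<open>j1\<close> cannot be skipped.\<close>
    have j: "j = j1"
    proof (cases j j1 rule: linorder_cases)
      case less
      then have "?s < steepest h n y j" "steepest h n y j < ?s"
        using R least(1)[of j] j1' by (auto simp: next_smaller_def)
      then show ?thesis by simp
    next
      case greater
      then have "?s < steepest h n y j1" "steepest h n y j1 \<le> ?s"
        using R least(2) j1' by (auto simp: next_smaller_def)
      then show ?thesis by simp
    qed
    have "l = j1" if l: "l \<in> ?A" for l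
    proof (rule ccontr)
      assume "l \<noteq> j1"
      then have l': "l \<in> {j1<..n+1}" using j1_le[OF l] l by auto
      then have "chord h y j1 l = ?s" using tie l by blast
      then have "?s \<le> steepest h n y j1" using chord_le_steepest[of j1 l y] l' i j1' by auto
      moreover have "steepest h n y j1 < ?s" using R j l' by (auto simp: next_smaller_def)
      ultimately show False by simp
    qed
    then show "?A = {j}" using j j1 by blast
  qed
qed

text \<open>Solved for the leftmost height: \<open>y i\<close> is the highest value at
  \<open>h i\<close> among the lines of slope \<open>s\<close> through the later points. Slopes
  therefore determine heights from right to left, and arbitrary slopes occur.\<close>

lemma steepest_eq_iff_height:
  assumes i: "1 \<le> i" "i \<le> n"
  shows "steepest h n y i = s \<longleftrightarrow> y i = Max ((\<lambda>j. y j - s * (h j - h i)) ` {i<..n+1})"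
proof -
  have "(\<lambda>j. y j - s * (h j - h i)) ` {i<..n+1} \<noteq> {}" using i by auto
  then have "y i = Max ((\<lambda>j. y j - s * (h j - h i)) ` {i<..n+1}) \<longleftrightarrow>
      (\<exists>j\<in>{i<..n+1}. y i = y j - s * (h j - h i)) \<and> (\<forall>j\<in>{i<..n+1}. y j - s * (h j - h i) \<le> y i)"
    by (subst eq_commute, subst Max_eq_iff) auto
  also have "\<dots> \<longleftrightarrow> (\<exists>j\<in>{i<..n+1}. chord h y i j = s) \<and> (\<forall>j\<in>{i<..n+1}. chord h y i j \<le> s)"
    using chord_compare(1,3)[of i _ y s] i by (intro arg_cong2[of _ _ _ _ "(\<and>)"] bex_cong ball_cong) auto
  finally show ?thesis using steepest_eq_iff[OF i] by blast
qed

text \<open>Fixing the last height removes the common shift, which slopes cannot see.\<close>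

lemma steepest_inj:
  assumes "y (n + 1) = z (n + 1)" "\<And>i. i \<in> {1..n} \<Longrightarrow> steepest h n y i = steepest h n z i"
    and "1 \<le> i" "i \<le> n + 1"
  shows "y i = z i"
  using assms(3,4)
proof (induction "n + 1 - i" arbitrary: i rule: less_induct)
  case less
  show ?case
  proof (cases "i = n + 1")
    case False
    then have i: "1 \<le> i" "i \<le> n" using less.prems by auto
    have "(\<lambda>j. y j - steepest h n z i * (h j - h i)) ` {i<..n+1}
        = (\<lambda>j. z j - steepest h n z i * (h j - h i)) ` {i<..n+1}"
      using less.hyps i by (intro image_cong) auto
    then show ?thesis
      using steepest_eq_iff_height[OF i, of y "steepest h n z i"]
        steepest_eq_iff_height[OF i, of z "steepest h n z i"] assms(2)[of i] i by auto
  qed (use assms in simp)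
qed

lemma steepest_surj:
  "\<exists>y. y (n + 1) = 0 \<and> (\<forall>i\<in>{1..n}. steepest h n y i = x i)"
proof -
  \<comment> \<open>\<open>p\<close> counts the indices already treated, from the right end.\<close>
  have "\<exists>y. y (n + 1) = 0 \<and> (\<forall>i\<in>{1..n}. n + 1 - p \<le> i \<longrightarrow> steepest h n y i = x i)" for p
  proof (induction p)
    case 0
    show ?case by (intro exI[of _ "\<lambda>_. 0"]) auto
  next
    case (Suc p)
    then obtain y where y: "y (n + 1) = 0"
      "\<And>i. i \<in> {1..n} \<Longrightarrow> n + 1 - p \<le> i \<Longrightarrow> steepest h n y i = x i" by blast
    define i0 where "i0 = n - p"
    show ?case
    proof (cases "1 \<le> i0")
      case False
      then have "n + 1 - p \<le> i" if "i \<in> {1..n}" for i using that i0_def by auto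
      then show ?thesis using y by blast
    next
      case True
      define z where "z = y(i0 := Max ((\<lambda>j. y j - x i0 * (h j - h i0)) ` {i0<..n+1}))"
      have "i0 \<le> n" by (simp add: i0_def)
      \<comment> \<open>A steepest slope looks only to the right, so changing the height at
        \<open>i0\<close> leaves all later slopes alone.\<close>
      have st: "steepest h n z i = steepest h n y i" if "i0 < i" for i
        unfolding steepest_def
        by (intro arg_cong[of _ _ Max] image_cong) (use that in \<open>auto simp: chord_def z_def\<close>)
      have "z i0 = Max ((\<lambda>j. z j - x i0 * (h j - h i0)) ` {i0<..n+1})"
        unfolding z_def by (simp add: image_def)
      then have "steepest h n z i0 = x i0"
        using steepest_eq_iff_height True \<open>i0 \<le> n\<close> by blast
      moreover have "i = i0 \<or> i0 < i \<and> n + 1 - p \<le> i" if "i \<in> {1..n}" "n + 1 - Suc p \<le> i" for i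
        using that True by (auto simp: i0_def)
      ultimately have "steepest h n z i = x i" if "i \<in> {1..n}" "n + 1 - Suc p \<le> i" for i
        using y(2)[of i] st[of i] that by metis
      moreover have "z (n + 1) = 0" using y(1) \<open>i0 \<le> n\<close> by (simp add: z_def)
      ultimately show ?thesis by blast
    qed
  qed
  from this[of "n + 1"] show ?thesis by auto
qed

end

section \<open>Blocks of coordinates\<close>

lemma pos_less: "i < j \<Longrightarrow> pos i < pos j"
  unfolding pos_def by (intro psubset_card_mono) auto

lemma pos_le_iff: "pos i \<le> pos j \<longleftrightarrow> i \<le> j"
  using pos_less[of i j] pos_less[of j i] by (cases i j rule: linorder_cases) auto

lemma pos_eq_iff: "pos i = pos j \<longleftrightarrow> i = j"
  using pos_le_iff[of i j] pos_le_iff[of j i] by auto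

lemma bij_betw_pos: "bij_betw pos (UNIV :: 'n::{finite,linorder} set) {1..CARD('n)}"
proof -
  have inj: "inj (pos :: 'n \<Rightarrow> nat)" by (auto simp: inj_def pos_eq_iff)
  have "pos i \<in> {1..CARD('n)}" for i :: 'n
  proof -
    have "card {..i} > 0" by (subst card_gt_0_iff) auto
    moreover have "card {..i} \<le> CARD('n)" by (intro card_mono) auto
    ultimately show ?thesis by (simp add: pos_def)
  qed
  then have "range (pos :: 'n \<Rightarrow> nat) = {1..CARD('n)}"
    by (intro card_subset_eq) (auto simp: card_image[OF inj])
  then show ?thesis using inj by (simp add: bij_betw_def)
qed

locale block_composition =
  fixes t :: nat and m :: "nat \<Rightarrow> nat" and ty :: "'n::{finite,linorder} itself"
  assumes dim: "CARD('n) = (\<Sum>s=1..t. m s)"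
begin

text \<open>Taking the least \<open>s\<close> skips empty blocks, where consecutive partial sums
  coincide.\<close>

definition blk :: "'n \<Rightarrow> nat" where
  "blk i = (LEAST s. pos i \<le> partial_sum m s)"

definition lab :: "'n \<Rightarrow> nat" where
  "lab i = pos i - partial_sum m (blk i - 1)"

definition idx :: "nat \<Rightarrow> nat \<Rightarrow> 'n" where
  "idx s p = the_inv pos (partial_sum m (s - 1) + p)"

lemma partial_sum_mono: "s \<le> r \<Longrightarrow> partial_sum m s \<le> partial_sum m r"
  unfolding partial_sum_def by (intro sum_mono2) auto

lemma partial_sum_t: "partial_sum m t = CARD('n)"
  by (simp add: partial_sum_def dim)

lemma partial_sum_pred: "1 \<le> s \<Longrightarrow> partial_sum m s = partial_sum m (s - 1) + m s"
  unfolding partial_sum_def by (cases s) auto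

lemma pos_range: "1 \<le> pos (i :: 'n)" "pos (i :: 'n) \<le> CARD('n)"
  using bij_betw_apply[OF bij_betw_pos, of i] by auto

lemma blk_bounds:
  "pos i \<le> partial_sum m (blk i)" "partial_sum m (blk i - 1) < pos i" "1 \<le> blk i" "blk i \<le> t"
proof -
  have t: "pos i \<le> partial_sum m t" using pos_range partial_sum_t by simp
  show 1: "pos i \<le> partial_sum m (blk i)" unfolding blk_def using t by (rule LeastI)
  show "blk i \<le> t" unfolding blk_def using t by (rule Least_le)
  \<comment> \<open>\<open>partial_sum m 0\<close> is 0 while positions start at 1. This also makes
    the natural-number subtraction in \<open>blk i - 1\<close> harmless.\<close>
  show 2: "1 \<le> blk i"
    using 1 pos_range(1)[of i] by (cases "blk i") (auto simp: partial_sum_def)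
  then have "\<not> pos i \<le> partial_sum m (blk i - 1)"
    unfolding blk_def by (intro not_less_Least) (auto simp: blk_def)
  then show "partial_sum m (blk i - 1) < pos i" by simp
qed

lemma mem_block_iff: "i \<in> block m s \<longleftrightarrow> blk i = s"
proof
  assume "blk i = s"
  then show "i \<in> block m s" using blk_bounds[of i] by (auto simp: block_def)
next
  assume i: "i \<in> block m s"
  then have "blk i \<le> s" unfolding blk_def block_def by (auto intro: Least_le)
  moreover have "\<not> blk i < s"
  proof
    assume "blk i < s"
    then have "partial_sum m (blk i) \<le> partial_sum m (s - 1)" by (intro partial_sum_mono) simp
    then show False using blk_bounds(1)[of i] i by (simp add: block_def)
  qed
  ultimately show "blk i = s" by simp
qed

sublocale sylvester_blocks t m blk
proof
  show "i \<in> block m s \<longleftrightarrow> blk i = s" for i :: 'n and s by (rule mem_block_iff)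
  show "blk i \<in> {1..t}" for i :: 'n using blk_bounds[of i] by simp
  show "mono blk"
  proof
    fix i j :: 'n assume "i \<le> j"
    then have "pos i \<le> partial_sum m (blk j)"
      using blk_bounds(1)[of j] pos_le_iff[of i j] by simp
    then show "blk i \<le> blk j" unfolding blk_def[of i] by (rule Least_le)
  qed
qed

lemma lab_range: "lab i \<in> {1..m (blk i)}"
  using blk_bounds[of i] partial_sum_pred[of "blk i"] by (auto simp: lab_def)

lemma pos_eq: "pos i = partial_sum m (blk i - 1) + lab i"
  using blk_bounds(2)[of i] by (simp add: lab_def)

lemma pos_idx:
  assumes "s \<in> {1..t}" "p \<in> {1..m s}"
  shows "pos (idx s p) = partial_sum m (s - 1) + p"
proof -
  have "partial_sum m (s - 1) + p \<le> CARD('n)"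
    using assms partial_sum_pred[of s] partial_sum_mono[of s t] partial_sum_t by auto
  then have "partial_sum m (s - 1) + p \<in> range (pos :: 'n \<Rightarrow> nat)"
    using bij_betw_imp_surj_on[OF bij_betw_pos[where 'n = 'n]] assms by auto
  then show ?thesis
    unfolding idx_def by (intro f_the_inv_into_f) (auto simp: inj_on_def pos_eq_iff)
qed

lemma blk_idx:
  assumes "s \<in> {1..t}" "p \<in> {1..m s}"
  shows "blk (idx s p) = s"
  unfolding mem_block_iff[symmetric] block_def
  using pos_idx[OF assms] assms partial_sum_pred[of s] by auto

lemma lab_idx:
  assumes "s \<in> {1..t}" "p \<in> {1..m s}"
  shows "lab (idx s p) = p"
  unfolding lab_def blk_idx[OF assms] pos_idx[OF assms] by simp

lemma idx_blk_lab [simp]: "idx (blk i) (lab i) = i"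
proof -
  have "pos (idx (blk i) (lab i)) = pos i" using pos_idx[OF blk_range lab_range] pos_eq by simp
  then show ?thesis unfolding pos_eq_iff .
qed

lemma le_iff_lab_le: "blk i = blk k \<Longrightarrow> i \<le> k \<longleftrightarrow> lab i \<le> lab k"
  using pos_eq[of i] pos_eq[of k] pos_le_iff[of i k] by simp

lemma interval_eq_idx:
  assumes "s \<in> {1..t}" "1 \<le> p" "p \<le> q" "q \<le> m s"
  shows "{idx s p..idx s q} = idx s ` {p..q}"
proof (intro equalityI subsetI)
  have pq: "p \<in> {1..m s}" "q \<in> {1..m s}" using assms by auto
  fix j assume j: "j \<in> {idx s p..idx s q}"
  then have s: "blk j = s"
    using blk_between[of "idx s p" j "idx s q"] blk_idx[OF assms(1)] pq by auto
  then have "lab j \<in> {p..q}"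
    using j le_iff_lab_le[of "idx s p" j] le_iff_lab_le[of j "idx s q"] blk_idx[OF assms(1)] lab_idx[OF assms(1)] pq
    by auto
  then show "j \<in> idx s ` {p..q}" using idx_blk_lab[of j] s by (metis imageI)
next
  fix j assume "j \<in> idx s ` {p..q}"
  then obtain r where r: "j = idx s r" "r \<in> {p..q}" by auto
  moreover have "r \<in> {1..m s}" "p \<in> {1..m s}" "q \<in> {1..m s}" using r assms by auto
  ultimately show "j \<in> {idx s p..idx s q}"
    using le_iff_lab_le blk_idx[OF assms(1)] lab_idx[OF assms(1)] by simp
qed

lemma inj_on_idx: "s \<in> {1..t} \<Longrightarrow> inj_on (idx s) {1..m s}"
  using lab_idx by (metis inj_onI)

lemma argmins_idx:
  assumes "s \<in> {1..t}" "1 \<le> p" "p \<le> q" "q \<le> m s"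
  shows "argmins {idx s p..idx s q} x = idx s ` argmins {p..q} (x \<circ> idx s)"
  unfolding interval_eq_idx[OF assms] by (auto simp: argmins_def)

lemma card_block: "s \<in> {1..t} \<Longrightarrow> card (block m s :: 'n set) = m s"
proof -
  assume s: "s \<in> {1..t}"
  have "block m s = idx s ` {1..m s}"
    using s blk_idx[OF s] lab_range idx_blk_lab by (force simp: mem_block_iff image_iff)
  then show ?thesis using card_image[OF inj_on_idx[OF s]] by simp
qed

text \<open>Splits the family into what is seen inside one factor, in labels \<open>1..m s\<close>,
  and what compares two factors.\<close>

lemma block_intervals:
  "(\<forall>I\<in>block_family blk. R I) \<longleftrightarrow>
    (\<forall>s\<in>{1..t}. \<forall>p q. 1 \<le> p \<longrightarrow> p \<le> q \<longrightarrow> q \<le> m s \<longrightarrow> R {idx s p..idx s q}) \<and>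
    (\<forall>i k. blk i \<noteq> blk k \<longrightarrow> R {i, k})" (is "?L \<longleftrightarrow> ?R")
proof
  assume L: ?L
  have "R {idx s p..idx s q}" if "s \<in> {1..t}" "1 \<le> p" "p \<le> q" "q \<le> m s" for s p q
  proof -
    have "p \<in> {1..m s}" "q \<in> {1..m s}" using that by auto
    then have "idx s p \<le> idx s q \<and> blk (idx s p) = blk (idx s q)"
      using le_iff_lab_le[of "idx s p" "idx s q"] that by (simp add: blk_idx lab_idx)
    then show ?thesis using L unfolding block_family_def by blast
  qed
  moreover have "R {i, k}" if "blk i \<noteq> blk k" for i k
    using L that unfolding block_family_def by blast
  ultimately show ?R by blast
next
  assume R: ?R
  show ?L
  proof
    fix I assume "I \<in> block_family blk"
    then consider i k where "I = {i..k}" "i \<le> k" "blk i = blk k" | i k where "I = {i, k}" "blk i \<noteq> blk k"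
      unfolding block_family_def by blast
    then show "R I"
    proof cases
      case 1
      have "lab i \<le> lab k" using 1 le_iff_lab_le by blast
      then have "R {idx (blk i) (lab i)..idx (blk i) (lab k)}"
        using R blk_range[of i] lab_range[of i] lab_range[of k] 1(3) by (metis atLeastAtMost_iff)
      then show ?thesis using 1 idx_blk_lab[of k] idx_blk_lab[of i] by simp
    next
      case 2
      then show ?thesis using R by blast
    qed
  qed
qed

lemma strict_on_block_family_iff:
  "strict_on (block_family blk) x \<longleftrightarrow>
    (\<forall>s\<in>{1..t}. \<forall>i\<in>{1..m s}. \<exists>j. next_smaller (m s) (x \<circ> idx s) i j) \<and>
    (\<forall>i k. blk i \<noteq> blk k \<longrightarrow> x i \<noteq> x k)"
proof -
  have *: "is_singleton (idx s ` argmins {p..q} z) \<longleftrightarrow> is_singleton (argmins {p..q} z)"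
    if "s \<in> {1..t}" "1 \<le> p" "p \<le> q" "q \<le> m s" for s p q z
  proof -
    have "inj_on (idx s) (argmins {p..q} z)"
      using inj_on_idx[OF that(1)] by (rule inj_on_subset) (use that in \<open>auto simp: argmins_def\<close>)
    then show ?thesis by (simp add: is_singleton_altdef card_image)
  qed
  have pair: "is_singleton (argmins {i, k} x) \<longleftrightarrow> x i \<noteq> x k" if "blk i \<noteq> blk k" for i k
  proof -
    have "i \<noteq> k" using that by auto
    have "argmins {i, k} x = {i, k}" if "x i = x k" using that by (auto simp: argmins_def)
    moreover have "argmins {i, k} x = {i}" if "x i < x k" using that by (auto simp: argmins_def)
    moreover have "argmins {i, k} x = {k}" if "x k < x i" using that by (auto simp: argmins_def)
    ultimately show ?thesis
      using \<open>i \<noteq> k\<close> by (cases "x i" "x k" rule: linorder_cases) (auto simp: is_singleton_altdef)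
  qed
  show ?thesis
    unfolding strict_on_def block_intervals strict_intervals_iff_next_smaller[symmetric]
    using argmins_idx * pair by (simp cong: conj_cong)
qed

text \<open>Inside a block the pointers carry the same information as the interval minimizers; the
  minimizers of a pair record its comparison in both directions.\<close>

lemma argmins_block_family_eq_iff:
  assumes "strict_on (block_family blk) x" "strict_on (block_family blk) y"
  shows "(\<forall>I\<in>block_family blk. argmins I x = argmins I y) \<longleftrightarrow>
    (\<forall>s\<in>{1..t}. \<forall>i\<in>{1..m s}. next_smaller (m s) (x \<circ> idx s) i = next_smaller (m s) (y \<circ> idx s) i) \<and>
    (\<forall>i k. blk i \<noteq> blk k \<longrightarrow> (x i \<le> x k \<longleftrightarrow> y i \<le> y k))"
proof -
  have *: "idx s ` argmins {p..q} z = idx s ` argmins {p..q} z' \<longleftrightarrow> argmins {p..q} z = argmins {p..q} z'"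
    if "s \<in> {1..t}" "1 \<le> p" "p \<le> q" "q \<le> m s" for s p q z z'
    using inj_on_idx[OF that(1)] by (rule inj_on_image_eq_iff) (use that in \<open>auto simp: argmins_def\<close>)
  have pair: "(\<forall>i k. blk i \<noteq> blk k \<longrightarrow> argmins {i, k} x = argmins {i, k} y)
      \<longleftrightarrow> (\<forall>i k. blk i \<noteq> blk k \<longrightarrow> (x i \<le> x k \<longleftrightarrow> y i \<le> y k))" (is "?L \<longleftrightarrow> ?R")
  proof -
    have mem: "i \<in> argmins {i, k} z \<longleftrightarrow> z i \<le> z k" for i k :: 'n and z :: "'n \<Rightarrow> real"
      by (auto simp: argmins_def)
    show ?thesis
    proof
      assume L: ?L
      show ?R
      proof (intro allI impI)
        fix i k assume "blk i \<noteq> blk k"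
        then have "argmins {i, k} x = argmins {i, k} y" using L by blast
        then show "x i \<le> x k \<longleftrightarrow> y i \<le> y k" using mem by metis
      qed
    next
      assume R: ?R
      show ?L
      proof (intro allI impI)
        fix i k assume "blk i \<noteq> blk k"
        then have "x i \<le> x k \<longleftrightarrow> y i \<le> y k" "x k \<le> x i \<longleftrightarrow> y k \<le> y i" using R by metis+
        then show "argmins {i, k} x = argmins {i, k} y" by (auto simp: argmins_def)
      qed
    qed
  qed
  have nx: "\<forall>i\<in>{1..m s}. \<exists>j. next_smaller (m s) (x \<circ> idx s) i j"
    "\<forall>i\<in>{1..m s}. \<exists>j. next_smaller (m s) (y \<circ> idx s) i j" if "s \<in> {1..t}" for s
    using assms that unfolding strict_on_block_family_iff by blast+
  have "(\<forall>p q. 1 \<le> p \<longrightarrow> p \<le> q \<longrightarrow> q \<le> m s \<longrightarrow>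
      argmins {idx s p..idx s q} x = argmins {idx s p..idx s q} y) \<longleftrightarrow>
    (\<forall>i\<in>{1..m s}. next_smaller (m s) (x \<circ> idx s) i = next_smaller (m s) (y \<circ> idx s) i)"
    if s: "s \<in> {1..t}" for s
    unfolding argmins_intervals_eq_iff_next_smaller[OF nx[OF s], symmetric]
    using argmins_idx[OF s] *[OF s] by (simp cong: conj_cong)
  then show ?thesis unfolding block_intervals pair by simp
qed

end

section \<open>Products of simplices\<close>

lemma slope_eq_chord:
  "slope b w (u i) (u j) = chord (\<lambda>i. b \<bullet> u i) (\<lambda>i. w \<bullet> u i) i j"
  by (simp add: slope_def chord_def inner_diff_right)

lemma closed_segment_edge_of_iff:
  fixes x y :: "'a::euclidean_space"
  shows "closed_segment x y edge_of Q \<longleftrightarrow> x \<noteq> y \<and> closed_segment x y face_of Q"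
  by (auto simp: edge_of_def segment_convex_hull aff_dim_convex_hull aff_dim_2)

lemma component_linear: "linear (component m s)"
  by (intro linearI) (simp_all add: component_def vec_eq_iff)

lemma component_add: "component m s (x + y) = component m s x + component m s y"
  by (simp add: component_def vec_eq_iff)

lemma component_diff: "component m s (x - y) = component m s x - component m s y"
  by (simp add: component_def vec_eq_iff)

lemma component_scaleR: "component m s (r *\<^sub>R x) = r *\<^sub>R component m s x"
  by (simp add: component_def vec_eq_iff)

lemma component_block_space: "x \<in> block_space m s \<Longrightarrow> component m s x = x"
  by (auto simp: component_def block_space_def vec_eq_iff)

lemma inner_component_block_space: "x \<in> block_space m s \<Longrightarrow> component m s w \<bullet> x = w \<bullet> x"
  unfolding inner_vec_def component_def block_space_def by (intro sum.cong) auto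

lemma component_component: "component m s (component m s x) = component m s x"
  by (simp add: component_def vec_eq_iff)

locale simplex_product =
  fixes t :: nat
    and m :: "nat \<Rightarrow> nat"
    and \<Delta> :: "nat \<Rightarrow> (real ^ 'n::{finite,linorder}) set"
    and c :: "real ^ 'n::{finite,linorder}"
    and u :: "nat \<Rightarrow> nat \<Rightarrow> (real ^ 'n::{finite,linorder})"
  assumes card_eq: "CARD('n) = (\<Sum>s=1..t. m s)"
    and subspace: "\<And>s. s \<in> {1..t} \<Longrightarrow> \<Delta> s \<subseteq> block_space m s"
    and simplex: "\<And>s. s \<in> {1..t} \<Longrightarrow> int (m s) simplex \<Delta> s"
    and labels: "\<And>s. s \<in> {1..t} \<Longrightarrow>
      increasing_labelling (\<Delta> s) (component m s c) (m s + 1) (u s)"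
begin

sublocale block_composition t m "TYPE('n)"
  by unfold_locales (rule card_eq)

lemma component_other_block:
  assumes "(x :: (real, 'n) vec) \<in> block_space m r" "r \<noteq> s"
  shows "component m s x = 0"
  using assms by (auto simp: component_def block_space_def vec_eq_iff mem_block)

lemma sum_components: "(\<Sum>s=1..t. component m s x) = (x :: (real, 'n) vec)"
proof (rule vec_eq_iff[THEN iffD2, rule_format])
  fix i :: 'n
  have "(\<Sum>s=1..t. component m s x) $ i = (\<Sum>s=1..t. if blk i = s then x $ i else 0)"
    unfolding sum_component component_def by (simp add: mem_block)
  also have "\<dots> = x $ i" using blk_range[of i] by simp
  finally show "(\<Sum>s=1..t. component m s x) $ i = x $ i" .
qed

lemma eq_iff_components: "(x :: (real, 'n) vec) = y \<longleftrightarrow> (\<forall>s\<in>{1..t}. component m s x = component m s y)"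
proof
  assume *: "\<forall>s\<in>{1..t}. component m s x = component m s y"
  have "(\<Sum>s=1..t. component m s x) = (\<Sum>s=1..t. component m s y)"
    using * by (intro sum.cong) auto
  then show "x = y" by (simp only: sum_components)
qed simp

section \<open>A single simplex factor\<close>

lemma vertices_eq: "s \<in> {1..t} \<Longrightarrow> vertices (\<Delta> s) = u s ` {1..m s + 1}"
  and inj_on_u: "s \<in> {1..t} \<Longrightarrow> inj_on (u s) {1..m s + 1}"
  using labels[of s] by (auto simp: increasing_labelling_def bij_betw_def)

lemma simplex_hull:
  assumes "s \<in> {1..t}"
  shows "\<not> affine_dependent (u s ` {1..m s + 1})" "\<Delta> s = convex hull (u s ` {1..m s + 1})"
proof -
  obtain C where C: "\<not> affine_dependent C" "\<Delta> s = convex hull C"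
    using simplex[OF assms] unfolding simplex_def by blast
  then have "vertices (\<Delta> s) = C"
    by (simp add: vertices_def extreme_point_of_convex_hull_affine_independent)
  then show "\<not> affine_dependent (u s ` {1..m s + 1})" "\<Delta> s = convex hull (u s ` {1..m s + 1})"
    using C vertices_eq[OF assms] by auto
qed

lemma convex_simplex: "s \<in> {1..t} \<Longrightarrow> convex (\<Delta> s)"
  using simplex_hull convex_convex_hull by metis

lemma u_in_simplex: "s \<in> {1..t} \<Longrightarrow> i \<in> {1..m s + 1} \<Longrightarrow> u s i \<in> \<Delta> s"
  using simplex_hull(2)[of s] by (simp add: hull_inc)

lemma u_in_block_space: "s \<in> {1..t} \<Longrightarrow> i \<in> {1..m s + 1} \<Longrightarrow> u s i \<in> block_space m s"
  using u_in_simplex subspace by blast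

lemma u_extreme: "s \<in> {1..t} \<Longrightarrow> i \<in> {1..m s + 1} \<Longrightarrow> u s i extreme_point_of \<Delta> s"
  using vertices_eq unfolding vertices_def by blast

lemma u_eq_iff: "s \<in> {1..t} \<Longrightarrow> i \<in> {1..m s + 1} \<Longrightarrow> j \<in> {1..m s + 1} \<Longrightarrow> u s i = u s j \<longleftrightarrow> i = j"
  using inj_on_u inj_on_eq_iff by metis

text \<open>Any set of vertices of a simplex spans a face; hence every later vertex is an improving
  neighbor.\<close>

lemma segment_face_of_simplex:
  assumes "s \<in> {1..t}" "i \<in> {1..m s + 1}" "j \<in> {1..m s + 1}"
  shows "closed_segment (u s i) (u s j) face_of \<Delta> s"
  unfolding simplex_hull(2)[OF assms(1)] face_of_convex_hull_affine_independent[OF simplex_hull(1)[OF assms(1)]]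
    segment_convex_hull
  using assms by (intro exI[of _ "{u s i, u s j}"]) auto

definition height :: "nat \<Rightarrow> nat \<Rightarrow> real" where
  "height s i = c \<bullet> u s i"

definition lift :: "(real, 'n) vec \<Rightarrow> nat \<Rightarrow> nat \<Rightarrow> real" where
  "lift w s i = w \<bullet> u s i"

text \<open>The real value of the maximal slope. At the top label \<open>m s + 1\<close> no chord
  exists and the maximum is over the empty set, so comparisons are confined to labels in
  \<open>{1..m s}\<close>.\<close>

definition steep :: "(real, 'n) vec \<Rightarrow> nat \<Rightarrow> nat \<Rightarrow> real" where
  "steep w s i = steepest (height s) (m s) (lift w s) i"

lemma inner_component_u:
  "s \<in> {1..t} \<Longrightarrow> i \<in> {1..m s + 1} \<Longrightarrow> component m s w \<bullet> u s i = w \<bullet> u s i"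
  using inner_component_block_space u_in_block_space by blast

lemma strict_mono_height:
  assumes "s \<in> {1..t}"
  shows "strict_mono_on {1..m s + 1} (height s)"
proof -
  have "strict_mono_on {1..m s + 1} (\<lambda>i. component m s c \<bullet> u s i)"
    using labels[OF assms] by (simp add: increasing_labelling_def)
  then show ?thesis
    using inner_component_u[OF assms, of _ c] by (simp add: strict_mono_on_def height_def)
qed

lemma heights: "s \<in> {1..t} \<Longrightarrow> increasing_heights (height s) (m s)"
  by unfold_locales (rule strict_mono_height)

lemma height_less_iff:
  "s \<in> {1..t} \<Longrightarrow> i \<in> {1..m s + 1} \<Longrightarrow> j \<in> {1..m s + 1} \<Longrightarrow> height s i < height s j \<longleftrightarrow> i < j"
  using strict_mono_on_less[OF strict_mono_height] by blast

lemma simplex_improving_neighbors: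
  assumes s: "s \<in> {1..t}" and i: "i \<in> {1..m s + 1}"
  shows "improving_neighbors (\<Delta> s) (component m s c) (u s i) = u s ` {i<..m s + 1}"
proof -
  have "u s j \<in> improving_neighbors (\<Delta> s) (component m s c) (u s i) \<longleftrightarrow> i < j"
    if j: "j \<in> {1..m s + 1}" for j
    using vertices_eq[OF s] j i u_eq_iff[OF s i j] segment_face_of_simplex[OF s i j]
      height_less_iff[OF s i j]
    by (auto simp: improving_neighbors_def closed_segment_edge_of_iff inner_component_u[OF s] height_def)
  moreover have "improving_neighbors (\<Delta> s) (component m s c) (u s i) \<subseteq> u s ` {1..m s + 1}"
    using vertices_eq[OF s] by (auto simp: improving_neighbors_def)
  ultimately show ?thesis using i by auto
qed

lemma simplex_is_max_vertex:
  assumes s: "s \<in> {1..t}" and i: "i \<in> {1..m s + 1}"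
  shows "is_max_vertex (\<Delta> s) (component m s c) (u s i) \<longleftrightarrow> i = m s + 1"
proof -
  have "is_max_vertex (\<Delta> s) (component m s c) (u s i) \<longleftrightarrow> (\<forall>j\<in>{1..m s + 1}. height s j \<le> height s i)"
    using i vertices_eq[OF s] by (auto simp: is_max_vertex_def inner_component_u[OF s] height_def)
  also have "\<dots> \<longleftrightarrow> (\<forall>j\<in>{1..m s + 1}. j \<le> i)"
    using height_less_iff[OF s i] by (auto simp: not_less[symmetric])
  also have "\<dots> \<longleftrightarrow> i = m s + 1" using i by force
  finally show ?thesis .
qed

lemma simplex_max_slope:
  assumes s: "s \<in> {1..t}" and i: "i \<in> {1..m s}"
  shows "max_slope (\<Delta> s) (component m s c) (component m s w) (u s i) = ereal (steep w s i)"
proof -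
  have i': "i \<in> {1..m s + 1}" using i by auto
  have "slope (component m s c) (component m s w) (u s i) ` u s ` {i<..m s + 1}
      = chord (height s) (lift w s) i ` {i<..m s + 1}"
    unfolding image_image
    using i by (intro image_cong) (auto simp: slope_eq_chord chord_def inner_component_u[OF s] height_def lift_def)
  then show ?thesis
    using simplex_is_max_vertex[OF s i'] simplex_improving_neighbors[OF s i'] i
    by (auto simp: max_slope_def steep_def steepest_def)
qed

lemma product_slope_map_nth: "product_slope_map m \<Delta> c u w $ i = steep w (blk i) (lab i)"
proof -
  have "(THE s. i \<in> block m s) = blk i" by (simp add: mem_block)
  then show ?thesis
    using simplex_max_slope[OF blk_range lab_range, of i w]
    by (simp add: product_slope_map_def Let_def slope_map_def lab_def)
qed

section \<open>Vertices and edges of the product polytope\<close>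

definition valid_labels :: "(nat \<Rightarrow> nat) \<Rightarrow> bool" where
  "valid_labels p \<longleftrightarrow> (\<forall>s\<in>{1..t}. p s \<in> {1..m s + 1})"

definition vert :: "(nat \<Rightarrow> nat) \<Rightarrow> (real, 'n) vec" where
  "vert p = (\<Sum>s=1..t. u s (p s))"

abbreviation P :: "(real, 'n) vec set" where
  "P \<equiv> product_polytope t m \<Delta>"

lemma valid_labelsD: "valid_labels p \<Longrightarrow> s \<in> {1..t} \<Longrightarrow> p s \<in> {1..m s + 1}"
  by (simp add: valid_labels_def)

lemma valid_labels_upd: "valid_labels p \<Longrightarrow> q \<in> {p s<..m s + 1} \<Longrightarrow> valid_labels (p(s := q))"
  by (auto simp: valid_labels_def)

lemma component_vert:
  assumes "valid_labels p" "s \<in> {1..t}"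
  shows "component m s (vert p) = u s (p s)"
proof -
  have "component m s (vert p) = (\<Sum>r=1..t. component m s (u r (p r)))"
    unfolding vert_def by (rule linear_sum[OF component_linear])
  also have "\<dots> = (\<Sum>r=1..t. if s = r then u s (p s) else 0)"
  proof (intro sum.cong refl)
    fix r assume "r \<in> {1..t}"
    then have r: "u r (p r) \<in> block_space m r" using u_in_block_space valid_labelsD[OF assms(1)] by blast
    show "component m s (u r (p r)) = (if s = r then u s (p s) else 0)"
      using component_other_block[OF r, of s] component_block_space[OF r] by auto
  qed
  also have "\<dots> = u s (p s)" using assms(2) by simp
  finally show ?thesis .
qed

lemma vert_eqI:
  assumes "valid_labels p" "\<And>s. s \<in> {1..t} \<Longrightarrow> component m s x = u s (p s)"
  shows "x = vert p"
  using assms component_vert by (subst eq_iff_components) simp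

lemma vert_eq_iff:
  assumes "valid_labels p" "valid_labels q"
  shows "vert p = vert q \<longleftrightarrow> (\<forall>s\<in>{1..t}. p s = q s)"
  using assms component_vert u_eq_iff valid_labelsD by (subst eq_iff_components) simp

lemma vert_upd:
  assumes "s \<in> {1..t}"
  shows "vert (p(s := q)) = vert p + (u s q - u s (p s))"
proof -
  have "vert (p(s := q)) = (\<Sum>r\<in>{1..t}. u r (p r) + (if s = r then u s q - u s (p s) else 0))"
    unfolding vert_def by (intro sum.cong) auto
  also have "\<dots> = vert p + (u s q - u s (p s))"
    unfolding sum.distrib vert_def using assms by simp
  finally show ?thesis .
qed

text \<open>Moves one factor of a point and freezes the others; this transfers extremality from the
  product to a factor.\<close>

definition replace :: "nat \<Rightarrow> (real, 'n) vec \<Rightarrow> (real, 'n) vec \<Rightarrow> (real, 'n) vec" where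
  "replace s x a = x - component m s x + a"

lemma component_replace:
  assumes "s \<in> {1..t}" "a \<in> \<Delta> s"
  shows "component m r (replace s x a) = (if r = s then a else component m r x)"
proof -
  have a: "a \<in> block_space m s" using assms subspace by blast
  have x: "component m s x \<in> block_space m s" by (auto simp: component_def block_space_def)
  show ?thesis
  proof (cases "r = s")
    case True
    then show ?thesis using component_block_space[OF a]
      by (simp add: replace_def component_add component_diff component_component)
  next
    case False
    then show ?thesis using component_other_block[OF a, of r] component_other_block[OF x, of r]
      by (simp add: replace_def component_add component_diff)
  qed
qed

lemma replace_in_P:
  assumes "x \<in> P" "s \<in> {1..t}" "a \<in> \<Delta> s"
  shows "replace s x a \<in> P"
  using assms component_replace[OF assms(2,3)] by (auto simp: product_polytope_def)

text \<open>A segment in one factor lifts to the product by freezing the other components.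
  Conversely, a segment of the product through \<open>x\<close> must be constant in every component,
  hence degenerate.\<close>

lemma extreme_point_of_P_iff:
  "x extreme_point_of P \<longleftrightarrow> (\<forall>s\<in>{1..t}. component m s x extreme_point_of \<Delta> s)" (is "?L \<longleftrightarrow> ?R")
proof
  assume L: ?L
  then have x: "x \<in> P" by (simp add: extreme_point_of_def)
  show ?R
  proof (intro ballI)
    fix s assume s: "s \<in> {1..t}"
    show "component m s x extreme_point_of \<Delta> s"
      unfolding extreme_point_of_def
    proof (intro conjI ballI notI)
      show "component m s x \<in> \<Delta> s" using x s by (simp add: product_polytope_def)
      fix a b assume ab: "a \<in> \<Delta> s" "b \<in> \<Delta> s" "component m s x \<in> open_segment a b"
      obtain r where r: "a \<noteq> b" "0 < r" "r < 1" "component m s x = (1 - r) *\<^sub>R a + r *\<^sub>R b"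
        using ab(3) unfolding in_segment by blast
      have "x = (1 - r) *\<^sub>R replace s x a + r *\<^sub>R replace s x b"
        using r(4) by (simp add: replace_def algebra_simps)
      moreover have "replace s x a \<noteq> replace s x b" using r(1) by (simp add: replace_def)
      ultimately have "x \<in> open_segment (replace s x a) (replace s x b)"
        unfolding in_segment using r by blast
      then show False
        using L replace_in_P[OF x s ab(1)] replace_in_P[OF x s ab(2)] by (auto simp: extreme_point_of_def)
    qed
  qed
next
  assume R: ?R
  show ?L
    unfolding extreme_point_of_def
  proof (intro conjI ballI notI)
    show "x \<in> P" using R by (simp add: product_polytope_def extreme_point_of_def)
    fix a b assume ab: "a \<in> P" "b \<in> P" "x \<in> open_segment a b"
    then obtain r where r: "a \<noteq> b" "0 < r" "r < 1" "x = (1 - r) *\<^sub>R a + r *\<^sub>R b"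
      unfolding in_segment by blast
    have "component m s a = component m s b" if s: "s \<in> {1..t}" for s
    proof (rule ccontr)
      assume ne: "component m s a \<noteq> component m s b"
      have "component m s x = (1 - r) *\<^sub>R component m s a + r *\<^sub>R component m s b"
        unfolding r(4) by (simp add: component_add component_scaleR)
      then have "component m s x \<in> open_segment (component m s a) (component m s b)"
        unfolding in_segment using r ne by blast
      then show False
        using R s ab by (auto simp: extreme_point_of_def product_polytope_def)
    qed
    then show False using r(1) eq_iff_components by blast
  qed
qed

lemma vertices_P: "vertices P = vert ` {p. valid_labels p}"
proof (intro equalityI subsetI)
  fix x assume "x \<in> vertices P"
  then have "\<forall>s\<in>{1..t}. \<exists>i\<in>{1..m s + 1}. component m s x = u s i"
    using vertices_eq unfolding vertices_def extreme_point_of_P_iff by blast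
  then obtain p where p: "\<forall>s\<in>{1..t}. p s \<in> {1..m s + 1} \<and> component m s x = u s (p s)"
    by metis
  then have "valid_labels p" by (simp add: valid_labels_def)
  moreover have "x = vert p" using calculation p by (intro vert_eqI) auto
  ultimately show "x \<in> vert ` {p. valid_labels p}" by blast
next
  fix x assume "x \<in> vert ` {p. valid_labels p}"
  then obtain p where "valid_labels p" "x = vert p" by blast
  then show "x \<in> vertices P"
    unfolding vertices_def extreme_point_of_P_iff
    using component_vert u_extreme valid_labelsD by simp
qed

text \<open>An edge of factor \<open>s\<close> times vertices of the others: extremality pins the
  other components of \<open>a\<close> and \<open>b\<close>, and the face property of the edge
  handles component \<open>s\<close>.\<close>

lemma segment_face_of_P:
  assumes p: "valid_labels p" and s: "s \<in> {1..t}" and q: "q \<in> {1..m s + 1}"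
  shows "closed_segment (vert p) (vert (p(s := q))) face_of P"
  unfolding face_of_def
proof (intro conjI ballI impI)
  let ?q = "p(s := q)"
  have vq: "valid_labels ?q" using p q by (simp add: valid_labels_def)
  have vP: "vert p \<in> P" "vert ?q \<in> P"
    using component_vert[OF p] component_vert[OF vq] u_in_simplex valid_labelsD[OF p] valid_labelsD[OF vq]
    by (auto simp: product_polytope_def)
  have convP: "convex P"
    unfolding convex_alt product_polytope_def
    using convex_simplex by (auto simp: convex_alt component_add component_scaleR)
  then show "closed_segment (vert p) (vert ?q) \<subseteq> P" using vP closed_segment_subset by blast
  show "convex (closed_segment (vert p) (vert ?q))" by (rule convex_closed_segment)
  have comp: "component m r x = (if r = s then component m s x else u r (p r))"
    if "x \<in> closed_segment (vert p) (vert ?q)" "r \<in> {1..t}" for x r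
    using that component_vert[OF p that(2)] component_vert[OF vq that(2)]
    by (auto simp: in_segment component_add component_scaleR simp flip: scaleR_left_distrib)
  have seg: "component m s x \<in> closed_segment (u s (p s)) (u s q)"
    if "x \<in> closed_segment (vert p) (vert ?q)" for x
    using that component_vert[OF p s] component_vert[OF vq s]
    by (auto simp: in_segment component_add component_scaleR)
  have conv: "x \<in> closed_segment (vert p) (vert ?q)"
    if cs: "component m s x \<in> closed_segment (u s (p s)) (u s q)"
      and cr: "\<And>r. r \<in> {1..t} \<Longrightarrow> r \<noteq> s \<Longrightarrow> component m r x = u r (p r)" for x
  proof -
    obtain e where e: "0 \<le> e" "e \<le> 1" "component m s x = (1 - e) *\<^sub>R u s (p s) + e *\<^sub>R u s q"
      using cs unfolding in_segment by blast
    have "component m r x = component m r ((1 - e) *\<^sub>R vert p + e *\<^sub>R vert ?q)" if r: "r \<in> {1..t}" for r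
    proof (cases "r = s")
      case True
      show ?thesis
        unfolding component_add component_scaleR component_vert[OF p r] component_vert[OF vq r]
        using e(3) True by simp
    next
      case False
      then have "component m r x = u r (p r)" using cr r by blast
      then show ?thesis
        unfolding component_add component_scaleR component_vert[OF p r] component_vert[OF vq r]
        using False by (simp flip: scaleR_left_distrib)
    qed
    then have "x = (1 - e) *\<^sub>R vert p + e *\<^sub>R vert ?q" using eq_iff_components by blast
    then show ?thesis unfolding in_segment using e by blast
  qed
  fix a b x
  assume a: "a \<in> P" and b: "b \<in> P" and x: "x \<in> closed_segment (vert p) (vert ?q)"
    and ab: "x \<in> open_segment a b"
  obtain e where e: "a \<noteq> b" "0 < e" "e < 1" "x = (1 - e) *\<^sub>R a + e *\<^sub>R b"
    using ab unfolding in_segment by blast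
  have ce: "component m r x = (1 - e) *\<^sub>R component m r a + e *\<^sub>R component m r b" for r
    unfolding e(4) by (simp add: component_add component_scaleR)
  have open_seg: "component m r x \<in> open_segment (component m r a) (component m r b)"
    if "component m r a \<noteq> component m r b" for r
    unfolding in_segment using ce e that by blast
  have eq: "component m r x = component m r a" if "component m r a = component m r b" for r
    using ce[of r] that by (simp flip: scaleR_left_distrib)
  have abr: "component m r a \<in> \<Delta> r" "component m r b \<in> \<Delta> r" if "r \<in> {1..t}" for r
    using a b that by (auto simp: product_polytope_def)
  have other: "component m r a = u r (p r) \<and> component m r b = u r (p r)"
    if r: "r \<in> {1..t}" "r \<noteq> s" for r
  proof -
    have xr: "component m r x = u r (p r)" using comp[OF x r(1)] r(2) by simp
    have "component m r a = component m r b"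
      using open_seg[of r] xr u_extreme[OF r(1) valid_labelsD[OF p r(1)]] abr[OF r(1)]
      by (auto simp: extreme_point_of_def)
    then show ?thesis using eq[of r] xr by auto
  qed
  have "component m s a \<in> closed_segment (u s (p s)) (u s q) \<and>
      component m s b \<in> closed_segment (u s (p s)) (u s q)"
  proof (cases "component m s a = component m s b")
    case True
    then show ?thesis using eq[of s] seg[OF x] by auto
  next
    case False
    show ?thesis
      using face_ofD[OF segment_face_of_simplex[OF s valid_labelsD[OF p s] q] open_seg[OF False] abr[OF s] seg[OF x]] .
  qed
  then show "a \<in> closed_segment (vert p) (vert ?q)" "b \<in> closed_segment (vert p) (vert ?q)"
    using conv other by auto
qed

text \<open>Exchanging the \<open>s\<close>-labels of the ends gives vertices \<open>z\<close> and
  \<open>z'\<close> with the same midpoint, so the segment, being a face, contains \<open>z\<close>.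
  Component \<open>s\<close> puts \<open>z\<close> at the far end, component \<open>r\<close> at the
  near end.\<close>

lemma edge_differs_once:
  assumes p: "valid_labels p" and q: "valid_labels q"
    and edge: "closed_segment (vert p) (vert q) face_of P"
    and s: "s \<in> {1..t}" "p s \<noteq> q s" and r: "r \<in> {1..t}" "p r \<noteq> q r"
  shows "r = s"
proof (rule ccontr)
  assume "r \<noteq> s"
  define z where "z = vert (p(s := q s))"
  define z' where "z' = vert (q(s := p s))"
  have v: "valid_labels (p(s := q s))" "valid_labels (q(s := p s))"
    using p q by (auto simp: valid_labels_def)
  have vP: "vert l \<in> P" if "valid_labels l" for l
    using component_vert[OF that] u_in_simplex valid_labelsD[OF that] by (auto simp: product_polytope_def)
  have "z \<noteq> z'"
    unfolding z_def z'_def vert_eq_iff[OF v] using s by auto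
  moreover have mid: "(1 - 1/2) *\<^sub>R vert p + (1/2) *\<^sub>R vert q = (1 - 1/2) *\<^sub>R z + (1/2) *\<^sub>R z'"
    unfolding z_def z'_def vert_upd[OF s(1)] by (simp add: algebra_simps)
  ultimately have "(1 - 1/2) *\<^sub>R vert p + (1/2) *\<^sub>R vert q \<in> open_segment z z'"
    unfolding in_segment by (intro conjI exI[of _ "1/2"]) simp_all
  moreover have "(1 - 1/2) *\<^sub>R vert p + (1/2) *\<^sub>R vert q \<in> closed_segment (vert p) (vert q)"
    unfolding in_segment by (intro exI[of _ "1/2"]) simp
  ultimately have "z \<in> closed_segment (vert p) (vert q)"
    using face_ofD[OF edge] vP v unfolding z_def z'_def by blast
  then obtain e where e: "z = (1 - e) *\<^sub>R vert p + e *\<^sub>R vert q"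
    unfolding in_segment by blast
  have "u s (q s) = (1 - e) *\<^sub>R u s (p s) + e *\<^sub>R u s (q s)"
    using arg_cong[OF e, of "component m s"] component_vert[OF p s(1)] component_vert[OF q s(1)]
      component_vert[OF v(1) s(1)] by (simp add: z_def component_add component_scaleR)
  moreover have "(1 - e) *\<^sub>R (u s (p s) - u s (q s))
      = ((1 - e) *\<^sub>R u s (p s) + e *\<^sub>R u s (q s)) - u s (q s)"
    by (simp add: algebra_simps)
  ultimately have "(1 - e) *\<^sub>R (u s (p s) - u s (q s)) = 0" by simp
  then have "e = 1" using u_eq_iff[OF s(1) valid_labelsD[OF p s(1)] valid_labelsD[OF q s(1)]] s(2) by simp
  have "u r (p r) = (1 - e) *\<^sub>R u r (p r) + e *\<^sub>R u r (q r)"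
    using arg_cong[OF e, of "component m r"] component_vert[OF p r(1)] component_vert[OF q r(1)]
      component_vert[OF v(1) r(1)] \<open>r \<noteq> s\<close> by (simp add: z_def component_add component_scaleR)
  then show False
    using \<open>e = 1\<close> u_eq_iff[OF r(1) valid_labelsD[OF p r(1)] valid_labelsD[OF q r(1)]] r(2) by simp
qed

lemma P_improving_neighbors:
  assumes p: "valid_labels p"
  shows "improving_neighbors P c (vert p) = {vert (p(s := q)) | s q. s \<in> {1..t} \<and> q \<in> {p s<..m s + 1}}"
proof (intro equalityI subsetI)
  fix x assume "x \<in> improving_neighbors P c (vert p)"
  then have x: "x \<in> vertices P" "vert p \<noteq> x" "closed_segment (vert p) x face_of P" "c \<bullet> vert p < c \<bullet> x"
    by (auto simp: improving_neighbors_def closed_segment_edge_of_iff)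
  then obtain q where q: "valid_labels q" "x = vert q" using vertices_P by auto
  then obtain s where s: "s \<in> {1..t}" "p s \<noteq> q s" using x(2) vert_eq_iff[OF p q(1)] by blast
  have face: "closed_segment (vert p) (vert q) face_of P" using x(3) q(2) by simp
  have "q r = (p(s := q s)) r" if "r \<in> {1..t}" for r
  proof (cases "r = s")
    case False
    then have "p r = q r" using edge_differs_once[OF p q(1) face s that] by blast
    then show ?thesis using False by simp
  qed simp
  moreover have v: "valid_labels (p(s := q s))" using p q by (auto simp: valid_labels_def)
  ultimately have xq: "x = vert (p(s := q s))" using vert_eq_iff[OF q(1) v] q(2) by blast
  then have "height s (p s) < height s (q s)"
    using x(4) vert_upd[OF s(1), of p "q s"] by (simp add: height_def inner_add_right inner_diff_right)
  then have "q s \<in> {p s<..m s + 1}"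
    using height_less_iff[OF s(1)] valid_labelsD[OF p s(1)] valid_labelsD[OF q(1) s(1)] by auto
  then show "x \<in> {vert (p(s := q)) | s q. s \<in> {1..t} \<and> q \<in> {p s<..m s + 1}}" using xq s by blast
next
  fix x assume "x \<in> {vert (p(s := q)) | s q. s \<in> {1..t} \<and> q \<in> {p s<..m s + 1}}"
  then obtain s q where s: "s \<in> {1..t}" and q: "q \<in> {p s<..m s + 1}" and x: "x = vert (p(s := q))"
    by blast
  have q1: "q \<in> {1..m s + 1}" using q by auto
  have v: "valid_labels (p(s := q))" using p q by (rule valid_labels_upd)
  have "height s (p s) < height s q"
    using height_less_iff[OF s valid_labelsD[OF p s] q1] q by auto
  then have "c \<bullet> vert p < c \<bullet> x"
    unfolding x vert_upd[OF s] by (simp add: height_def inner_add_right inner_diff_right)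
  moreover have "x \<in> vertices P" using vertices_P v x by blast
  ultimately show "x \<in> improving_neighbors P c (vert p)"
    using segment_face_of_P[OF p s q1] x
    by (auto simp: improving_neighbors_def closed_segment_edge_of_iff)
qed

lemma P_is_max_vertex:
  assumes p: "valid_labels p"
  shows "is_max_vertex P c (vert p) \<longleftrightarrow> (\<forall>s\<in>{1..t}. p s = m s + 1)" (is "?L \<longleftrightarrow> ?R")
proof
  assume L: ?L
  show ?R
  proof (rule ccontr)
    assume "\<not> ?R"
    then obtain s where s: "s \<in> {1..t}" "p s \<noteq> m s + 1" by blast
    then have "m s + 1 \<in> {p s<..m s + 1}" using valid_labelsD[OF p s(1)] by auto
    then have "vert (p(s := m s + 1)) \<in> improving_neighbors P c (vert p)"
      unfolding P_improving_neighbors[OF p] using s(1) by blast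
    then show False using L by (auto simp: improving_neighbors_def is_max_vertex_def)
  qed
next
  assume R: ?R
  have "c \<bullet> x \<le> c \<bullet> vert p" if x: "x \<in> vertices P" for x
  proof -
    obtain q where q: "valid_labels q" "x = vert q" using x vertices_P by auto
    have "height s (q s) \<le> height s (p s)" if s: "s \<in> {1..t}" for s
      using height_less_iff[OF s valid_labelsD[OF p s] valid_labelsD[OF q(1) s]] R s valid_labelsD[OF q(1) s]
      by (auto simp: not_less[symmetric])
    then show ?thesis
      unfolding q(2) vert_def inner_sum_right height_def by (rule sum_mono)
  qed
  then show ?L using p vertices_P by (auto simp: is_max_vertex_def)
qed

lemma P_slope:
  assumes "s \<in> {1..t}"
  shows "slope c w (vert p) (vert (p(s := q))) = chord (height s) (lift w s) (p s) q"
  unfolding slope_def chord_def vert_upd[OF assms] height_def lift_def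
  by (simp add: inner_diff_right inner_add_right)

end

section \<open>Best improving neighbours\<close>

lemma continuous_on_Max_image:
  fixes f :: "'a::topological_space \<Rightarrow> 'b \<Rightarrow> real"
  assumes "finite J" "J \<noteq> {}" "\<And>j. j \<in> J \<Longrightarrow> continuous_on A (\<lambda>x. f x j)"
  shows "continuous_on A (\<lambda>x. Max (f x ` J))"
  using assms
proof (induction J rule: finite_ne_induct)
  case (insert j J)
  then have "continuous_on A (\<lambda>x. max (f x j) (Max (f x ` J)))"
    by (intro continuous_on_max) auto
  then show ?case using insert by simp
qed simp

lemma next_smaller_cong:
  assumes "\<And>k. k \<in> {i..n} \<Longrightarrow> x k = y k" "i \<le> n"
  shows "next_smaller n x i = next_smaller n y i"
  using assms by (intro ext) (auto simp: next_smaller_def)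

lemma steepest_shift:
  assumes "\<And>j. j \<in> {i..n + 1} \<Longrightarrow> z j = y j + a" "i \<le> n"
  shows "steepest h n z i = steepest h n y i"
  unfolding steepest_def
  by (intro arg_cong[of _ _ Max] image_cong) (use assms in \<open>auto simp: chord_def\<close>)

context simplex_product
begin

definition steep_targets :: "(real, 'n) vec \<Rightarrow> nat \<Rightarrow> nat \<Rightarrow> nat set" where
  "steep_targets w s i = {q \<in> {i<..m s + 1}. chord (height s) (lift w s) i q = steep w s i}"

text \<open>A relation in place of the \<open>THE\<close> in \<open>arborescence\<close>, usable
  before uniqueness is known.\<close>

definition best_neighbor :: "(real, 'n) vec \<Rightarrow> (real, 'n) vec \<Rightarrow> (real, 'n) vec \<Rightarrow> bool" where
  "best_neighbor w x v \<longleftrightarrow> v \<in> improving_neighbors P c x \<and> ereal (slope c w x v) = max_slope P c w x"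

text \<open>A test vertex: with the other factors at their top, all improving moves stay in factor
  \<open>s\<close>. Lowering one more label leaves exactly two competing factors.\<close>

definition top_except :: "nat \<Rightarrow> nat \<Rightarrow> nat \<Rightarrow> nat" where
  "top_except s i = (\<lambda>r. m r + 1)(s := i)"

lemma chord_le_steep:
  "s \<in> {1..t} \<Longrightarrow> 1 \<le> i \<Longrightarrow> q \<in> {i<..m s + 1} \<Longrightarrow> chord (height s) (lift w s) i q \<le> steep w s i"
  unfolding steep_def using increasing_heights.chord_le_steepest[OF heights] by simp

lemma steep_targets_nonempty: "s \<in> {1..t} \<Longrightarrow> i \<in> {1..m s} \<Longrightarrow> steep_targets w s i \<noteq> {}"
  unfolding steep_def steep_targets_def
  using increasing_heights.ex_chord_steepest[OF heights, of s i "lift w s"] by fastforce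

lemma steep_targets_eq_singleton_iff:
  "s \<in> {1..t} \<Longrightarrow> i \<in> {1..m s} \<Longrightarrow> steep_targets w s i = {j} \<longleftrightarrow> next_smaller (m s) (steep w s) i j"
  using increasing_heights.unique_steepest_iff_next_smaller[OF heights, of s i "lift w s" j]
  by (simp add: steep_targets_def steep_def[abs_def])

text \<open>An improving neighbor changes one label, and its slope is a chord of that factor. The
  overall maximum is thus the largest steepest slope among the factors below their top.\<close>

lemma best_neighbor_iff:
  assumes p: "valid_labels p" and s: "s \<in> {1..t}" and q: "q \<in> {p s<..m s + 1}"
  shows "best_neighbor w (vert p) (vert (p(s := q))) \<longleftrightarrow>
    q \<in> steep_targets w s (p s) \<and> (\<forall>r\<in>{1..t}. p r \<le> m r \<longrightarrow> steep w r (p r) \<le> steep w s (p s))"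
proof -
  let ?N = "improving_neighbors P c (vert p)" and ?v = "vert (p(s := q))"
  have N: "?N = (\<lambda>(r, q'). vert (p(r := q'))) ` (SIGMA r:{1..t}. {p r<..m r + 1})"
    unfolding P_improving_neighbors[OF p] by force
  have v: "?v \<in> ?N" unfolding P_improving_neighbors[OF p] using s q by blast
  have fin: "finite ?N" unfolding N by auto
  have "\<not> is_max_vertex P c (vert p)" unfolding P_is_max_vertex[OF p] using s q by force
  then have "best_neighbor w (vert p) ?v \<longleftrightarrow>
      slope c w (vert p) ?v = Max (slope c w (vert p) ` ?N)"
    using v by (simp add: best_neighbor_def max_slope_def)
  also have "\<dots> \<longleftrightarrow> (\<forall>x\<in>?N. slope c w (vert p) x \<le> slope c w (vert p) ?v)"
    using fin v by (subst eq_commute, subst Max_eq_iff) auto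
  also have "\<dots> \<longleftrightarrow> (\<forall>r\<in>{1..t}. \<forall>q'\<in>{p r<..m r + 1}.
      chord (height r) (lift w r) (p r) q' \<le> chord (height s) (lift w s) (p s) q)"
    unfolding N using P_slope s by simp
  also have "\<dots> \<longleftrightarrow> q \<in> steep_targets w s (p s) \<and>
      (\<forall>r\<in>{1..t}. p r \<le> m r \<longrightarrow> steep w r (p r) \<le> steep w s (p s))" (is "?L \<longleftrightarrow> ?R")
  proof
    assume L: ?L
    have le: "steep w r (p r) \<le> chord (height s) (lift w s) (p s) q" if r: "r \<in> {1..t}" "p r \<le> m r" for r
    proof -
      obtain q' where "q' \<in> steep_targets w r (p r)"
        using steep_targets_nonempty[OF r(1), of "p r" w] r(2) valid_labelsD[OF p r(1)] by auto
      then show ?thesis using bspec[OF bspec[OF L r(1)], of q'] by (simp add: steep_targets_def)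
    qed
    have "p s \<le> m s" "1 \<le> p s" using q valid_labelsD[OF p s] by auto
    then have "chord (height s) (lift w s) (p s) q = steep w s (p s)"
      using le[OF s] chord_le_steep[OF s _ q, of w] by (intro antisym) auto
    then show ?R using le q by (simp add: steep_targets_def)
  next
    assume R: ?R
    show ?L
    proof (intro ballI)
      fix r q' assume r: "r \<in> {1..t}" "q' \<in> {p r<..m r + 1}"
      then have "chord (height r) (lift w r) (p r) q' \<le> steep w r (p r)"
        using chord_le_steep valid_labelsD[OF p r(1)] by simp
      also have "\<dots> \<le> chord (height s) (lift w s) (p s) q"
        using R r by (simp add: steep_targets_def)
      finally show "chord (height r) (lift w r) (p r) q' \<le> chord (height s) (lift w s) (p s) q" .
    qed
  qed
  finally show ?thesis .
qed

lemma best_neighborE: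
  assumes "valid_labels p" "best_neighbor w (vert p) v"
  obtains s q where "s \<in> {1..t}" "q \<in> {p s<..m s + 1}" "v = vert (p(s := q))"
  using assms unfolding best_neighbor_def P_improving_neighbors[OF assms(1)] by blast

lemma vert_upd_eq_iff:
  assumes p: "valid_labels p" and s: "s \<in> {1..t}" "q \<in> {p s<..m s + 1}"
    and r: "r \<in> {1..t}" "q' \<in> {p r<..m r + 1}"
  shows "vert (p(s := q)) = vert (p(r := q')) \<longleftrightarrow> s = r \<and> q = q'"
proof -
  have "vert (p(s := q)) = vert (p(r := q')) \<longleftrightarrow> (\<forall>k\<in>{1..t}. (p(s := q)) k = (p(r := q')) k)"
    using vert_eq_iff[OF valid_labels_upd[OF p s(2)] valid_labels_upd[OF p r(2)]] .
  also have "\<dots> \<longleftrightarrow> s = r \<and> q = q'"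
  proof
    assume *: "\<forall>k\<in>{1..t}. (p(s := q)) k = (p(r := q')) k"
    have "s = r" using bspec[OF * s(1)] s(2) by (cases "s = r") auto
    then show "s = r \<and> q = q'" using bspec[OF * s(1)] by simp
  qed simp
  finally show ?thesis .
qed

lemma valid_top_except: "i \<in> {1..m s} \<Longrightarrow> valid_labels (top_except s i)"
  by (auto simp: valid_labels_def top_except_def)

lemma valid_top_except2: "i \<in> {1..m s} \<Longrightarrow> j \<in> {1..m r} \<Longrightarrow> valid_labels ((top_except s i)(r := j))"
  by (auto simp: valid_labels_def top_except_def)

lemma best_neighbor_top_except:
  assumes "s \<in> {1..t}" "i \<in> {1..m s}" "q \<in> {i<..m s + 1}"
  shows "best_neighbor w (vert (top_except s i)) (vert ((top_except s i)(s := q))) \<longleftrightarrow> q \<in> steep_targets w s i"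
proof -
  let ?p = "top_except s i"
  have [simp]: "?p s = i" "r \<noteq> s \<Longrightarrow> \<not> ?p r \<le> m r" for r by (simp_all add: top_except_def)
  have "r = s" if "?p r \<le> m r" for r using that by (cases "r = s") (simp_all add: top_except_def)
  then have "\<forall>r\<in>{1..t}. ?p r \<le> m r \<longrightarrow> steep w r (?p r) \<le> steep w s (?p s)" by (metis order_refl)
  then show ?thesis
    using best_neighbor_iff[OF valid_top_except[OF assms(2)] assms(1), of q w] assms(3) by simp
qed

lemma best_neighbor_top_except2:
  assumes s: "s \<in> {1..t}" "i \<in> {1..m s}" and r: "r \<in> {1..t}" "j \<in> {1..m r}" "s \<noteq> r"
    and q: "q \<in> {j<..m r + 1}"
  shows "best_neighbor w (vert ((top_except s i)(r := j))) (vert ((top_except s i)(r := q))) \<longleftrightarrow>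
    q \<in> steep_targets w r j \<and> steep w s i \<le> steep w r j"
proof -
  let ?p = "(top_except s i)(r := j)"
  have pv: "?p s = i" "?p r = j" using r(3) by (simp_all add: top_except_def)
  have "k = s \<or> k = r" if "?p k \<le> m k" for k
    using that by (cases "k = s"; cases "k = r") (simp_all add: top_except_def)
  then have "(\<forall>k\<in>{1..t}. ?p k \<le> m k \<longrightarrow> steep w k (?p k) \<le> steep w r (?p r)) \<longleftrightarrow> steep w s i \<le> steep w r j"
    using pv s r by fastforce
  then show ?thesis
    using best_neighbor_iff[OF valid_top_except2[OF s(2) r(2)] r(1), of q w] q pv by simp
qed

section \<open>Genericity and arborescences in terms of steepest targets\<close>

definition distinguishing :: "(real, 'n) vec \<Rightarrow> bool" where
  "distinguishing w \<longleftrightarrow>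
     (\<forall>s\<in>{1..t}. \<forall>i\<in>{1..m s}. is_singleton (steep_targets w s i)) \<and>
     (\<forall>s\<in>{1..t}. \<forall>i\<in>{1..m s}. \<forall>r\<in>{1..t}. \<forall>j\<in>{1..m r}. s \<noteq> r \<longrightarrow> steep w s i \<noteq> steep w r j)"

text \<open>The factors below their top have different slopes, so one factor wins, and inside it the
  target is unique.\<close>

lemma ex1_best_neighbor:
  assumes w: "distinguishing w" and p: "valid_labels p" and s0: "s0 \<in> {1..t}" "p s0 \<noteq> m s0 + 1"
  shows "\<exists>!v. best_neighbor w (vert p) v"
proof -
  define S where "S = {s \<in> {1..t}. p s \<le> m s}"
  have pS: "p s \<in> {1..m s}" if "s \<in> S" for s
    using that valid_labelsD[OF p] unfolding S_def by auto
  have "s0 \<in> S" using s0 valid_labelsD[OF p s0(1)] by (auto simp: S_def)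
  then have "Max ((\<lambda>s. steep w s (p s)) ` S) \<in> (\<lambda>s. steep w s (p s)) ` S"
    by (intro Max_in) (auto simp: S_def)
  then obtain s where s: "s \<in> S" "Max ((\<lambda>s. steep w s (p s)) ` S) = steep w s (p s)" by auto
  have max: "steep w r (p r) \<le> steep w s (p s)" if "r \<in> S" for r
    unfolding s(2)[symmetric] using that by (intro Max_ge) (auto simp: S_def)
  have st: "s \<in> {1..t}" using s(1) by (simp add: S_def)
  obtain q where q: "steep_targets w s (p s) = {q}"
    using w st pS[OF s(1)] unfolding distinguishing_def is_singleton_def by blast
  then have qr: "q \<in> {p s<..m s + 1}" by (auto simp: steep_targets_def)
  show ?thesis
  proof (rule ex1I[of _ "vert (p(s := q))"])
    show "best_neighbor w (vert p) (vert (p(s := q)))"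
      unfolding best_neighbor_iff[OF p st qr] using q max by (simp add: S_def)
    fix v assume v: "best_neighbor w (vert p) v"
    then obtain r q' where r: "r \<in> {1..t}" "q' \<in> {p r<..m r + 1}" "v = vert (p(r := q'))"
      using best_neighborE[OF p] by blast
    have b: "q' \<in> steep_targets w r (p r)" "\<And>k. k \<in> S \<Longrightarrow> steep w k (p k) \<le> steep w r (p r)"
      using v unfolding r(3) best_neighbor_iff[OF p r(1,2)] by (auto simp: S_def)
    have rS: "r \<in> S" using r by (auto simp: S_def)
    have "steep w r (p r) = steep w s (p s)" using b(2)[OF s(1)] max[OF rS] by simp
    then have "r = s"
      using w r(1) st pS[OF rS] pS[OF s(1)] unfolding distinguishing_def by blast
    then show "v = vert (p(s := q))" using b(1) q r(3) by simp
  qed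
qed

text \<open>Two targets in one factor, or equal slopes in two factors, would each produce two best
  neighbors at a vertex with one or two factors below the top.\<close>

lemma distinguishing_if_ex1_best_neighbor:
  assumes ex1: "\<And>p. valid_labels p \<Longrightarrow> \<exists>s\<in>{1..t}. p s \<noteq> m s + 1 \<Longrightarrow> \<exists>!v. best_neighbor w (vert p) v"
  shows "distinguishing w"
  unfolding distinguishing_def
proof (intro conjI ballI impI)
  fix s i assume s: "s \<in> {1..t}" "i \<in> {1..m s}"
  let ?p = "top_except s i"
  have "?p s \<noteq> m s + 1" using s by (simp add: top_except_def)
  then have u: "\<exists>!v. best_neighbor w (vert ?p) v" using ex1[OF valid_top_except[OF s(2)]] s(1) by blast
  have "q = q'" if "q \<in> steep_targets w s i" "q' \<in> steep_targets w s i" for q q'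
  proof -
    have r: "q \<in> {i<..m s + 1}" "q' \<in> {i<..m s + 1}" using that by (auto simp: steep_targets_def)
    then have "vert (?p(s := q)) = vert (?p(s := q'))"
      using u best_neighbor_top_except[OF s] that by blast
    then show ?thesis
      using vert_upd_eq_iff[OF valid_top_except[OF s(2)] s(1) _ s(1)] r by (simp add: top_except_def)
  qed
  then show "is_singleton (steep_targets w s i)"
    using steep_targets_nonempty[OF s] by (auto intro!: is_singletonI')
next
  fix s i r j assume s: "s \<in> {1..t}" "i \<in> {1..m s}" and r: "r \<in> {1..t}" "j \<in> {1..m r}" "s \<noteq> r"
  show "steep w s i \<noteq> steep w r j"
  proof
    assume eq: "steep w s i = steep w r j"
    let ?p = "(top_except s i)(r := j)"
    have p: "valid_labels ?p" by (rule valid_top_except2[OF s(2) r(2)])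
    have ps: "?p s = i" "?p r = j" using r(3) by (simp_all add: top_except_def)
    obtain q where q: "q \<in> steep_targets w s i" using steep_targets_nonempty[OF s] by auto
    obtain q' where q': "q' \<in> steep_targets w r j" using steep_targets_nonempty[OF r(1,2)] by auto
    have qr: "q \<in> {?p s<..m s + 1}" "q' \<in> {?p r<..m r + 1}"
      using q q' ps by (auto simp: steep_targets_def)
    have swap: "?p = (top_except r j)(s := i)"
      using r(3) by (auto simp: top_except_def)
    have "best_neighbor w (vert ?p) (vert (?p(r := q')))"
      using best_neighbor_top_except2[OF s r, of q' w] q' eq qr ps by simp
    moreover have "best_neighbor w (vert ?p) (vert (?p(s := q)))"
      unfolding swap using best_neighbor_top_except2[OF r(1,2) s r(3)[symmetric], of q w] q eq qr ps by simp
    moreover have "\<exists>!v. best_neighbor w (vert ?p) v"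
      using ex1[OF p] s ps by (metis Suc_eq_plus1 Suc_n_not_le_n atLeastAtMost_iff)
    ultimately have "vert (?p(r := q')) = vert (?p(s := q))" by blast
    then show False using vert_upd_eq_iff[OF p r(1) qr(2) s(1) qr(1)] r(3) by blast
  qed
qed

text \<open>A multiple of \<open>c\<close> has the same slope along every chord. In dimension at
  least 2 this forces a tie, between two targets if two coordinates share a block, otherwise between
  two factors.\<close>

lemma independent_if_distinguishing:
  assumes w: "distinguishing w" and dim: "DIM((real, 'n) vec) \<ge> 2"
  shows "w \<noteq> c \<and> independent {w, c}"
proof (rule ccontr)
  assume neg: "\<not> (w \<noteq> c \<and> independent {w, c})"
  \<comment> \<open>Some block is nonempty, so its factor has two vertices, which \<open>c\<close>
    separates.\<close>
  have "c \<noteq> 0"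
  proof -
    obtain i :: 'n where True by blast
    have "c \<bullet> u (blk i) 1 < c \<bullet> u (blk i) 2"
      using height_less_iff[OF blk_range, of 1 i 2] lab_range[of i] by (auto simp: height_def)
    then show ?thesis by auto
  qed
  then have "\<exists>k. w = k *\<^sub>R c"
  proof (cases "w = c")
    case False
    then have "\<not> (independent {c} \<and> w \<notin> span {c})" using neg by (simp add: independent_insert)
    then have "w \<in> span {c}" using \<open>c \<noteq> 0\<close> by simp
    then show ?thesis by (auto simp: span_singleton)
  qed (auto intro: exI[of _ 1])
  then obtain k where k: "w = k *\<^sub>R c" by blast
  have chord: "chord (height s) (lift w s) i q = k"
    if "s \<in> {1..t}" "i \<in> {1..m s}" "q \<in> {i<..m s + 1}" for s i q
  proof -
    have "height s i < height s q" using that height_less_iff by auto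
    then show ?thesis by (simp add: chord_def lift_def k height_def field_simps)
  qed
  have steep: "steep w s i = k" if "s \<in> {1..t}" "i \<in> {1..m s}" for s i
    using steep_targets_nonempty[OF that, of w] chord[OF that] by (auto simp: steep_targets_def)
  have "\<exists>i j :: 'n. i \<noteq> j"
  proof (rule ccontr)
    assume "\<not> (\<exists>i j :: 'n. i \<noteq> j)"
    then have "(UNIV :: 'n set) = {undefined}" by auto
    then have "CARD('n) = 1" by (metis card_1_singleton_iff One_nat_def)
    then show False using dim by simp
  qed
  then obtain i j :: 'n where ij: "i < j" by (meson linorder_neqE)
  show False
  proof (cases "blk i = blk j")
    case True
    define s where "s = blk i"
    have s: "s \<in> {1..t}" using blk_range s_def by auto
    have "lab i < lab j" using ij le_iff_lab_le[OF True[symmetric]] unfolding not_le[symmetric] by simp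
    \<comment> \<open>Two coordinates in one block give \<open>m s \<ge> 2\<close>, so the first
      vertex has at least two higher ones.\<close>
    then have m: "1 \<in> {1..m s}" "2 \<in> {1<..m s + 1}" "3 \<in> {1<..m s + 1}"
      using lab_range[of i] lab_range[of j] True by (auto simp: s_def)
    then have "2 \<in> steep_targets w s 1" "3 \<in> steep_targets w s 1"
      using chord[OF s m(1)] steep[OF s m(1)] by (auto simp: steep_targets_def)
    moreover have "is_singleton (steep_targets w s 1)" using w s m(1) by (auto simp: distinguishing_def)
    ultimately show False by (auto simp: is_singleton_def)
  next
    case False
    then have "steep w (blk i) (lab i) \<noteq> steep w (blk j) (lab j)"
      using w blk_range lab_range unfolding distinguishing_def by blast
    then show False using steep[OF blk_range lab_range] by simp
  qed
qed

lemma generic_direction_iff: "generic_direction P c w \<longleftrightarrow> distinguishing w"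
proof
  assume g: "generic_direction P c w"
  show "distinguishing w"
  proof (rule distinguishing_if_ex1_best_neighbor)
    fix p assume p: "valid_labels p" "\<exists>s\<in>{1..t}. p s \<noteq> m s + 1"
    then have "vert p \<in> vertices P" "\<not> is_max_vertex P c (vert p)"
      using vertices_P P_is_max_vertex[OF p(1)] by auto
    then show "\<exists>!v. best_neighbor w (vert p) v"
      using g unfolding generic_direction_def best_neighbor_def by blast
  qed
next
  assume w: "distinguishing w"
  have "\<exists>!v. best_neighbor w x v" if x: "x \<in> vertices P" "\<not> is_max_vertex P c x" for x
  proof -
    obtain p where p: "valid_labels p" "x = vert p" using x(1) vertices_P by auto
    then obtain s where "s \<in> {1..t}" "p s \<noteq> m s + 1" using x(2) P_is_max_vertex by auto
    then show ?thesis using ex1_best_neighbor[OF w p(1)] p(2) by blast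
  qed
  then show "generic_direction P c w"
    using independent_if_distinguishing[OF w] unfolding generic_direction_def best_neighbor_def by blast
qed

lemma arborescence_eq_iff_best_neighbor:
  assumes "distinguishing w" "distinguishing z"
  shows "arborescence P c w = arborescence P c z \<longleftrightarrow>
    (\<forall>p. valid_labels p \<longrightarrow> (\<exists>s\<in>{1..t}. p s \<noteq> m s + 1) \<longrightarrow>
      best_neighbor w (vert p) = best_neighbor z (vert p))" (is "?L \<longleftrightarrow> ?R")
proof
  assume L: ?L
  show ?R
  proof (intro allI impI)
    fix p assume p: "valid_labels p" "\<exists>s\<in>{1..t}. p s \<noteq> m s + 1"
    then have nm: "vert p \<in> vertices P" "\<not> is_max_vertex P c (vert p)"
      using vertices_P P_is_max_vertex[OF p(1)] by auto
    have "arborescence P c y (vert p) = (THE v. best_neighbor y (vert p) v)" for y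
      using nm by (simp add: arborescence_def best_neighbor_def)
    then have "(THE v. best_neighbor w (vert p) v) = (THE v. best_neighbor z (vert p) v)"
      using L by metis
    moreover have "\<exists>!v. best_neighbor w (vert p) v" "\<exists>!v. best_neighbor z (vert p) v"
      using ex1_best_neighbor assms p by blast+
    ultimately show "best_neighbor w (vert p) = best_neighbor z (vert p)"
      by (intro ext) (metis the1_equality theI')
  qed
next
  assume R: ?R
  have "best_neighbor w x = best_neighbor z x" if x: "x \<in> vertices P" "\<not> is_max_vertex P c x" for x
  proof -
    obtain p where p: "valid_labels p" "x = vert p" using x(1) vertices_P by auto
    then have "\<exists>s\<in>{1..t}. p s \<noteq> m s + 1" using x(2) P_is_max_vertex by auto
    then show ?thesis using R p by blast
  qed
  then show ?L
    unfolding arborescence_def best_neighbor_def[symmetric] by (intro restrict_ext) simp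
qed

text \<open>Every choice is decided by the targets within factors and the comparisons of slopes
  across factors. Conversely, vertices with one or two factors below the top expose each of these
  data.\<close>

lemma arborescence_eq_iff:
  assumes w: "distinguishing w" and z: "distinguishing z"
  shows "arborescence P c w = arborescence P c z \<longleftrightarrow>
    (\<forall>s\<in>{1..t}. \<forall>i\<in>{1..m s}. steep_targets w s i = steep_targets z s i) \<and>
    (\<forall>s\<in>{1..t}. \<forall>i\<in>{1..m s}. \<forall>r\<in>{1..t}. \<forall>j\<in>{1..m r}. s \<noteq> r \<longrightarrow>
      (steep w s i \<le> steep w r j \<longleftrightarrow> steep z s i \<le> steep z r j))" (is "_ \<longleftrightarrow> ?R")
  unfolding arborescence_eq_iff_best_neighbor[OF w z]
proof
  assume L: "\<forall>p. valid_labels p \<longrightarrow> (\<exists>s\<in>{1..t}. p s \<noteq> m s + 1) \<longrightarrow>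
      best_neighbor w (vert p) = best_neighbor z (vert p)"
  have targets: "steep_targets w s i = steep_targets z s i" if s: "s \<in> {1..t}" "i \<in> {1..m s}" for s i
  proof -
    have "top_except s i s \<noteq> m s + 1" using s by (simp add: top_except_def)
    then have "best_neighbor w (vert (top_except s i)) = best_neighbor z (vert (top_except s i))"
      using L valid_top_except[OF s(2)] s(1) by blast
    then have "q \<in> steep_targets w s i \<longleftrightarrow> q \<in> steep_targets z s i" if "q \<in> {i<..m s + 1}" for q
      using best_neighbor_top_except[OF s that] by metis
    moreover have "steep_targets y s i \<subseteq> {i<..m s + 1}" for y by (auto simp: steep_targets_def)
    ultimately show ?thesis by blast
  qed
  moreover have "steep w s i \<le> steep w r j \<longleftrightarrow> steep z s i \<le> steep z r j"
    if s: "s \<in> {1..t}" "i \<in> {1..m s}" and r: "r \<in> {1..t}" "j \<in> {1..m r}" "s \<noteq> r" for s i r j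
  proof -
    let ?p = "(top_except s i)(r := j)"
    have "?p r \<noteq> m r + 1" using r by simp
    then have eq: "best_neighbor w (vert ?p) = best_neighbor z (vert ?p)"
      using L valid_top_except2[OF s(2) r(2)] r(1) by blast
    \<comment> \<open>At this vertex, moving factor \<open>r\<close> to a target \<open>q\<close> is
      best exactly if the slope of factor \<open>s\<close> does not exceed that of factor
      \<open>r\<close>.\<close>
    obtain q where q: "q \<in> steep_targets w r j" using steep_targets_nonempty[OF r(1,2)] by blast
    then have q': "q \<in> steep_targets z r j" using targets[OF r(1,2)] by simp
    have "q \<in> {j<..m r + 1}" using q by (simp add: steep_targets_def)
    then show ?thesis using best_neighbor_top_except2[OF s r, of q] eq q q' by metis
  qed
  ultimately show ?R by blast
next
  assume R: ?R
  show "\<forall>p. valid_labels p \<longrightarrow> (\<exists>s\<in>{1..t}. p s \<noteq> m s + 1) \<longrightarrow>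
      best_neighbor w (vert p) = best_neighbor z (vert p)"
  proof (intro allI impI ext)
    fix p v assume p: "valid_labels p"
    have key: "best_neighbor w (vert p) (vert (p(s := q))) \<longleftrightarrow> best_neighbor z (vert p) (vert (p(s := q)))"
      if s: "s \<in> {1..t}" "q \<in> {p s<..m s + 1}" for s q
    proof -
      have ps: "p s \<in> {1..m s}" using s valid_labelsD[OF p s(1)] by auto
      have "steep w r (p r) \<le> steep w s (p s) \<longleftrightarrow> steep z r (p r) \<le> steep z s (p s)"
        if r: "r \<in> {1..t}" "p r \<le> m r" for r
      proof (cases "r = s")
        case False
        have "p r \<in> {1..m r}" using r valid_labelsD[OF p r(1)] by auto
        then show ?thesis using R r(1) s(1) ps False by blast
      qed simp
      moreover have "steep_targets w s (p s) = steep_targets z s (p s)" using R s(1) ps by blast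
      ultimately show ?thesis unfolding best_neighbor_iff[OF p s] by simp
    qed
    show "best_neighbor w (vert p) v = best_neighbor z (vert p) v"
      using key best_neighborE[OF p, of w v] best_neighborE[OF p, of z v] by metis
  qed
qed

end

section \<open>The product slope map\<close>

context simplex_product
begin

abbreviation \<Theta> :: "(real, 'n) vec \<Rightarrow> (real, 'n) vec" where
  "\<Theta> \<equiv> product_slope_map m \<Delta> c u"

lemma \<Theta>_idx: "s \<in> {1..t} \<Longrightarrow> i \<in> {1..m s} \<Longrightarrow> \<Theta> w $ idx s i = steep w s i"
  by (simp add: product_slope_map_nth blk_idx lab_idx)

lemma next_smaller_\<Theta>:
  "s \<in> {1..t} \<Longrightarrow> i \<in> {1..m s} \<Longrightarrow> next_smaller (m s) (($) (\<Theta> w) \<circ> idx s) i = next_smaller (m s) (steep w s) i"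
  by (intro next_smaller_cong) (auto simp: \<Theta>_idx)

lemma all_cross_block:
  "(\<forall>i k. blk i \<noteq> blk k \<longrightarrow> R (blk i) (lab i) (blk k) (lab k)) \<longleftrightarrow>
    (\<forall>s\<in>{1..t}. \<forall>i\<in>{1..m s}. \<forall>r\<in>{1..t}. \<forall>j\<in>{1..m r}. s \<noteq> r \<longrightarrow> R s i r j)" (is "?L \<longleftrightarrow> ?R")
proof
  assume L: ?L
  show ?R
  proof (intro ballI impI)
    fix s i r j assume "s \<in> {1..t}" "i \<in> {1..m s}" "r \<in> {1..t}" "j \<in> {1..m r}" "s \<noteq> r"
    then show "R s i r j"
      using L[rule_format, of "idx s i" "idx r j"] by (simp add: blk_idx lab_idx)
  qed
next
  assume ?R
  then show ?L using blk_range lab_range by blast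
qed

lemma strict_on_\<Theta>_iff: "strict_on (block_family blk) (($) (\<Theta> w)) \<longleftrightarrow> distinguishing w"
proof -
  have "(\<exists>j. next_smaller (m s) (($) (\<Theta> w) \<circ> idx s) i j) \<longleftrightarrow> is_singleton (steep_targets w s i)"
    if "s \<in> {1..t}" "i \<in> {1..m s}" for s i
    using next_smaller_\<Theta>[OF that] steep_targets_eq_singleton_iff[OF that] by (simp add: is_singleton_def)
  moreover have "(\<forall>i k. blk i \<noteq> blk k \<longrightarrow> \<Theta> w $ i \<noteq> \<Theta> w $ k) \<longleftrightarrow>
    (\<forall>s\<in>{1..t}. \<forall>i\<in>{1..m s}. \<forall>r\<in>{1..t}. \<forall>j\<in>{1..m r}. s \<noteq> r \<longrightarrow> steep w s i \<noteq> steep w r j)"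
    unfolding product_slope_map_nth by (rule all_cross_block[of "\<lambda>s i r j. steep w s i \<noteq> steep w r j"])
  ultimately show ?thesis
    unfolding strict_on_block_family_iff distinguishing_def by simp
qed

definition fiber :: "(real, 'n) vec \<Rightarrow> (real, 'n) vec set" where
  "fiber w0 = {w. generic_direction P c w \<and> arborescence P c w = arborescence P c w0}"

lemma pivot_fan_fibers: "pivot_fan P c = fan_of_max_cones {closure (fiber w) | w. distinguishing w}"
  by (simp add: pivot_fan_def fiber_def generic_direction_iff)

text \<open>Targets in a factor are the next-smaller pointers of \<open>\<Theta> w\<close>, and
  comparing factors means comparing coordinates of different blocks. Together these are the
  minimizers on the family.\<close>

lemma mem_fiber_iff:
  assumes "distinguishing w0"
  shows "w \<in> fiber w0 \<longleftrightarrow> \<Theta> w \<in> open_cell (block_family blk) (\<Theta> w0)"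
proof (cases "distinguishing w")
  case True
  have "steep_targets w s i = steep_targets w0 s i \<longleftrightarrow>
      next_smaller (m s) (($) (\<Theta> w) \<circ> idx s) i = next_smaller (m s) (($) (\<Theta> w0) \<circ> idx s) i"
    if s: "s \<in> {1..t}" "i \<in> {1..m s}" for s i
  proof -
    obtain j k where jk: "steep_targets w s i = {j}" "steep_targets w0 s i = {k}"
      using True assms s unfolding distinguishing_def is_singleton_def by meson
    then have "next_smaller (m s) (steep w s) i j" "next_smaller (m s) (steep w0 s) i k"
      using steep_targets_eq_singleton_iff[OF s] by blast+
    then have "next_smaller (m s) (steep w s) i = (\<lambda>l. l = j)" "next_smaller (m s) (steep w0 s) i = (\<lambda>l. l = k)"
      using next_smaller_unique by (intro ext; blast)+
    then show ?thesis unfolding next_smaller_\<Theta>[OF s] jk by (metis singleton_inject)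
  qed
  moreover have "(\<forall>i k. blk i \<noteq> blk k \<longrightarrow> (\<Theta> w $ i \<le> \<Theta> w $ k \<longleftrightarrow> \<Theta> w0 $ i \<le> \<Theta> w0 $ k)) \<longleftrightarrow>
    (\<forall>s\<in>{1..t}. \<forall>i\<in>{1..m s}. \<forall>r\<in>{1..t}. \<forall>j\<in>{1..m r}. s \<noteq> r \<longrightarrow>
      (steep w s i \<le> steep w r j \<longleftrightarrow> steep w0 s i \<le> steep w0 r j))"
    unfolding product_slope_map_nth
    by (rule all_cross_block[of "\<lambda>s i r j. steep w s i \<le> steep w r j \<longleftrightarrow> steep w0 s i \<le> steep w0 r j"])
  ultimately have "arborescence P c w = arborescence P c w0 \<longleftrightarrow>
      (\<forall>I\<in>block_family blk. argmins I (($) (\<Theta> w)) = argmins I (($) (\<Theta> w0)))"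
    using True assms
    by (simp add: arborescence_eq_iff argmins_block_family_eq_iff strict_on_\<Theta>_iff)
  then show ?thesis
    using True by (simp add: fiber_def generic_direction_iff open_cell_def)
next
  case False
  \<comment> \<open>The image of a non-generic direction has a tie on some member of the family,
    whereas the cell of \<open>\<Theta> w0\<close> has unique minimizers throughout.\<close>
  have "strict_on (block_family blk) (($) (\<Theta> w0))" using assms strict_on_\<Theta>_iff by blast
  moreover have "\<not> strict_on (block_family blk) (($) (\<Theta> w))" using False strict_on_\<Theta>_iff by blast
  ultimately have "\<Theta> w \<notin> open_cell (block_family blk) (\<Theta> w0)"
    unfolding open_cell_def strict_on_def by fastforce
  then show ?thesis using False by (simp add: fiber_def generic_direction_iff)
qed

text \<open>Heights measured from the top vertex of each factor. A factor with
  \<open>m s + 1\<close> vertices contributes \<open>m s\<close> numbers, so this is a linear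
  endomorphism of the whole space, and slopes depend on nothing else.\<close>

definition relative_lift :: "(real, 'n) vec \<Rightarrow> (real, 'n) vec" where
  "relative_lift w = (\<chi> k. w \<bullet> (u (blk k) (lab k) - u (blk k) (m (blk k) + 1)))"

lemma linear_relative_lift: "linear relative_lift"
  by (intro linearI) (simp_all add: relative_lift_def vec_eq_iff inner_add_left)

lemma relative_lift_idx:
  "s \<in> {1..t} \<Longrightarrow> i \<in> {1..m s} \<Longrightarrow> relative_lift w $ idx s i = lift w s i - lift w s (m s + 1)"
  by (simp add: relative_lift_def blk_idx lab_idx lift_def inner_diff_right)

text \<open>Affine independence gives \<open>m s\<close> independent differences in a space of
  dimension at most \<open>m s\<close>: here full-dimensionality of the simplices enters.\<close>

lemma block_space_subset_span:
  assumes s: "s \<in> {1..t}"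
  shows "block_space m s \<subseteq> span ((\<lambda>i. u s i - u s (m s + 1)) ` {1..m s})" (is "?V \<subseteq> span ?D")
proof (rule card_ge_dim_independent)
  have top: "u s (m s + 1) \<notin> u s ` {1..m s}"
    using u_eq_iff[OF s] by force
  have "{1..m s + 1} = insert (m s + 1) {1..m s}" by auto
  then have "insert (u s (m s + 1)) (u s ` {1..m s}) = u s ` {1..m s + 1}" by simp
  then have "independent ((\<lambda>x. - u s (m s + 1) + x) ` u s ` {1..m s})"
    using affine_dependent_iff_dependent[OF top] simplex_hull(1)[OF s] by simp
  moreover have "(\<lambda>x. - u s (m s + 1) + x) ` u s ` {1..m s} = ?D"
    unfolding image_image by (intro image_cong) auto
  ultimately show "independent ?D" by simp
  show "?D \<subseteq> ?V" using u_in_block_space[OF s] by (auto simp: block_space_def)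
  have "inj_on (\<lambda>i. u s i - u s (m s + 1)) {1..m s}"
    using u_eq_iff[OF s] by (auto simp: inj_on_def)
  then have "card ?D = m s" by (simp add: card_image)
  moreover have "dim ?V \<le> card ((\<lambda>i. axis i 1 :: (real, 'n) vec) ` block m s)"
  proof (rule dim_le_card)
    show "?V \<subseteq> span ((\<lambda>i. axis i 1) ` block m s)"
    proof
      fix x :: "(real, 'n) vec" assume x: "x \<in> ?V"
      have "x = (\<Sum>i\<in>UNIV. x $ i *\<^sub>R axis i 1)"
        using basis_expansion[of x] by (simp add: scalar_mult_eq_scaleR)
      also have "\<dots> = (\<Sum>i\<in>block m s. x $ i *\<^sub>R axis i 1)"
        using x by (intro sum.mono_neutral_right) (auto simp: block_space_def)
      also have "\<dots> \<in> span ((\<lambda>i. axis i 1) ` block m s)"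
        by (intro span_sum span_scale span_base) auto
      finally show "x \<in> span ((\<lambda>i. axis i 1) ` block m s)" .
    qed
  qed simp
  moreover have "card ((\<lambda>i. axis i 1 :: (real, 'n) vec) ` block m s) \<le> m s"
    using card_image_le[of "block m s :: 'n set" "\<lambda>i. axis i 1 :: (real, 'n) vec"] card_block[OF s] by simp
  ultimately show "dim ?V \<le> card ?D" by simp
qed

text \<open>Each component of \<open>w\<close> is orthogonal to vectors spanning its block space,
  hence to itself.\<close>

lemma eq_0_if_relative_lifts_0:
  assumes "\<And>s i. s \<in> {1..t} \<Longrightarrow> i \<in> {1..m s} \<Longrightarrow> lift w s i = lift w s (m s + 1)"
  shows "w = 0"
proof -
  have "component m s w = 0" if s: "s \<in> {1..t}" for s
  proof -
    have V: "component m s w \<in> block_space m s" by (simp add: component_def block_space_def)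
    have "orthogonal (component m s w) (component m s w)"
    proof (rule orthogonal_to_span)
      show "component m s w \<in> span ((\<lambda>i. u s i - u s (m s + 1)) ` {1..m s})"
        using V block_space_subset_span[OF s] by blast
      fix y assume "y \<in> (\<lambda>i. u s i - u s (m s + 1)) ` {1..m s}"
      then obtain i where "i \<in> {1..m s}" "y = u s i - u s (m s + 1)" by blast
      then show "orthogonal (component m s w) y"
        using assms[OF s] inner_component_u[OF s, of _ w]
        by (simp add: orthogonal_def inner_diff_right lift_def)
    qed
    then show ?thesis by (simp add: orthogonal_self)
  qed
  moreover have "component m s (0 :: (real, 'n) vec) = 0" for s by (simp add: component_def vec_eq_iff)
  ultimately show ?thesis using eq_iff_components[of w 0] by simp
qed

lemma inj_relative_lift: "inj relative_lift"
  unfolding linear_injective_0[OF linear_relative_lift]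
proof (intro allI impI)
  fix w assume "relative_lift w = 0"
  then have "lift w s i = lift w s (m s + 1)" if "s \<in> {1..t}" "i \<in> {1..m s}" for s i
    using relative_lift_idx[OF that, of w] by simp
  then show "w = 0" by (rule eq_0_if_relative_lifts_0)
qed

section \<open>Bijectivity, continuity and piecewise linearity of the slope map\<close>

lemma steep_relative:
  assumes "s \<in> {1..t}" "i \<in> {1..m s}"
  shows "steep w s i = steepest (height s) (m s) (\<lambda>j. lift w s j - lift w s (m s + 1)) i"
  unfolding steep_def by (rule steepest_shift[where a = "lift w s (m s + 1)"]) (use assms in auto)

lemma inj_\<Theta>: "inj \<Theta>"
proof (rule injI)
  fix v w assume eq: "\<Theta> v = \<Theta> w"
  have "relative_lift v $ k = relative_lift w $ k" for k
  proof -
    define s where "s = blk k"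
    have s: "s \<in> {1..t}" using blk_range s_def by blast
    interpret increasing_heights "height s" "m s" by (rule heights[OF s])
    have "lift v s (lab k) - lift v s (m s + 1) = lift w s (lab k) - lift w s (m s + 1)"
    proof (rule steepest_inj[of "\<lambda>j. lift v s j - lift v s (m s + 1)" "\<lambda>j. lift w s j - lift w s (m s + 1)"])
      fix i assume i: "i \<in> {1..m s}"
      have "steep v s i = steep w s i" using eq \<Theta>_idx[OF s i, of v] \<Theta>_idx[OF s i, of w] by simp
      then show "steepest (height s) (m s) (\<lambda>j. lift v s j - lift v s (m s + 1)) i =
          steepest (height s) (m s) (\<lambda>j. lift w s j - lift w s (m s + 1)) i"
        by (simp only: steep_relative[OF s i])
    qed (use lab_range[of k] s_def in auto)
    then show ?thesis
      by (simp add: relative_lift_def s_def lift_def inner_diff_right)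
  qed
  then have "relative_lift v = relative_lift w" by (simp add: vec_eq_iff)
  then show "v = w" using inj_relative_lift by (rule injD[rotated])
qed

text \<open>Heights with the prescribed slopes exist in each factor separately; since
  \<open>relative_lift\<close> is onto, one vector realises them all.\<close>

lemma surj_\<Theta>: "surj \<Theta>"
  unfolding surj_def
proof
  fix x :: "(real, 'n) vec"
  have "\<forall>s. \<exists>y. s \<in> {1..t} \<longrightarrow> y (m s + 1) = 0 \<and> (\<forall>i\<in>{1..m s}. steepest (height s) (m s) y i = x $ idx s i)"
    using increasing_heights.steepest_surj[OF heights] by meson
  then obtain y where y: "\<And>s. s \<in> {1..t} \<Longrightarrow> y s (m s + 1) = 0"
    "\<And>s i. s \<in> {1..t} \<Longrightarrow> i \<in> {1..m s} \<Longrightarrow> steepest (height s) (m s) (y s) i = x $ idx s i"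
    by metis
  have "surj relative_lift"
    using linear_injective_imp_surjective[OF linear_relative_lift inj_relative_lift] by simp
  then obtain w where w: "relative_lift w = (\<chi> k. y (blk k) (lab k))" by (metis surjD)
  have "\<Theta> w $ k = x $ k" for k
  proof -
    define s i where "s = blk k" "i = lab k"
    then have s: "s \<in> {1..t}" "i \<in> {1..m s}" using blk_range lab_range by auto
    have rel: "lift w s j - lift w s (m s + 1) = y s j" if "j \<in> {1..m s + 1}" for j
    proof (cases "j = m s + 1")
      case False
      then have j: "j \<in> {1..m s}" using that by auto
      then show ?thesis
        using relative_lift_idx[OF s(1) j, of w] w by (simp add: blk_idx[OF s(1) j] lab_idx[OF s(1) j])
    qed (use y(1)[OF s(1)] in simp)
    have "\<Theta> w $ k = steep w s i" by (simp add: product_slope_map_nth s_i_def)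
    also have "\<dots> = steepest (height s) (m s) (y s) i"
      unfolding steep_relative[OF s]
      by (rule steepest_shift[where a = 0]) (use s rel in auto)
    also have "\<dots> = x $ k" using y(2)[OF s] by (simp add: s_i_def)
    finally show ?thesis .
  qed
  then have "x = \<Theta> w" by (simp add: vec_eq_iff)
  then show "\<exists>w. x = \<Theta> w" ..
qed

lemma continuous_\<Theta>: "continuous_on UNIV \<Theta>"
proof -
  have "continuous_on UNIV (\<lambda>w. \<Theta> w $ i)" for i
    unfolding product_slope_map_nth steep_def steepest_def
    using lab_range[of i]
    by (intro continuous_on_Max_image) (auto simp: chord_def lift_def divide_inverse intro!: continuous_intros)
  then have "continuous_on UNIV (\<lambda>w. \<chi> i. \<Theta> w $ i)" by (rule continuous_on_vec_lambda)
  then show ?thesis by simp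
qed

text \<open>On a fiber every coordinate of \<open>\<Theta>\<close> is the slope of a fixed chord,
  which is linear in \<open>w\<close>. If all these slopes vanish, the lift is constant along the
  targets up to the top vertex, so the kernel is trivial. Continuity extends the equality to the
  closure.\<close>

lemma ex_linear_on_closure_fiber:
  assumes w0: "distinguishing w0"
  shows "\<exists>L. linear L \<and> inj L \<and> (\<forall>w\<in>closure (fiber w0). \<Theta> w = L w)"
proof -
  have "\<forall>s i. \<exists>j. s \<in> {1..t} \<longrightarrow> i \<in> {1..m s} \<longrightarrow> steep_targets w0 s i = {j}"
    using w0 unfolding distinguishing_def is_singleton_def by meson
  then obtain N where N: "\<And>s i. s \<in> {1..t} \<Longrightarrow> i \<in> {1..m s} \<Longrightarrow> steep_targets w0 s i = {N s i}"
    by metis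
  have Nr: "N s i \<in> {i<..m s + 1}" if "s \<in> {1..t}" "i \<in> {1..m s}" for s i
    using N[OF that] by (auto simp: steep_targets_def)
  define L :: "(real, 'n) vec \<Rightarrow> (real, 'n) vec"
    where "L w = (\<chi> k. chord (height (blk k)) (lift w (blk k)) (lab k) (N (blk k) (lab k)))" for w
  have lin: "linear L"
    by (intro linearI)
      (simp_all add: L_def vec_eq_iff chord_def lift_def inner_add_left add_divide_distrib diff_divide_distrib
        right_diff_distrib)
  have "inj L"
    unfolding linear_injective_0[OF lin]
  proof (intro allI impI)
    fix w assume "L w = 0"
    then have chord0: "chord (height (blk k)) (lift w (blk k)) (lab k) (N (blk k) (lab k)) = 0" for k
      by (simp add: L_def vec_eq_iff)
    have step: "lift w s (N s i) = lift w s i" if s: "s \<in> {1..t}" "i \<in> {1..m s}" for s i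
    proof -
      have "height s i < height s (N s i)" using height_less_iff[OF s(1)] s Nr[OF s] by auto
      then show ?thesis using chord0[of "idx s i"] s by (simp add: blk_idx lab_idx chord_def)
    qed
    \<comment> \<open>\<open>N s\<close> raises labels, so iterating it reaches the top from every
      vertex.\<close>
    have top: "lift w s i = lift w s (m s + 1)" if s: "s \<in> {1..t}" and i: "i \<in> {1..m s + 1}" for s i
      using i
    proof (induction "m s + 1 - i" arbitrary: i rule: less_induct)
      case less
      show ?case
      proof (cases "i = m s + 1")
        case False
        then have i: "i \<in> {1..m s}" using less.prems by auto
        have "lift w s (N s i) = lift w s (m s + 1)"
          using less.hyps[of "N s i"] Nr[OF s i] i by auto
        then show ?thesis using step[OF s i] by simp
      qed simp
    qed
    show "w = 0"
    proof (rule eq_0_if_relative_lifts_0)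
      fix s i assume "s \<in> {1..t}" "i \<in> {1..m s}"
      then show "lift w s i = lift w s (m s + 1)" by (intro top) auto
    qed
  qed
  moreover have "\<Theta> w = L w" if "w \<in> fiber w0" for w
  proof -
    have w: "distinguishing w" "arborescence P c w = arborescence P c w0"
      using that by (auto simp: fiber_def generic_direction_iff)
    have "\<Theta> w $ k = L w $ k" for k
    proof -
      have "steep_targets w (blk k) (lab k) = steep_targets w0 (blk k) (lab k)"
        using arborescence_eq_iff[OF w(1) w0] w(2) blk_range lab_range by blast
      then have "N (blk k) (lab k) \<in> steep_targets w (blk k) (lab k)"
        using N[OF blk_range lab_range] by simp
      then show ?thesis by (simp add: L_def product_slope_map_nth steep_targets_def)
    qed
    then show ?thesis by (simp add: vec_eq_iff)
  qed
  moreover have "closed {w. \<Theta> w = L w}"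
    using continuous_\<Theta> linear_continuous_on[of L UNIV] lin
    by (intro closed_Collect_eq) (auto simp: linear_conv_bounded_linear)
  ultimately have "closure (fiber w0) \<subseteq> {w. \<Theta> w = L w}"
    by (intro closure_minimal) auto
  then show ?thesis using lin \<open>inj L\<close> by blast
qed

text \<open>Closure commutes with the injective linear map that represents \<open>\<Theta>\<close>
  there, and by surjectivity the image of the fiber fills the whole open cell.\<close>

lemma image_closure_fiber:
  assumes w0: "distinguishing w0"
  shows "\<Theta> ` closure (fiber w0) = closed_cell (block_family blk) (\<Theta> w0)"
proof -
  obtain L where L: "linear L" "inj L" "\<forall>w\<in>closure (fiber w0). \<Theta> w = L w"
    using ex_linear_on_closure_fiber[OF w0] by blast
  have "\<Theta> ` closure (fiber w0) = L ` closure (fiber w0)" using L(3) by (intro image_cong) auto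
  also have "\<dots> = closure (L ` fiber w0)" by (rule closure_injective_linear_image[OF L(1,2)])
  also have "L ` fiber w0 = \<Theta> ` fiber w0"
    using L(3) closure_subset[of "fiber w0"] by (intro image_cong) auto
  also have "\<Theta> ` fiber w0 = open_cell (block_family blk) (\<Theta> w0)"
  proof -
    have "fiber w0 = \<Theta> -` open_cell (block_family blk) (\<Theta> w0)"
      using mem_fiber_iff[OF w0] by auto
    then show ?thesis using surj_\<Theta> by (simp add: surj_image_vimage_eq)
  qed
  also have "closure \<dots> = closed_cell (block_family blk) (\<Theta> w0)"
    using closure_open_cell(1) strict_on_\<Theta>_iff w0 by blast
  finally show ?thesis .
qed

text \<open>Surjectivity ensures that no cell is missed: a vector with unique minimizers is the
  image of a generic direction.\<close>

lemma image_max_cones: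
  "(`) \<Theta> ` {closure (fiber w) | w. distinguishing w} =
    {closed_cell (block_family blk) x | x. strict_on (block_family blk) (($) x)}" (is "?A = ?B")
proof (intro equalityI subsetI)
  fix C assume "C \<in> ?A"
  then obtain w where w: "distinguishing w" "C = \<Theta> ` closure (fiber w)" by auto
  then have "C = closed_cell (block_family blk) (\<Theta> w)" using image_closure_fiber by simp
  then show "C \<in> ?B" using w(1) strict_on_\<Theta>_iff by blast
next
  fix C assume "C \<in> ?B"
  then obtain x where x: "C = closed_cell (block_family blk) x" "strict_on (block_family blk) (($) x)" by blast
  obtain w where w: "x = \<Theta> w" using surj_\<Theta> by blast
  then have "distinguishing w" using x(2) strict_on_\<Theta>_iff by blast
  then have "C = \<Theta> ` closure (fiber w)" using x(1) w image_closure_fiber by simp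
  then show "C \<in> ?A" using \<open>distinguishing w\<close> by blast
qed

lemma pl_isomorphism_\<Theta>: "pl_isomorphism \<Theta> (pivot_fan P c) (sylvester_fan t m)"
proof -
  let ?K = "{closure (fiber w) | w. distinguishing w}"
  have syl: "sylvester_fan t m = fan_of_max_cones ((`) \<Theta> ` ?K)"
    unfolding sylvester_fan_eq image_max_cones ..
  have "pl_isomorphism \<Theta> (fan_of_max_cones ?K) (fan_of_max_cones ((`) \<Theta> ` ?K))"
  proof (rule pl_isomorphism_of_max_cones)
    show "complete_fan (fan_of_max_cones ((`) \<Theta> ` ?K))"
      using complete_fan_sylvester_fan syl by simp
    show "bij \<Theta>" using inj_\<Theta> surj_\<Theta> by (simp add: bij_def)
    show "continuous_on UNIV \<Theta>" by (rule continuous_\<Theta>)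
    show "\<exists>L. linear L \<and> inj L \<and> (\<forall>w\<in>C. \<Theta> w = L w)" if "C \<in> ?K" for C
      using that ex_linear_on_closure_fiber by blast
  qed
  then show ?thesis using syl pivot_fan_fibers by simp
qed

end

theorem theorem4p9:
  fixes t :: nat
    and m :: "nat \<Rightarrow> nat"
    and \<Delta> :: "nat \<Rightarrow> (real ^ 'n::{finite,linorder}) set"
    and c :: "real ^ 'n::{finite,linorder}"
    and u :: "nat \<Rightarrow> nat \<Rightarrow> (real ^ 'n::{finite,linorder})"
  assumes dim: "CARD('n) = (\<Sum>s=1..t. m s)"
    and subspace: "\<And>s. s \<in> {1..t} \<Longrightarrow> \<Delta> s \<subseteq> block_space m s"
    and simplex: "\<And>s. s \<in> {1..t} \<Longrightarrow> int (m s) simplex \<Delta> s"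
    and generic: "\<And>s. s \<in> {1..t} \<Longrightarrow> inj_on (\<lambda>v. component m s c \<bullet> v) (vertices (\<Delta> s))"
    and labels: "\<And>s. s \<in> {1..t} \<Longrightarrow>
      increasing_labelling (\<Delta> s) (component m s c) (m s + 1) (u s)"
  shows "pl_isomorphism (product_slope_map m \<Delta> c u)
    (pivot_fan (product_polytope t m \<Delta>) c) (sylvester_fan t m)"
proof -
  interpret simplex_product t m \<Delta> c u
    by unfold_locales (fact dim subspace simplex labels)+
  show ?thesis by (rule pl_isomorphism_\<Theta>)
qed

end
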